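(* Let $\mathcal{J}=\langle U,f,g\rangle$ be a compact nonexpansive control problem with compact invariant set $Y$, and for $\beta\in(0,1)$, $\rho\in(0,1]$ let $$\bar V_{\rho,\beta}(y_0)=\inf_{\mathbf{u}\in\mathcal{U}}\Big\{\beta\int_0^{+\infty}\rho e^{-\rho s}g\big(\mathbf{y}(s,\mathbf{u},y_0)\big)\,ds+(1-\beta)\limsup_{t\to\infty}\frac1t\int_0^t g\big(\mathbf{y}(s,\mathbf{u},y_0)\big)\,ds\Big\}$$ be the $(\beta,\rho)$-weighted average value. Then for any $\beta\in(0,1)$ and every $y_0\in Y$, $$\lim_{\rho\to0}\bar V_{\rho,\beta}(y_0)=V^*(y_0),$$ where $V^*$ is the general uniform value of $\mathcal{J}$, given by $$V^*(y_0)=\sup_{\theta\in\Delta(\mathbb{R}_+)}\ \inf_{s\in\mathbb{R}_+}\ \inf_{\mathbf{u}\in\mathcal{U}}\int_{0}^{\infty} g\big(\mathbf{y}(t+s,\mathbf{u},y_0)\big)\,d\theta(t),\qquad y_0\in Y.$$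
   Context: Setting. $U$ is a compact subset of a separable metric space. A (pure) control is a measurable function $\mathbf{u}:\mathbb{R}_+\to U$; $\mathcal{U}$ is the set of all controls. Consider $\mathbf{y}'(t)=f(\mathbf{y}(t),\mathbf{u}(t))$, $\mathbf{y}(0)=y_0\in\mathbb{R}^d$. Standing assumptions: the running cost $g:\mathbb{R}^d\times U\to\mathbb{R}$ is Borel measurable and bounded; $f:\mathbb{R}^d\times U\to\mathbb{R}^d$ is Borel measurable, there is $L\ge 0$ with $\|f(y,u)-f(\bar y,u)\|\le L\|y-\bar y\|$ for all $y,\bar y\in\mathbb{R}^d$, $u\in U$, and there is $a>0$ with $\|f(y,u)\|\le a(1+\|y\|)$ for all $(y,u)$. Then for every $y_0$ and $\mathbf{u}\in\mathcal{U}$ there is a unique absolutely continuous solution on $\mathbb{R}_+$, denoted $t\mapsto\mathbf{y}(t,\mathbf{u},y_0)$. Compact nonexpansive. $\mathcal{J}=\langle U,f,g\rangle$ is compact nonexpansive if: (i) there is a compact set $Y\subseteq\mathbb{R}^d$ that is invariant: $\mathbf{y}(t,\mathbf{u},y_0)\in Y$ for all $t\ge0$, $\mathbf{u}\in\mathcal{U}$, $y_0\in Y$; (ii) $g$ does not depend on $u$ and is continuous in $y\in Y$ (write $g(y)$); (iii) for all $y_1,y_2\in\mathbb{R}^d$, $\sup_{a\in U}\inf_{b\in U}\langle y_1-y_2,f(y_1,a)-f(y_2,b)\rangle\le 0$. Evaluations. $\Delta(\mathbb{R}_+)$ is the set of (Borel) probability measures on $\mathbb{R}_+=[0,+\infty)$.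 For $\theta\in\Delta(\mathbb{R}_+)$, $\gamma_\theta(y_0,\mathbf{u})=\int_{[0,+\infty)} g(\mathbf{y}(t,\mathbf{u},y_0))\,d\theta(t)$ and $V_\theta(y_0)=\inf_{\mathbf{u}\in\mathcal{U}}\gamma_\theta(y_0,\mathbf{u})$. For $s\ge 0$, $TV_s(\theta)=\max_{Q\in\mathcal{B}(\mathbb{R}_+)}|\theta(Q)-\theta(Q+s)|$, with $\mathcal{B}(\mathbb{R}_+)$ the Borel subsets of $\mathbb{R}_+$. Random controls. A random control is a pair $((\Omega,\mathcal{B}(\Omega),\lambda),\mathbf{u})$ with $(\Omega,\mathcal{B}(\Omega),\lambda)$ a standard Borel probability space and $\mathbf{u}:Y\times\Omega\times[0,+\infty)\to U$ Borel measurable; $\mathbf{u}_\omega(y_0)=\mathbf{u}(y_0,\omega,\cdot)\in\mathcal{U}$ and $\gamma_\theta(y_0,\mathbf{u})=\int_\Omega\gamma_\theta(y_0,\mathbf{u}_\omega(y_0))\,d\lambda(\omega)$. General uniform value. A function $V:Y\to\mathbb{R}$ is the general uniform value of $\mathcal{J}$ if (1) for each $\varepsilon>0$ there are $\eta>0,S>0$ such that every $\theta\in\Delta(\mathbb{R}_+)$ with $\sup_{0\le s\le S}TV_s(\theta)\le\eta$ satisfies $|V_\theta(y_0)-V(y_0)|\le\varepsilon$ for all $y_0\in Y$; and (2) for each $\varepsilon>0$ there are $\eta>0$, $S>0$ and a random control $\mathbf{u}$ such that every $\theta\in\Delta(\mathbb{R}_+)$ with $\sup_{0\le s\le S}TV_s(\theta)\le\eta$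 satisfies $\gamma_\theta(y_0,\mathbf{u})\le V(y_0)+\varepsilon$ for all $y_0\in Y$. In the paper, the general uniform value of a compact nonexpansive problem is the function $V^*$ displayed in the claim. *)

theory Defs
  imports "HOL-Probability.Probability"
begin

text \<open>
  The state space \<open>\<real>\<^sup>d\<close> is an arbitrary type \<open>'a::euclidean_space\<close>; the separable metric space
  containing \<open>U\<close> is an arbitrary type \<open>'u\<close> of sort \<open>{metric_space, second_countable_topology}\<close>.
\<close>

abbreviation half_line :: "real measure" where
  "half_line \<equiv> restrict_space borel {0..}"

text \<open>
  A control is used only at times \<open>t \<ge> 0\<close>; its values at negative times are irrelevant.
  Measurability is Borel measurability: replacing Lebesgue measurable controls by Borel ones
  modifies them on null sets only, which does not affect the trajectories.
\<close>

definition controls :: "'u::{metric_space, second_countable_topology} set \<Rightarrow> (real \<Rightarrow> 'u) set" where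
  "controls U = half_line \<rightarrow>\<^sub>M restrict_space borel U"

definition control_problem ::
  "'u::{metric_space, second_countable_topology} set \<Rightarrow> ('a::euclidean_space \<Rightarrow> 'u \<Rightarrow> 'a)
    \<Rightarrow> ('a \<Rightarrow> 'u \<Rightarrow> real) \<Rightarrow> bool" where
  "control_problem U f g \<longleftrightarrow>
     compact U \<and> U \<noteq> {} \<and>
     (\<lambda>(y, u). g y u) \<in> borel \<Otimes>\<^sub>M restrict_space borel U \<rightarrow>\<^sub>M borel \<and>
     (\<exists>M. \<forall>y. \<forall>u\<in>U. \<bar>g y u\<bar> \<le> M) \<and>
     (\<lambda>(y, u). f y u) \<in> borel \<Otimes>\<^sub>M restrict_space borel U \<rightarrow>\<^sub>M borel \<and>
     (\<exists>L\<ge>0. \<forall>y y'. \<forall>u\<in>U. norm (f y u - f y' u) \<le> L * norm (y - y')) \<and>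
     (\<exists>a>0. \<forall>y. \<forall>u\<in>U. norm (f y u) \<le> a * (1 + norm y))"

text \<open>
  Absolute continuity on every compact interval \<open>[0, T]\<close>. The members \<open>k\<close> of a division are
  compact intervals \<open>[Inf k, Sup k]\<close> with pairwise disjoint interiors.
\<close>

definition locally_abs_continuous :: "(real \<Rightarrow> 'a::euclidean_space) \<Rightarrow> bool" where
  "locally_abs_continuous y \<longleftrightarrow>
     (\<forall>T\<ge>0. \<forall>\<epsilon>>0. \<exists>\<delta>>0. \<forall>\<D> S. \<D> division_of S \<and> S \<subseteq> {0..T} \<and> (\<Sum>k\<in>\<D>. Sup k - Inf k) < \<delta>
        \<longrightarrow> (\<Sum>k\<in>\<D>. norm (y (Sup k) - y (Inf k))) < \<epsilon>)"

definition is_solution ::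
  "('a::euclidean_space \<Rightarrow> 'u \<Rightarrow> 'a) \<Rightarrow> (real \<Rightarrow> 'u) \<Rightarrow> 'a \<Rightarrow> (real \<Rightarrow> 'a) \<Rightarrow> bool" where
  "is_solution f u y0 y \<longleftrightarrow>
     locally_abs_continuous y \<and> y 0 = y0 \<and>
     (AE t in lborel. t > 0 \<longrightarrow> (y has_vector_derivative f (y t) (u t)) (at t))"

text \<open>
  Under \<open>control_problem\<close>, for \<open>u \<in> controls U\<close>, a solution exists and is unique on \<open>[0, \<infinity>)\<close>;
  the choice operator only selects its values at negative times, which are never used.
\<close>

definition trajectory ::
  "('a::euclidean_space \<Rightarrow> 'u \<Rightarrow> 'a) \<Rightarrow> (real \<Rightarrow> 'u) \<Rightarrow> 'a \<Rightarrow> real \<Rightarrow> 'a" where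
  "trajectory f u y0 = (SOME y. is_solution f u y0 y)"

text \<open>
  The running cost \<open>g(y(t), u(t))\<close>; in a compact nonexpansive problem it is \<open>g(y(t))\<close>.
\<close>

definition running_cost ::
  "('a::euclidean_space \<Rightarrow> 'u \<Rightarrow> 'a) \<Rightarrow> ('a \<Rightarrow> 'u \<Rightarrow> real) \<Rightarrow> (real \<Rightarrow> 'u) \<Rightarrow> 'a \<Rightarrow> real \<Rightarrow> real" where
  "running_cost f g u y0 t = g (trajectory f u y0 t) (u t)"

definition compact_nonexpansive ::
  "'u::{metric_space, second_countable_topology} set \<Rightarrow> ('a::euclidean_space \<Rightarrow> 'u \<Rightarrow> 'a)
    \<Rightarrow> ('a \<Rightarrow> 'u \<Rightarrow> real) \<Rightarrow> 'a set \<Rightarrow> bool" where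
  "compact_nonexpansive U f g Y \<longleftrightarrow>
     control_problem U f g \<and>
     compact Y \<and> (\<forall>y0\<in>Y. \<forall>u\<in>controls U. \<forall>t\<ge>0. trajectory f u y0 t \<in> Y) \<and>
     (\<forall>y. \<forall>a\<in>U. \<forall>b\<in>U. g y a = g y b) \<and> (\<forall>a\<in>U. continuous_on Y (\<lambda>y. g y a)) \<and>
     (\<forall>y1 y2. (SUP a\<in>U. INF b\<in>U. (y1 - y2) \<bullet> (f y1 a - f y2 b)) \<le> 0)"

definition evaluations :: "real measure set" where
  "evaluations = {\<theta>. prob_space \<theta> \<and> sets \<theta> = sets half_line}"

definition payoff ::
  "('a::euclidean_space \<Rightarrow> 'u \<Rightarrow> 'a) \<Rightarrow> ('a \<Rightarrow> 'u \<Rightarrow> real) \<Rightarrow> real measure \<Rightarrow> 'a \<Rightarrow> (real \<Rightarrow> 'u) \<Rightarrow> real" where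
  "payoff f g \<theta> y0 u = (LINT t|\<theta>. running_cost f g u y0 t)"

definition eval_value ::
  "'u::{metric_space, second_countable_topology} set \<Rightarrow> ('a::euclidean_space \<Rightarrow> 'u \<Rightarrow> 'a)
    \<Rightarrow> ('a \<Rightarrow> 'u \<Rightarrow> real) \<Rightarrow> real measure \<Rightarrow> 'a \<Rightarrow> real" where
  "eval_value U f g \<theta> y0 = (INF u\<in>controls U. payoff f g \<theta> y0 u)"

definition TV :: "real \<Rightarrow> real measure \<Rightarrow> real" where
  "TV s \<theta> = (SUP Q\<in>sets half_line. \<bar>measure \<theta> Q - measure \<theta> ((\<lambda>t. t + s) ` Q)\<bar>)"

text \<open>\<open>M\<close> carries the Borel sets of a Polish (separable completely metrizable) topology.\<close>

definition standard_borel :: "'w measure \<Rightarrow> bool" where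
  "standard_borel M \<longleftrightarrow>
     (\<exists>T. completely_metrizable_space T \<and> second_countable T \<and> topspace T = space M \<and>
          sets M = sigma_sets (space M) {V. openin T V})"

definition random_control ::
  "'u::{metric_space, second_countable_topology} set \<Rightarrow> 'a::euclidean_space set
    \<Rightarrow> 'w measure \<Rightarrow> ('a \<Rightarrow> 'w \<Rightarrow> real \<Rightarrow> 'u) \<Rightarrow> bool" where
  "random_control U Y \<Lambda> u \<longleftrightarrow>
     standard_borel \<Lambda> \<and> prob_space \<Lambda> \<and>
     (\<lambda>(y, \<omega>, t). u y \<omega> t)
       \<in> restrict_space borel Y \<Otimes>\<^sub>M (\<Lambda> \<Otimes>\<^sub>M half_line) \<rightarrow>\<^sub>M restrict_space borel U"

definition random_payoff ::
  "('a::euclidean_space \<Rightarrow> 'u \<Rightarrow> 'a) \<Rightarrow> ('a \<Rightarrow> 'u \<Rightarrow> real) \<Rightarrow> real measure \<Rightarrow> 'a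
    \<Rightarrow> 'w measure \<Rightarrow> ('a \<Rightarrow> 'w \<Rightarrow> real \<Rightarrow> 'u) \<Rightarrow> real" where
  "random_payoff f g \<theta> y0 \<Lambda> u = (LINT \<omega>|\<Lambda>. payoff f g \<theta> y0 (u y0 \<omega>))"

text \<open>
  One cannot quantify over the type of sample points, so they are taken to be real numbers (with an
  arbitrary standard Borel structure on a set of reals). This is no restriction, since every
  standard Borel space is Borel isomorphic to a Borel subset of the real line.
\<close>

definition general_uniform_value ::
  "'u::{metric_space, second_countable_topology} set \<Rightarrow> ('a::euclidean_space \<Rightarrow> 'u \<Rightarrow> 'a)
    \<Rightarrow> ('a \<Rightarrow> 'u \<Rightarrow> real) \<Rightarrow> 'a set \<Rightarrow> ('a \<Rightarrow> real) \<Rightarrow> bool" where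
  "general_uniform_value U f g Y V \<longleftrightarrow>
     (\<forall>\<epsilon>>0. \<exists>\<eta>>0. \<exists>S>0. \<forall>\<theta>\<in>evaluations. (SUP s\<in>{0..S}. TV s \<theta>) \<le> \<eta> \<longrightarrow>
        (\<forall>y0\<in>Y. \<bar>eval_value U f g \<theta> y0 - V y0\<bar> \<le> \<epsilon>)) \<and>
     (\<forall>\<epsilon>>0. \<exists>\<eta>>0. \<exists>S>0. \<exists>(\<Lambda> :: real measure) u. random_control U Y \<Lambda> u \<and>
        (\<forall>\<theta>\<in>evaluations. (SUP s\<in>{0..S}. TV s \<theta>) \<le> \<eta> \<longrightarrow>
          (\<forall>y0\<in>Y. random_payoff f g \<theta> y0 \<Lambda> u \<le> V y0 + \<epsilon>)))"

definition V_star ::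
  "'u::{metric_space, second_countable_topology} set \<Rightarrow> ('a::euclidean_space \<Rightarrow> 'u \<Rightarrow> 'a)
    \<Rightarrow> ('a \<Rightarrow> 'u \<Rightarrow> real) \<Rightarrow> 'a \<Rightarrow> real" where
  "V_star U f g y0 =
     (SUP \<theta>\<in>evaluations. INF s\<in>{0..}. INF u\<in>controls U. LINT t|\<theta>. running_cost f g u y0 (t + s))"

text \<open>
  The upper limit is taken in the extended reals, where the library's \<open>Limsup\<close> lives;
  it is finite because the running cost is bounded.
\<close>

definition weighted_value ::
  "'u::{metric_space, second_countable_topology} set \<Rightarrow> ('a::euclidean_space \<Rightarrow> 'u \<Rightarrow> 'a)
    \<Rightarrow> ('a \<Rightarrow> 'u \<Rightarrow> real) \<Rightarrow> real \<Rightarrow> real \<Rightarrow> 'a \<Rightarrow> real" where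
  "weighted_value U f g \<rho> \<beta> y0 =
     (INF u\<in>controls U.
        \<beta> * (LINT s:{0..}|lborel. \<rho> * exp (- \<rho> * s) * running_cost f g u y0 s) +
        (1 - \<beta>) * real_of_ereal (Limsup at_top
          (\<lambda>t. ereal (1 / t * (LINT s:{0..t}|lborel. running_cost f g u y0 s)))))"

end

theory Submission
  imports Defs
begin

text \<open>
  The proof rests on a shadowing property. In the nonexpansivity condition the actions \<open>a\<close> and \<open>b\<close>
  enter the scalar product additively, so a good \<open>b\<close> can be chosen before \<open>a\<close> is known: for two
  current states \<open>p\<close> and \<open>q\<close>, one constant action answers every control that the first trajectory may
  use, and over a time step \<open>d\<close> the squared distance of the two trajectories grows by at most a
  constant times \<open>d\<^sup>2\<close> (\<open>one_step\<close>). The steps \<open>h / (k + 1)\<close> have an infinite sum, but the sum of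
  their squares is of order \<open>h\<^sup>2\<close>. Hence every trajectory can be shadowed from every other initial
  state on the whole half-line, with an error equal to the initial distance plus a multiple of \<open>h\<close>
  (\<open>shadow\<close>). As \<open>Y\<close> is compact, finitely many actions suffice in each step. Up to a small error it is
  thus enough to consider controls coded by sequences of digits, where each digit takes finitely many
  values and the state at time \<open>t\<close> depends on finitely many digits. Total boundedness of the reachable
  set also reduces the initial delay \<open>s\<close> in the definition of \<open>V\<^sup>*\<close> to finitely many values
  (\<open>finitely_many_shifts\<close>).

  Convergence of \<open>V\<^sub>\<theta>\<close> to \<open>V\<^sup>*\<close>: if \<open>TV\<^sub>s(\<theta>)\<close> is small for all \<open>s \<le> S\<close>, then a shift of time by such
  an \<open>s\<close> hardly changes an integral with respect to \<open>\<theta>\<close> (\<open>integral_shift_TV\<close>). Since only finitely many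
  delays matter, delaying does not help and \<open>V\<^sub>\<theta> \<le> V\<^sup>* + \<epsilon>\<close>. For the converse one averages the payoff over
  shifts distributed according to an evaluation that is nearly optimal in \<open>V\<^sup>*\<close> and exchanges the
  integrals (\<open>average_of_shifts\<close>). By shadowing, the functions \<open>V\<^sub>\<theta>\<close> and \<open>V\<^sup>*\<close> are equicontinuous, so the
  estimates are uniform on \<open>Y\<close> (\<open>limit_value_uniform\<close>).

  Weighted values: by the first part, applied to uniform distributions on \<open>[0, T]\<close>, some control has
  an average close to \<open>V\<^sup>*\<close> on \<open>[0, T]\<close>. Restarted at the time when its accumulated excess over
  \<open>V\<^sup>* + 3\<epsilon>\<close> is maximal, it has all its averages below \<open>V\<^sup>* + 3\<epsilon>\<close> on a horizon proportional to \<open>T\<close>.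
  Replacing the restart by one of finitely many delays and using the compactness of the space of digit
  sequences, one gets a single control with \<open>\<integral>\<^sub>0\<^sup>t g \<le> t (V\<^sup>* + \<epsilon>) + K\<close> for all \<open>t\<close> (\<open>pure_uniform\<close>). It is
  good for the Abel mean and for the upper limit of the Cesaro means at the same time, which bounds the
  weighted value from above; from below each of the two means is at least \<open>V\<^sup>* - \<epsilon>\<close> by the first part.

  The random control: start the same control at a random time \<open>r h\<close> with \<open>r\<close> uniform on
  \<open>{0, \<dots>, N}\<close>. For large \<open>N\<close> the expected cost at each fixed time is at most \<open>V\<^sup>* + 3\<epsilon>\<close>. The random
  restarts are replaced by finitely many delays, and the laws of the digit sequences obtained for
  \<open>N = 1, 2, \<dots>\<close> have a limit law (\<open>limit_law\<close>), for which the bound holds at all times; the remaining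
  bounded delay is harmless for a regular evaluation. This is done for a finite net of initial states;
  from the other initial states one shadows, and the shadowing control depends measurably on the initial
  state and on the digits (\<open>random_control_exists\<close>).
\<close>

section \<open>Absolutely continuous functions and indefinite integrals\<close>

text \<open>
  This form of the fundamental theorem of calculus is obtained directly from the gauge definition of
  the integral. Tags outside the exceptional null set are controlled by differentiability. Tags in the
  null set are confined to an open set of small measure, where absolute continuity makes the total
  increment of \<open>y\<close> small.
\<close>

lemma has_integral_locally_abs_continuous:
  fixes y \<phi> :: "real \<Rightarrow> 'a::euclidean_space"
  assumes ac: "locally_abs_continuous y" and T: "0 \<le> T"
    and deriv: "AE t in lborel. t > 0 \<longrightarrow> (y has_vector_derivative \<phi> t) (at t)"
  shows "(\<phi> has_integral (y T - y 0)) {0..T}"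
proof -
  define N where "N = {t. \<not> (t > 0 \<longrightarrow> (y has_vector_derivative \<phi> t) (at t))} \<union> {0}"
  have "AE t in lebesgue. t > 0 \<longrightarrow> (y has_vector_derivative \<phi> t) (at t)"
    using deriv by (rule AE_completion)
  then have negN: "negligible N"
    unfolding N_def by (intro negligible_Un) (auto simp: negligible_iff_null_sets AE_iff_null_sets
        eventually_ae_filter completion.complete2 null_sets_completion_subset)
  \<comment> \<open>With value 0 on the null set, tags in it contribute nothing to the Riemann sums.\<close>
  define \<phi>' where "\<phi>' t = (if t \<in> N then 0 else \<phi> t)" for t
  have "(\<phi>' has_integral (y T - y 0)) (cbox 0 T)"
    unfolding has_integral
  proof (intro allI impI)
    fix e :: real assume e: "e > 0"
    obtain \<delta> where \<delta>: "\<delta> > 0" "\<And>\<D> S. \<D> division_of S \<Longrightarrow> S \<subseteq> {0..T} \<Longrightarrow> (\<Sum>k\<in>\<D>. Sup k - Inf k) < \<delta>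
        \<Longrightarrow> (\<Sum>k\<in>\<D>. norm (y (Sup k) - y (Inf k))) < e / 2"
      using ac T e unfolding locally_abs_continuous_def by (meson half_gt_zero)
    have "N \<in> sets lebesgue" using negN negligible_imp_sets by blast
    then obtain G where G: "open G" "N \<subseteq> G" "(G - N) \<in> lmeasurable" "emeasure lebesgue (G - N) < ennreal \<delta>"
      using sets_lebesgue_outer_open \<delta>(1) by metis
    have GN: "G = (G - N) \<union> N" using G by auto
    have Glm: "G \<in> lmeasurable"
      by (subst GN) (intro fmeasurable.Un G negligible_imp_measurable negN)
    have mG: "measure lebesgue G < \<delta>"
    proof -
      have "measure lebesgue G = measure lebesgue (G - N)"
        using measure_Un_null_set[of "G - N" lebesgue N] G negN GN by (auto simp: negligible_iff_null_sets)
      also have "\<dots> < \<delta>"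
        using G(3,4) \<delta> by (simp add: emeasure_eq_measure2 ennreal_less_iff)
      finally show ?thesis .
    qed
    define e' where "e' = e / (2 * (T + 1))"
    have e': "e' > 0" using e T by (auto simp: e'_def)
    have "\<exists>d>0. \<forall>s. \<bar>s - t\<bar> < d \<longrightarrow> norm (y s - y t - (s - t) *\<^sub>R \<phi> t) \<le> e' * \<bar>s - t\<bar>"
      if "t > 0" "t \<notin> N" for t
    proof -
      have "(y has_vector_derivative \<phi> t) (at t)" using that by (auto simp: N_def)
      then show ?thesis using e'
        unfolding has_vector_derivative_def has_derivative_at_alt by (auto simp: real_norm_def)
    qed
    then obtain d where d: "\<And>t. t > 0 \<Longrightarrow> t \<notin> N \<Longrightarrow> d t > 0 \<and>
        (\<forall>s. \<bar>s - t\<bar> < d t \<longrightarrow> norm (y s - y t - (s - t) *\<^sub>R \<phi> t) \<le> e' * \<bar>s - t\<bar>)"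
      by metis
    define \<gamma> where "\<gamma> t = (if t \<in> N then G else if t > 0 then ball t (d t) else UNIV)" for t
    have gauge: "gauge \<gamma>"
      using G d by (auto simp: gauge_def \<gamma>_def)
    show "\<exists>\<gamma>. gauge \<gamma> \<and> (\<forall>\<D>. \<D> tagged_division_of cbox 0 T \<and> \<gamma> fine \<D> \<longrightarrow>
        norm ((\<Sum>(x, k)\<in>\<D>. measure lborel k *\<^sub>R \<phi>' x) - (y T - y 0)) < e)"
    proof (intro exI conjI allI impI, rule gauge, elim conjE)
      fix p assume p: "p tagged_division_of cbox 0 T" and fine: "\<gamma> fine p"
      have finp: "finite p" using p by blast
      have tele: "y T - y 0 = (\<Sum>(x,K)\<in>p. y (Sup K) - y (Inf K))"
        using additive_tagged_division_1[OF T, of p y] p by simp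
      define pN where "pN = {xK\<in>p. fst xK \<in> N}"
      define pC where "pC = {xK\<in>p. fst xK \<notin> N}"
      have split: "p = pN \<union> pC" "pN \<inter> pC = {}"
        unfolding pN_def pC_def by blast+
      have finN: "finite pN" "finite pC"
        using finp split(1) by simp_all
      have interv: "\<exists>a b. K = {a..b} \<and> 0 \<le> a \<and> a \<le> x \<and> x \<le> b \<and> b \<le> T" if xK: "(x,K) \<in> p" for x K
      proof -
        obtain a b where K: "K = cbox a b" using tagged_division_ofD(4)[OF p xK] by blast
        have "x \<in> K" "K \<subseteq> cbox 0 T" using tagged_division_ofD(2,3)[OF p xK] by simp_all
        with K have "K = {a..b} \<and> 0 \<le> a \<and> a \<le> x \<and> x \<le> b \<and> b \<le> T" by simp
        then show ?thesis by blast
      qed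
      have C: "norm (\<Sum>(x,K)\<in>pC. measure lborel K *\<^sub>R \<phi>' x - (y (Sup K) - y (Inf K))) \<le> e' * T"
      proof -
        have "norm (\<Sum>(x,K)\<in>pC. measure lborel K *\<^sub>R \<phi>' x - (y (Sup K) - y (Inf K)))
            \<le> (\<Sum>(x,K)\<in>pC. e' * measure lborel K)"
        proof (rule sum_norm_le, clarify)
          fix x K assume xK: "(x,K) \<in> pC"
          then have "(x,K) \<in> p" by (simp add: pC_def)
          then obtain a b where ab: "K = {a..b}" "0 \<le> a" "a \<le> x" "x \<le> b" "b \<le> T"
            using interv by meson
          have xN: "x \<notin> N" using xK by (auto simp: pC_def)
          then have "x \<noteq> 0" by (auto simp: N_def)
          then have x0: "x > 0" using ab by linarith
          have sub: "K \<subseteq> ball x (d x)" using fineD[OF fine \<open>(x,K) \<in> p\<close>] xN x0 by (simp add: \<gamma>_def)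
          have "b \<in> K" "a \<in> K" using ab by auto
          then have "b \<in> ball x (d x)" "a \<in> ball x (d x)" using sub by blast+
          then have "\<bar>b - x\<bar> < d x" "\<bar>a - x\<bar> < d x" by (simp_all add: dist_real_def abs_minus_commute)
          then have 1: "norm (y b - y x - (b - x) *\<^sub>R \<phi> x) \<le> e' * (b - x)"
            and 2: "norm (y a - y x - (a - x) *\<^sub>R \<phi> x) \<le> e' * (x - a)"
            using conjunct2[OF d[OF x0 xN], rule_format, of b] conjunct2[OF d[OF x0 xN], rule_format, of a] ab
            by simp_all
          have "measure lborel K *\<^sub>R \<phi>' x - (y (Sup K) - y (Inf K)) =
             (y a - y x - (a - x) *\<^sub>R \<phi> x) - (y b - y x - (b - x) *\<^sub>R \<phi> x)"
            using ab xN by (simp add: \<phi>'_def algebra_simps)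
          then have "norm (measure lborel K *\<^sub>R \<phi>' x - (y (Sup K) - y (Inf K))) \<le> e' * (x - a) + e' * (b - x)"
            using norm_triangle_le_diff[OF add_mono[OF 2 1]] by simp
          also have "\<dots> = e' * measure lborel K" using ab by (simp add: algebra_simps)
          finally show "norm (measure lborel K *\<^sub>R \<phi>' x - (y (Sup K) - y (Inf K))) \<le> e' * measure lborel K" .
        qed
        also have "\<dots> \<le> (\<Sum>(x,K)\<in>p. e' * measure lborel K)"
          using finp e' by (intro sum_mono2) (auto simp: pC_def)
        also have "\<dots> = e' * (\<Sum>(x,K)\<in>p. measure lborel K)"
          by (simp add: sum_distrib_left split_def)
        also have "(\<Sum>(x,K)\<in>p. measure lborel K) = measure lborel (cbox 0 T)"
          using additive_content_tagged_division[OF p] by simp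
        also have "\<dots> = T" using T by simp
        finally show ?thesis .
      qed
      have tpd: "pN tagged_partial_division_of cbox 0 T"
        using p tagged_partial_division_subset[of p "cbox 0 T" pN] by (auto simp: pN_def tagged_division_of_def)
      then have div: "(snd ` pN) division_of \<Union>(snd ` pN)"
        by (rule partial_division_of_tagged_division)
      have "(\<Sum>K\<in>snd ` pN. Sup K - Inf K) = (\<Sum>K\<in>snd ` pN. measure lborel K)"
        by (rule sum.cong) (use interv in \<open>fastforce simp: pN_def\<close>)+
      also have "\<dots> = measure lebesgue (\<Union>(snd ` pN))"
      proof -
        have "sum (measure lborel) (snd ` pN) = sum (measure lebesgue) (snd ` pN)"
          by (rule sum.cong) (use interv in \<open>fastforce simp: pN_def\<close>)+
        then show ?thesis using content_division[OF div] by simp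
      qed
      also have "\<dots> \<le> measure lebesgue G"
      proof (rule measure_mono_fmeasurable)
        show "\<Union>(snd ` pN) \<subseteq> G" using fineD[OF fine] by (fastforce simp: pN_def \<gamma>_def)
        show "\<Union>(snd ` pN) \<in> sets lebesgue" using div lmeasurable_division by blast
      qed (rule Glm)
      finally have "(\<Sum>K\<in>snd ` pN. Sup K - Inf K) < \<delta>" using mG by simp
      moreover have "\<Union>(snd ` pN) \<subseteq> {0..T}" using interv by (fastforce simp: pN_def)
      ultimately have "(\<Sum>K\<in>snd ` pN. norm (y (Sup K) - y (Inf K))) < e / 2"
        using \<delta>(2) div by blast
      moreover have "(\<Sum>(x,K)\<in>pN. norm (y (Sup K) - y (Inf K))) = (\<Sum>K\<in>snd ` pN. norm (y (Sup K) - y (Inf K)))"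
      proof -
        \<comment> \<open>Summing over intervals instead of tags needs a function that vanishes on the empty interval.\<close>
        define D where "D K = (if K = {} then 0 else norm (y (Sup K) - y (Inf K)))" for K
        have "(\<Sum>(x,K)\<in>pN. D K) = (\<Sum>K\<in>snd ` pN. D K)"
        proof (rule sum.over_tagged_division_lemma)
          show "pN tagged_division_of \<Union>(snd ` pN)"
            using tpd by (rule tagged_partial_division_of_Union_self)
          fix u v :: real assume "box u v = {}"
          then show "D (cbox u v) = 0" by (cases "u = v") (auto simp: D_def)
        qed
        moreover have DK: "D K = norm (y (Sup K) - y (Inf K))" if "(x,K) \<in> pN" for x K
          using interv[of x K] that by (auto simp: pN_def D_def)
        then have "(\<Sum>(x,K)\<in>pN. D K) = (\<Sum>(x,K)\<in>pN. norm (y (Sup K) - y (Inf K)))"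
          by (intro sum.cong) auto
        moreover have "(\<Sum>K\<in>snd ` pN. D K) = (\<Sum>K\<in>snd ` pN. norm (y (Sup K) - y (Inf K)))"
          using DK by (intro sum.cong) auto
        ultimately show ?thesis by simp
      qed
      moreover have "norm (\<Sum>(x,K)\<in>pN. measure lborel K *\<^sub>R \<phi>' x - (y (Sup K) - y (Inf K)))
          \<le> (\<Sum>(x,K)\<in>pN. norm (y (Sup K) - y (Inf K)))"
        by (rule sum_norm_le) (auto simp: pN_def \<phi>'_def norm_minus_commute)
      ultimately have Nb: "norm (\<Sum>(x,K)\<in>pN. measure lborel K *\<^sub>R \<phi>' x - (y (Sup K) - y (Inf K))) < e / 2"
        by linarith
      have "(\<Sum>(x,K)\<in>p. measure lborel K *\<^sub>R \<phi>' x) - (y T - y 0)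
          = (\<Sum>(x,K)\<in>p. measure lborel K *\<^sub>R \<phi>' x - (y (Sup K) - y (Inf K)))"
        unfolding tele by (simp add: sum_subtractf split_def)
      also have "\<dots> = (\<Sum>(x,K)\<in>pN. measure lborel K *\<^sub>R \<phi>' x - (y (Sup K) - y (Inf K)))
         + (\<Sum>(x,K)\<in>pC. measure lborel K *\<^sub>R \<phi>' x - (y (Sup K) - y (Inf K)))"
        by (subst split(1), subst sum.union_disjoint) (use split finN in auto)
      finally have "norm ((\<Sum>(x,K)\<in>p. measure lborel K *\<^sub>R \<phi>' x) - (y T - y 0)) < e / 2 + e' * T"
        using Nb C by (smt (verit) norm_triangle_ineq)
      also have "e' * T \<le> e / 2" using T e by (simp add: e'_def field_simps)
      finally show "norm ((\<Sum>(x,K)\<in>p. measure lborel K *\<^sub>R \<phi>' x) - (y T - y 0)) < e" by simp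
    qed
  qed
  then have "(\<phi>' has_integral (y T - y 0)) {0..T}" by simp
  then show ?thesis
    by (rule has_integral_spike[OF negN, rotated]) (auto simp: \<phi>'_def)
qed

text \<open>
  The theorem on right averages of an integrable function gives the right derivative; applied to the
  reflected function it gives the left derivative.
\<close>

lemma AE_has_vector_derivative_integral:
  fixes \<phi> :: "real \<Rightarrow> 'a::euclidean_space"
  assumes int: "\<And>a b. \<phi> integrable_on {a..b}"
  shows "AE t in lborel. t > 0 \<longrightarrow> ((\<lambda>x. integral {0..x} \<phi>) has_vector_derivative \<phi> t) (at t)"
proof -
  have int1: "\<phi> integrable_on cbox a b" for a b using int by simp
  have int2: "(\<lambda>x. \<phi> (- x)) integrable_on cbox a b" for a b
    using int[of "- b" "- a"] Henstock_Kurzweil_Integration.integrable_reflect_real[where f=\<phi> and a="- b" and b="- a"]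
    by (simp del: Henstock_Kurzweil_Integration.integrable_reflect_real)
  obtain N1 where N1: "negligible N1" "\<And>x e. \<lbrakk>x \<notin> N1; 0 < e\<rbrakk> \<Longrightarrow>
      \<exists>d>0. \<forall>h. 0 < h \<and> h < d \<longrightarrow> norm (integral (cbox x (x + h *\<^sub>R One)) \<phi> /\<^sub>R h ^ DIM(real) - \<phi> x) < e"
    using integrable_ccontinuous_explicit[OF int1] by blast
  obtain N2 where N2: "negligible N2" "\<And>x e. \<lbrakk>x \<notin> N2; 0 < e\<rbrakk> \<Longrightarrow>
      \<exists>d>0. \<forall>h. 0 < h \<and> h < d \<longrightarrow> norm (integral (cbox x (x + h *\<^sub>R One)) (\<lambda>x. \<phi> (- x)) /\<^sub>R h ^ DIM(real) - \<phi> (- x)) < e"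
    using integrable_ccontinuous_explicit[OF int2] by blast
  define N where "N = N1 \<union> uminus ` N2"
  have negN: "negligible N"
    unfolding N_def by (intro negligible_Un N1 negligible_differentiable_image_negligible N2)
      (auto intro!: derivative_intros simp: differentiable_on_def)
  have "((\<lambda>x. integral {0..x} \<phi>) has_vector_derivative \<phi> t) (at t)" if t: "t > 0" "t \<notin> N" for t
    unfolding has_vector_derivative_def has_derivative_at_alt
  proof (intro conjI allI impI)
    fix e :: real assume e: "0 < e"
    have "t \<notin> N1" "- t \<notin> N2" using t by (auto simp: N_def image_iff)
    then obtain d1 d2 where d1: "d1 > 0" "\<And>h. 0 < h \<Longrightarrow> h < d1 \<Longrightarrow> norm (integral {t..t + h} \<phi> /\<^sub>R h - \<phi> t) < e"
      and d2: "d2 > 0" "\<And>h. 0 < h \<Longrightarrow> h < d2 \<Longrightarrow> norm (integral {- t..- t + h} (\<lambda>x. \<phi> (- x)) /\<^sub>R h - \<phi> t) < e"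
      using N1(2)[OF _ e, of t] N2(2)[OF _ e, of "- t"] by (auto simp: cbox_interval)
    have main: "norm (v - h *\<^sub>R \<phi> t) \<le> e * h" if "norm (v /\<^sub>R h - \<phi> t) < e" "h > 0" for h :: real and v :: 'a
    proof -
      have "v - h *\<^sub>R \<phi> t = h *\<^sub>R (v /\<^sub>R h - \<phi> t)" using that by (simp add: algebra_simps)
      then have "norm (v - h *\<^sub>R \<phi> t) = h * norm (v /\<^sub>R h - \<phi> t)" using that by (metis abs_of_pos norm_scaleR)
      then show ?thesis using that by (simp add: mult.commute mult_left_mono)
    qed
    show "\<exists>d>0. \<forall>y. norm (y - t) < d \<longrightarrow>
       norm (integral {0..y} \<phi> - integral {0..t} \<phi> - (y - t) *\<^sub>R \<phi> t) \<le> e * norm (y - t)"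
    proof (intro exI conjI allI impI)
      show "0 < min t (min d1 d2)" using t d1 d2 by simp
      fix y assume y: "norm (y - t) < min t (min d1 d2)"
      consider "y = t" | "y > t" | "y < t" by linarith
      then show "norm (integral {0..y} \<phi> - integral {0..t} \<phi> - (y - t) *\<^sub>R \<phi> t) \<le> e * norm (y - t)"
      proof cases
        case 2
        then have "integral {0..y} \<phi> = integral {0..t} \<phi> + integral {t..y} \<phi>"
          using t Henstock_Kurzweil_Integration.integral_combine[of 0 t y \<phi>] int by simp
        then show ?thesis using main[where h="y - t" and v="integral {t..y} \<phi>"] d1(2)[of "y - t"] y 2 by simp
      next
        case 3
        then have "integral {0..t} \<phi> = integral {0..y} \<phi> + integral {y..t} \<phi>"
          using t y Henstock_Kurzweil_Integration.integral_combine[of 0 y t \<phi>] int by simp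
        moreover have "integral {- t..- y} (\<lambda>x. \<phi> (- x)) = integral {y..t} \<phi>"
          using Henstock_Kurzweil_Integration.integral_reflect_real[of t y \<phi>] by simp
        ultimately have "norm (integral {0..t} \<phi> - integral {0..y} \<phi> - (t - y) *\<^sub>R \<phi> t) \<le> e * (t - y)"
          using main[where h="t - y" and v="integral {y..t} \<phi>"] d2(2)[of "t - y"] y 3 by simp
        moreover have "integral {0..y} \<phi> - integral {0..t} \<phi> - (y - t) *\<^sub>R \<phi> t
           = - (integral {0..t} \<phi> - integral {0..y} \<phi> - (t - y) *\<^sub>R \<phi> t)" by (simp add: algebra_simps)
        ultimately show ?thesis using 3 by (metis abs_of_neg minus_diff_eq norm_minus_cancel real_norm_def diff_less_0_iff_less)
      qed simp
    qed
  qed (auto intro: bounded_linear_intros)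
  then have sub: "{t \<in> space lebesgue. \<not> (t > 0 \<longrightarrow> ((\<lambda>x. integral {0..x} \<phi>) has_vector_derivative \<phi> t) (at t))} \<subseteq> N"
    by auto
  have "N \<in> null_sets lebesgue" using negN by (simp add: negligible_iff_null_sets)
  from AE_I'[OF this sub] show ?thesis by (simp only: AE_completion_iff)
qed

lemma gronwall:
  fixes z :: "real \<Rightarrow> real"
  assumes cont: "continuous_on {0..T} z" and L: "0 \<le> L"
    and le: "\<And>t. t \<in> {0..T} \<Longrightarrow> z t \<le> c + L * integral {0..t} z" and t: "t \<in> {0..T}"
  shows "z t \<le> c * exp (L * t)"
proof -
  define w where "w = (\<lambda>t. exp (- L * t) * (c + L * integral {0..t} z))"
  have "w t \<le> w 0"
  proof (rule DERIV_nonpos_imp_decreasing_open[of 0 t w])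
    show "0 \<le> t" using t by simp
    fix x assume x: "0 < x" "x < t"
    have "((\<lambda>u. integral {0..u} z) has_vector_derivative z x) (at x within {0..T})"
      using integral_has_vector_derivative[OF cont] x t by simp
    then have "((\<lambda>u. integral {0..u} z) has_vector_derivative z x) (at x)"
      using x t by (simp add: at_within_Icc_at)
    then have I: "((\<lambda>u. integral {0..u} z) has_real_derivative z x) (at x)"
      by (simp add: has_real_derivative_iff_has_vector_derivative)
    have "(w has_real_derivative exp (- L * x) * (L * z x) + (- L * exp (- L * x)) * (c + L * integral {0..x} z)) (at x)"
      unfolding w_def by (auto intro!: derivative_eq_intros I)
    moreover have "exp (- L * x) * (L * z x) + (- L * exp (- L * x)) * (c + L * integral {0..x} z)
       = exp (- L * x) * L * (z x - (c + L * integral {0..x} z))" by (simp add: algebra_simps)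
    moreover have "exp (- L * x) * L * (z x - (c + L * integral {0..x} z)) \<le> 0"
      using le[of x] x t L by (intro mult_nonneg_nonpos) auto
    ultimately show "\<exists>y. (w has_real_derivative y) (at x) \<and> y \<le> 0" by metis
  next
    have "continuous_on {0..t} z" using cont t by (auto intro: continuous_on_subset)
    then have "continuous_on {0..t} (\<lambda>u. integral {0..u} z)"
      by (intro indefinite_integral_continuous_1 integrable_continuous_real)
    then show "continuous_on {0..t} w" unfolding w_def by (intro continuous_intros)
  qed
  then have "exp (- L * t) * (c + L * integral {0..t} z) \<le> c" by (simp add: w_def)
  then have "exp (L * t) * (exp (- L * t) * (c + L * integral {0..t} z)) \<le> exp (L * t) * c"
    by (rule mult_left_mono) simp
  then have "c + L * integral {0..t} z \<le> c * exp (L * t)"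
    by (simp add: mult.assoc[symmetric] mult_exp_exp mult.commute)
  then show ?thesis using le[OF t] by linarith
qed

section \<open>Trajectories\<close>

lemma continuous_on_half_line:
  fixes y :: "real \<Rightarrow> 'b::topological_space"
  assumes "\<And>T. 0 \<le> T \<Longrightarrow> continuous_on {0..T} y"
  shows "continuous_on {0..} y"
  unfolding continuous_on_eq_continuous_within
proof
  fix t :: real assume t: "t \<in> {0..}"
  have "at t within {0..} = at t within {0..t + 1}"
    by (rule at_within_nhd[of t "{..<t + 1}"]) auto
  moreover have "continuous (at t within {0..t + 1}) y"
    using assms[of "t + 1"] t by (auto simp: continuous_on_eq_continuous_within)
  ultimately show "continuous (at t within {0..}) y" by simp
qed

lemma locally_abs_continuous_imp_continuous_on:
  fixes y :: "real \<Rightarrow> 'a::euclidean_space"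
  assumes "locally_abs_continuous y"
  shows "continuous_on {0..} y"
proof (rule continuous_on_half_line)
  fix T :: real assume T: "0 \<le> T"
  show "continuous_on {0..T} y"
    unfolding continuous_on_iff
  proof (intro ballI allI impI)
    fix x e :: real assume x: "x \<in> {0..T}" and e: "0 < e"
    obtain d where d: "d > 0" "\<And>\<D> S. \<D> division_of S \<Longrightarrow> S \<subseteq> {0..T} \<Longrightarrow> (\<Sum>k\<in>\<D>. Sup k - Inf k) < d
        \<Longrightarrow> (\<Sum>k\<in>\<D>. norm (y (Sup k) - y (Inf k))) < e"
      using assms T e unfolding locally_abs_continuous_def by meson
    have "dist (y x') (y x) < e" if "x' \<in> {0..T}" "dist x' x < d" for x'
    proof -
      define a b where "a = min x x'" and "b = max x x'"
      have "{cbox a b} division_of cbox a b" by (rule division_of_self) (auto simp: a_def b_def)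
      then have "norm (y b - y a) < e"
        using d(2)[of "{cbox a b}" "cbox a b"] x that
        by (auto simp: a_def b_def min_def max_def dist_real_def split: if_splits)
      then show ?thesis by (auto simp: a_def b_def min_def max_def dist_norm norm_minus_commute split: if_splits)
    qed
    then show "\<exists>d>0. \<forall>x'\<in>{0..T}. dist x' x < d \<longrightarrow> dist (y x') (y x) < e" using d(1) by blast
  qed
qed

lemma locally_abs_continuous_lipschitz:
  fixes y :: "real \<Rightarrow> 'a::euclidean_space"
  assumes "\<And>T. 0 \<le> T \<Longrightarrow> \<exists>C\<ge>0. \<forall>a b. 0 \<le> a \<longrightarrow> a \<le> b \<longrightarrow> b \<le> T \<longrightarrow> norm (y b - y a) \<le> C * (b - a)"
  shows "locally_abs_continuous y"
  unfolding locally_abs_continuous_def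
proof (intro allI impI)
  fix T e :: real assume T: "0 \<le> T" and e: "0 < e"
  obtain C where C: "C \<ge> 0" "\<And>a b. 0 \<le> a \<Longrightarrow> a \<le> b \<Longrightarrow> b \<le> T \<Longrightarrow> norm (y b - y a) \<le> C * (b - a)"
    using assms[OF T] by blast
  show "\<exists>\<delta>>0. \<forall>\<D> S. \<D> division_of S \<and> S \<subseteq> {0..T} \<and> (\<Sum>k\<in>\<D>. Sup k - Inf k) < \<delta> \<longrightarrow>
       (\<Sum>k\<in>\<D>. norm (y (Sup k) - y (Inf k))) < e"
  proof (intro exI[of _ "e / (C + 1)"] conjI allI impI)
    show "0 < e / (C + 1)" using C e by simp
  next
    fix \<D> S assume D: "\<D> division_of S \<and> S \<subseteq> {0..T} \<and> (\<Sum>k\<in>\<D>. Sup k - Inf k) < e / (C + 1)"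
    have "(\<Sum>k\<in>\<D>. norm (y (Sup k) - y (Inf k))) \<le> (\<Sum>k\<in>\<D>. C * (Sup k - Inf k))"
    proof (rule sum_mono)
      fix k assume k: "k \<in> \<D>"
      have "\<D> division_of S" "S \<subseteq> {0..T}" using D by auto
      then have "\<exists>a b. k = cbox a b" "k \<noteq> {}" "k \<subseteq> {0..T}" using k division_ofD(2-4)[of \<D> S k] by auto
      then obtain a b where "k = {a..b}" "a \<le> b" "0 \<le> a" "b \<le> T" by auto
      then show "norm (y (Sup k) - y (Inf k)) \<le> C * (Sup k - Inf k)" using C(2)[of a b] by simp
    qed
    also have "\<dots> = C * (\<Sum>k\<in>\<D>. Sup k - Inf k)" by (simp add: sum_distrib_left)
    also have "\<dots> \<le> C * (e / (C + 1))" using D C by (intro mult_left_mono) auto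
    also have "\<dots> < e" using C e by (simp add: field_simps)
    finally show "(\<Sum>k\<in>\<D>. norm (y (Sup k) - y (Inf k))) < e" .
  qed
qed

lemma borel_measurable_restrict_lebesgue_on:
  fixes \<phi> :: "real \<Rightarrow> 'a::euclidean_space"
  assumes "\<phi> \<in> borel_measurable (restrict_space borel S)" "S \<in> sets borel"
  shows "\<phi> \<in> borel_measurable (lebesgue_on S)"
proof -
  have "(\<lambda>x. indicator S x *\<^sub>R \<phi> x) \<in> borel_measurable lborel"
    using assms borel_measurable_restrict_space_iff[of S borel \<phi>] by simp
  then have "(\<lambda>x. indicator S x *\<^sub>R \<phi> x) \<in> borel_measurable lebesgue" by (rule measurable_completion)
  then show ?thesis using assms borel_measurable_restrict_space_iff[of S lebesgue \<phi>] by simp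
qed

lemma half_line_measurable_imp_integrable_on:
  fixes \<phi> :: "real \<Rightarrow> 'a::euclidean_space"
  assumes "\<phi> \<in> borel_measurable half_line" "\<And>t. t \<in> {a..b} \<Longrightarrow> norm (\<phi> t) \<le> B" "0 \<le> a"
  shows "\<phi> integrable_on {a..b}"
proof (rule measurable_bounded_by_integrable_imp_integrable)
  have "\<phi> \<in> borel_measurable (restrict_space borel {a..b})"
    using assms(1,3) by (auto intro: measurable_restrict_mono)
  then show "\<phi> \<in> borel_measurable (lebesgue_on {a..b})" by (rule borel_measurable_restrict_lebesgue_on) simp
  show "(\<lambda>_. B) integrable_on {a..b}" by (rule integrable_const_ivl)
qed (use assms in auto)

lemma shift_in_controls:
  assumes "u \<in> controls U" "0 \<le> s"
  shows "(\<lambda>t. u (t + s)) \<in> controls U"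
proof -
  have "(\<lambda>t. t + s) \<in> half_line \<rightarrow>\<^sub>M half_line"
    by (rule measurable_restrict_space3) (use assms in auto)
  then show ?thesis using assms(1) unfolding controls_def by (rule measurable_compose)
qed

lemma controls_in: "u \<in> controls U \<Longrightarrow> 0 \<le> t \<Longrightarrow> u t \<in> U"
  unfolding controls_def by (auto dest!: measurable_space simp: space_restrict_space)

lemma const_in_controls: "a \<in> U \<Longrightarrow> (\<lambda>_. a) \<in> controls U"
  unfolding controls_def by (simp add: space_restrict_space)

lemma continuous_on_halfline_measurable:
  "continuous_on {0..} y \<Longrightarrow> y \<in> borel_measurable half_line"
  by (rule borel_measurable_continuous_on_restrict)

lemma has_integral_power_div_fact:
  fixes t :: real
  assumes "0 \<le> t"
  shows "((\<lambda>s. s ^ n / fact n) has_integral t ^ Suc n / fact (Suc n)) {0..t}"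
proof -
  have "((\<lambda>s. s ^ n / fact n) has_integral (t ^ Suc n / fact (Suc n) - 0 ^ Suc n / fact (Suc n))) {0..t}"
  proof (rule fundamental_theorem_of_calculus[OF assms])
    fix x :: real
    have "((\<lambda>s. s ^ Suc n / fact (Suc n)) has_real_derivative x ^ n / fact n) (at x within {0..t})"
      by (rule derivative_eq_intros refl | simp)+
    then show "((\<lambda>s. s ^ Suc n / fact (Suc n)) has_vector_derivative x ^ n / fact n) (at x within {0..t})"
      by (simp add: has_real_derivative_iff_has_vector_derivative)
  qed
  then show ?thesis by simp
qed

text \<open>
  Under the standing assumptions this is equivalent to \<open>is_solution\<close>; it is easier to iterate, to
  restrict and to translate in time.
\<close>

definition integral_solution ::
  "('a::euclidean_space \<Rightarrow> 'u \<Rightarrow> 'a) \<Rightarrow> (real \<Rightarrow> 'u) \<Rightarrow> 'a \<Rightarrow> (real \<Rightarrow> 'a) \<Rightarrow> bool" where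
  "integral_solution f u y0 y \<longleftrightarrow>
     continuous_on {0..} y \<and> (\<forall>t\<ge>0. ((\<lambda>s. f (y s) (u s)) has_integral (y t - y0)) {0..t})"

lemma is_solution_imp_integral_solution:
  fixes f :: "'a::euclidean_space \<Rightarrow> 'u \<Rightarrow> 'a"
  assumes "is_solution f u y0 y"
  shows "integral_solution f u y0 y"
  using assms has_integral_locally_abs_continuous[of y _ "\<lambda>t. f (y t) (u t)"] locally_abs_continuous_imp_continuous_on[of y]
  unfolding is_solution_def integral_solution_def by auto

locale control_system =
  fixes U :: "'u::{metric_space, second_countable_topology} set"
    and f :: "'a::euclidean_space \<Rightarrow> 'u \<Rightarrow> 'a"
    and g :: "'a \<Rightarrow> 'u \<Rightarrow> real"
  assumes problem: "control_problem U f g"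
begin

definition L where "L = (SOME L. L \<ge> 0 \<and> (\<forall>y y'. \<forall>u\<in>U. norm (f y u - f y' u) \<le> L * norm (y - y')))"

lemma L_nonneg: "0 \<le> L" and f_lipschitz: "u \<in> U \<Longrightarrow> norm (f y u - f y' u) \<le> L * norm (y - y')"
proof -
  have "\<exists>L. L \<ge> 0 \<and> (\<forall>y y'. \<forall>u\<in>U. norm (f y u - f y' u) \<le> L * norm (y - y'))"
    using problem unfolding control_problem_def by blast
  from someI_ex[OF this] show "0 \<le> L" "u \<in> U \<Longrightarrow> norm (f y u - f y' u) \<le> L * norm (y - y')"
    unfolding L_def by blast+
qed

lemma f_growth: obtains a where "a > 0" "\<And>y u. u \<in> U \<Longrightarrow> norm (f y u) \<le> a * (1 + norm y)"
  using problem unfolding control_problem_def by blast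

lemma velocity_measurable:
  assumes "continuous_on {0..} y" "u \<in> controls U"
  shows "(\<lambda>s. f (y s) (u s)) \<in> borel_measurable half_line"
proof -
  have "(\<lambda>s. (y s, u s)) \<in> half_line \<rightarrow>\<^sub>M borel \<Otimes>\<^sub>M restrict_space borel U"
    using assms unfolding controls_def by (intro measurable_Pair continuous_on_halfline_measurable)
  moreover have "(\<lambda>(y, u). f y u) \<in> borel \<Otimes>\<^sub>M restrict_space borel U \<rightarrow>\<^sub>M borel"
    using problem unfolding control_problem_def by blast
  ultimately have "(\<lambda>s. (\<lambda>(y, u). f y u) (y s, u s)) \<in> borel_measurable half_line" by (rule measurable_compose)
  then show ?thesis by simp
qed

lemma velocity_bounded:
  assumes "continuous_on {0..} y" "u \<in> controls U"
  obtains B where "B > 0" "\<And>t. t \<in> {0..T} \<Longrightarrow> norm (f (y t) (u t)) \<le> B"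
proof -
  have "compact (y ` {0..T})"
    using assms(1) by (intro compact_continuous_image) (auto intro: continuous_on_subset)
  then obtain b where b: "b > 0" "\<And>t. t \<in> {0..T} \<Longrightarrow> norm (y t) \<le> b"
    using bounded_pos compact_imp_bounded by (metis imageI)
  obtain a where a: "a > 0" "\<And>y u. u \<in> U \<Longrightarrow> norm (f y u) \<le> a * (1 + norm y)"
    using f_growth by blast
  show ?thesis
  proof
    show "a * (1 + b) > 0" using a b by simp
    fix t assume t: "t \<in> {0..T}"
    have "norm (f (y t) (u t)) \<le> a * (1 + norm (y t))" using a controls_in[OF assms(2)] t by auto
    also have "\<dots> \<le> a * (1 + b)" using a b t by simp
    finally show "norm (f (y t) (u t)) \<le> a * (1 + b)" .
  qed
qed

lemma velocity_integrable:
  assumes "continuous_on {0..} y" "u \<in> controls U" "0 \<le> a"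
  shows "(\<lambda>s. f (y s) (u s)) integrable_on {a..b}"
proof -
  obtain B where "\<And>t. t \<in> {0..b} \<Longrightarrow> norm (f (y t) (u t)) \<le> B" using velocity_bounded assms by blast
  then show ?thesis
    using assms by (intro half_line_measurable_imp_integrable_on[OF velocity_measurable, where B=B]) auto
qed

text \<open>
  Gronwall's inequality gives uniqueness (equal initial states), causality (the control after time \<open>t\<close>
  is irrelevant at time \<open>t\<close>) and continuity in the initial state at once.
\<close>

lemma integral_solution_dist:
  assumes y: "integral_solution f u y0 y" and y': "integral_solution f u' y0' y'"
    and u: "u \<in> controls U" "u' \<in> controls U" and eq: "\<And>s. 0 \<le> s \<Longrightarrow> s < t \<Longrightarrow> u s = u' s" and t: "0 \<le> t"
  shows "norm (y t - y' t) \<le> norm (y0 - y0') * exp (L * t)"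
proof (rule gronwall[where T=t and z="\<lambda>t. norm (y t - y' t)"])
  have c: "continuous_on {0..} y" "continuous_on {0..} y'"
    using y y' by (auto simp: integral_solution_def)
  have c': "continuous_on {0..T} (\<lambda>s. norm (y s - y' s))" for T
    using c by (auto intro!: continuous_intros intro: continuous_on_subset)
  then show "continuous_on {0..t} (\<lambda>s. norm (y s - y' s))" .
  fix T assume T: "T \<in> {0..t}"
  have I: "((\<lambda>s. f (y s) (u s)) has_integral (y T - y0)) {0..T}" "((\<lambda>s. f (y' s) (u' s)) has_integral (y' T - y0')) {0..T}"
    using y y' T by (auto simp: integral_solution_def)
  have "((\<lambda>s. f (y' s) (u s)) has_integral (y' T - y0')) {0..T}"
    by (rule has_integral_spike[OF _ _ I(2), of "{t}"]) (use eq T in auto)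
  from has_integral_diff[OF I(1) this]
  have D: "((\<lambda>s. f (y s) (u s) - f (y' s) (u s)) has_integral ((y T - y0) - (y' T - y0'))) {0..T}" .
  have "norm ((y T - y0) - (y' T - y0')) = norm (integral {0..T} (\<lambda>s. f (y s) (u s) - f (y' s) (u s)))"
    using integral_unique[OF D] by simp
  also have "\<dots> \<le> integral {0..T} (\<lambda>s. L * norm (y s - y' s))"
  proof (rule integral_norm_bound_integral)
    show "(\<lambda>s. f (y s) (u s) - f (y' s) (u s)) integrable_on {0..T}" using D by blast
    show "(\<lambda>s. L * norm (y s - y' s)) integrable_on {0..T}"
      by (intro integrable_continuous_real continuous_intros c')
    fix s assume "s \<in> {0..T}"
    then show "norm (f (y s) (u s) - f (y' s) (u s)) \<le> L * norm (y s - y' s)"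
      by (intro f_lipschitz controls_in[OF u(1)]) simp
  qed
  also have "\<dots> = L * integral {0..T} (\<lambda>s. norm (y s - y' s))" by simp
  finally have "norm ((y T - y' T) - (y0 - y0')) \<le> L * integral {0..T} (\<lambda>s. norm (y s - y' s))"
    by (simp add: algebra_simps)
  then show "norm (y T - y' T) \<le> norm (y0 - y0') + L * integral {0..T} (\<lambda>s. norm (y s - y' s))"
    using norm_triangle_sub[of "y T - y' T" "y0 - y0'"] by simp
qed (use L_nonneg t in auto)

primrec picard :: "(real \<Rightarrow> 'u) \<Rightarrow> 'a \<Rightarrow> nat \<Rightarrow> real \<Rightarrow> 'a" where
  "picard u y0 0 = (\<lambda>t. y0)"
| "picard u y0 (Suc n) = (\<lambda>t. y0 + integral {0..t} (\<lambda>s. f (picard u y0 n s) (u s)))"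

lemma picard_continuous: "u \<in> controls U \<Longrightarrow> continuous_on {0..} (picard u y0 n)"
proof (induction n)
  case (Suc n)
  then have "continuous_on {0..T} (\<lambda>t. integral {0..t} (\<lambda>s. f (picard u y0 n s) (u s)))" for T
    by (intro indefinite_integral_continuous_1 velocity_integrable) auto
  then show ?case by (auto intro!: continuous_intros continuous_on_half_line)
qed simp

lemma picard_step:
  assumes u: "u \<in> controls U" and a: "a > 0" "\<And>y u. u \<in> U \<Longrightarrow> norm (f y u) \<le> a * (1 + norm y)"
  shows "0 \<le> t \<Longrightarrow> norm (picard u y0 (Suc n) t - picard u y0 n t)
     \<le> a * (1 + norm y0) * L ^ n * (t ^ Suc n / fact (Suc n))"
proof (induction n arbitrary: t)
  case 0
  have "((\<lambda>s. f y0 (u s)) has_integral integral {0..t} (\<lambda>s. f y0 (u s))) (cbox 0 t)"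
    using velocity_integrable[of "\<lambda>_. y0" u 0 t] u by (simp add: has_integral_integral)
  then have "norm (integral {0..t} (\<lambda>s. f y0 (u s))) \<le> (a * (1 + norm y0)) * measure lborel (cbox 0 t)"
    by (rule has_integral_bound[rotated]) (use a controls_in[OF u] in auto)
  then show ?case using 0 by simp
next
  case (Suc n)
  let ?K = "a * (1 + norm y0)"
  have i: "(\<lambda>s. f (picard u y0 n s) (u s)) integrable_on {0..t}" for n
    by (intro velocity_integrable picard_continuous u) simp
  have "picard u y0 (Suc (Suc n)) t - picard u y0 (Suc n) t =
     integral {0..t} (\<lambda>s. f (picard u y0 (Suc n) s) (u s) - f (picard u y0 n s) (u s))"
    using i[of "Suc n"] i[of n] by (simp add: Henstock_Kurzweil_Integration.integral_diff)
  also have "norm \<dots> \<le> integral {0..t} (\<lambda>s. L * ?K * L ^ n * (s ^ Suc n / fact (Suc n)))"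
  proof (rule integral_norm_bound_integral)
    show "(\<lambda>s. f (picard u y0 (Suc n) s) (u s) - f (picard u y0 n s) (u s)) integrable_on {0..t}"
      using i[of "Suc n"] i[of n] by (rule integrable_diff)
    show "(\<lambda>s. L * ?K * L ^ n * (s ^ Suc n / fact (Suc n))) integrable_on {0..t}"
      by (intro integrable_continuous_real continuous_intros) auto
    fix s assume s: "s \<in> {0..t}"
    have "norm (f (picard u y0 (Suc n) s) (u s) - f (picard u y0 n s) (u s))
       \<le> L * norm (picard u y0 (Suc n) s - picard u y0 n s)"
      using s by (intro f_lipschitz controls_in[OF u]) auto
    also have "\<dots> \<le> L * (?K * L ^ n * (s ^ Suc n / fact (Suc n)))"
      using Suc.IH[of s] s L_nonneg by (intro mult_left_mono) auto
    finally show "norm (f (picard u y0 (Suc n) s) (u s) - f (picard u y0 n s) (u s))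
       \<le> L * ?K * L ^ n * (s ^ Suc n / fact (Suc n))" by (simp only: mult.assoc)
  qed
  also have "\<dots> = L * ?K * L ^ n * (t ^ Suc (Suc n) / fact (Suc (Suc n)))"
    by (rule integral_unique, rule has_integral_mult_right, rule has_integral_power_div_fact[OF Suc.prems])
  also have "\<dots> = ?K * L ^ Suc n * (t ^ Suc (Suc n) / fact (Suc (Suc n)))" by simp
  finally show ?case .
qed

text \<open>
  The successive approximations converge uniformly on compact intervals, since their increments are
  dominated by the terms of an exponential series.
\<close>

lemma integral_solution_exists:
  assumes u: "u \<in> controls U"
  obtains y where "integral_solution f u y0 y"
proof -
  obtain a where a: "a > 0" "\<And>y u. u \<in> U \<Longrightarrow> norm (f y u) \<le> a * (1 + norm y)"
    using f_growth by blast
  define P where "P = picard u y0"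
  define D where "D i t = P (Suc i) t - P i t" for i t
  define y where "y t = y0 + (\<Sum>i. D i t)" for t
  have sumD: "(\<Sum>i<n. D i t) = P n t - y0" for n t
    by (induction n) (auto simp: D_def P_def)
  have lim: "uniform_limit {0..T} P y sequentially" for T
  proof (cases "0 \<le> T")
    case True
    have "uniform_limit {0..T} (\<lambda>n t. \<Sum>i<n. D i t) (\<lambda>t. \<Sum>i. D i t) sequentially"
    proof (rule Weierstrass_m_test)
      fix n t assume t: "t \<in> {0..T}"
      have "norm (D n t) \<le> a * (1 + norm y0) * L ^ n * (t ^ Suc n / fact (Suc n))"
        unfolding D_def P_def using picard_step[OF u a] t by simp
      also have "\<dots> \<le> a * (1 + norm y0) * L ^ n * (T ^ Suc n / fact n)"
        using t a L_nonneg True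
        by (intro mult_left_mono frac_le power_mono) (auto intro: fact_mono)
      also have "\<dots> = (a * (1 + norm y0) * T) * (inverse (fact n) * (L * T) ^ n)"
        by (simp add: power_mult_distrib field_simps)
      finally show "norm (D n t) \<le> (a * (1 + norm y0) * T) * (inverse (fact n) * (L * T) ^ n)" .
    next
      show "summable (\<lambda>n. (a * (1 + norm y0) * T) * (inverse (fact n) * (L * T) ^ n))"
        by (intro summable_mult summable_exp)
    qed
    then have "uniform_limit {0..T} (\<lambda>n t. y0 + (\<Sum>i<n. D i t)) (\<lambda>t. y0 + (\<Sum>i. D i t)) sequentially"
      by (intro uniform_limit_intros)
    then show ?thesis unfolding sumD y_def by simp
  qed auto
  have cP: "continuous_on {0..} (P n)" for n unfolding P_def by (rule picard_continuous[OF u])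
  have cy: "continuous_on {0..} y"
  proof (rule continuous_on_half_line)
    fix T :: real
    show "continuous_on {0..T} y"
      by (rule uniform_limit_theorem[OF _ lim]) (auto intro!: always_eventually continuous_on_subset[OF cP])
  qed
  have "((\<lambda>s. f (y s) (u s)) has_integral (y t - y0)) {0..t}" if t: "0 \<le> t" for t
  proof -
    have iP: "(\<lambda>s. f (P n s) (u s)) integrable_on {0..t}" for n
      by (intro velocity_integrable cP u) simp
    have iy: "(\<lambda>s. f (y s) (u s)) integrable_on {0..t}"
      by (intro velocity_integrable cy u) simp
    have "uniform_limit {0..t} (\<lambda>n s. f (P n s) (u s)) (\<lambda>s. f (y s) (u s)) sequentially"
    proof (rule uniform_limitI)
      fix e :: real assume e: "e > 0"
      have "\<forall>\<^sub>F n in sequentially. \<forall>s\<in>{0..t}. dist (P n s) (y s) < e / (L + 1)"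
        using uniform_limitD[OF lim, of "e / (L + 1)"] e L_nonneg by simp
      then show "\<forall>\<^sub>F n in sequentially. \<forall>s\<in>{0..t}. dist (f (P n s) (u s)) (f (y s) (u s)) < e"
      proof (eventually_elim, safe)
        fix n s assume H: "\<forall>s\<in>{0..t}. dist (P n s) (y s) < e / (L + 1)" "s \<in> {0..t}"
        have "dist (f (P n s) (u s)) (f (y s) (u s)) \<le> L * dist (P n s) (y s)"
          unfolding dist_norm using H by (intro f_lipschitz controls_in[OF u]) auto
        also have "\<dots> \<le> L * (e / (L + 1))" using H L_nonneg by (intro mult_left_mono) (auto intro: less_imp_le)
        also have "\<dots> < e" using e L_nonneg by (simp add: field_simps)
        finally show "dist (f (P n s) (u s)) (f (y s) (u s)) < e" .
      qed
    qed
    note unif = this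
    have "(\<lambda>n. integral {0..t} (\<lambda>s. f (P n s) (u s))) \<longlonglongrightarrow> integral {0..t} (\<lambda>s. f (y s) (u s))"
    proof (rule tendstoI)
      fix e :: real assume e: "e > 0"
      then have "\<forall>\<^sub>F n in sequentially. \<forall>s\<in>{0..t}. dist (f (P n s) (u s)) (f (y s) (u s)) < e / (t + 1)"
        using uniform_limitD[OF unif, of "e / (t + 1)"] t by simp
      then show "\<forall>\<^sub>F n in sequentially. dist (integral {0..t} (\<lambda>s. f (P n s) (u s))) (integral {0..t} (\<lambda>s. f (y s) (u s))) < e"
      proof eventually_elim
        case (elim n)
        have "((\<lambda>s. f (P n s) (u s) - f (y s) (u s)) has_integral
            (integral {0..t} (\<lambda>s. f (P n s) (u s)) - integral {0..t} (\<lambda>s. f (y s) (u s)))) (cbox 0 t)"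
          using has_integral_diff[OF integrable_integral[OF iP[of n]] integrable_integral[OF iy]] by simp
        then have "norm (integral {0..t} (\<lambda>s. f (P n s) (u s)) - integral {0..t} (\<lambda>s. f (y s) (u s)))
            \<le> e / (t + 1) * measure lborel (cbox 0 t)"
        proof (rule has_integral_bound[rotated])
          fix x assume "x \<in> cbox 0 t"
          then show "norm (f (P n x) (u x) - f (y x) (u x)) \<le> e / (t + 1)"
            using elim by (auto simp: dist_norm less_imp_le)
        qed (use e t in auto)
        also have "\<dots> = e / (t + 1) * t" using t by simp
        also have "\<dots> < e" using e t by (simp add: field_simps)
        finally show ?case by (simp add: dist_norm)
      qed
    qed
    then have "(\<lambda>n. P (Suc n) t - y0) \<longlonglongrightarrow> integral {0..t} (\<lambda>s. f (y s) (u s))"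
      by (simp add: P_def)
    moreover have "(\<lambda>n. P (Suc n) t - y0) \<longlonglongrightarrow> y t - y0"
      using tendsto_uniform_limitI[OF lim[of t], of t] t
      by (intro tendsto_intros) (auto intro: LIMSEQ_Suc)
    ultimately have "integral {0..t} (\<lambda>s. f (y s) (u s)) = y t - y0" by (rule LIMSEQ_unique)
    then show ?thesis using iy by (metis has_integral_integral)
  qed
  then have "integral_solution f u y0 y" using cy unfolding integral_solution_def by blast
  then show ?thesis by (rule that)
qed

text \<open>
  The velocity is bounded on compact intervals, so a solution of the integral equation is locally
  Lipschitz, and it is differentiable almost everywhere by Lebesgue's theorem.
\<close>

lemma integral_solution_imp_is_solution:
  assumes u: "u \<in> controls U" and y: "integral_solution f u y0 y"
  shows "is_solution f u y0 y"
  unfolding is_solution_def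
proof (intro conjI)
  have c: "continuous_on {0..} y" and I: "\<And>t. 0 \<le> t \<Longrightarrow> ((\<lambda>s. f (y s) (u s)) has_integral (y t - y0)) {0..t}"
    using y by (auto simp: integral_solution_def)
  show "y 0 = y0" using integral_unique[OF I[of 0]] by simp
  show "locally_abs_continuous y"
  proof (rule locally_abs_continuous_lipschitz)
    fix T :: real assume T: "0 \<le> T"
    obtain B where B: "B > 0" "\<And>t. t \<in> {0..T} \<Longrightarrow> norm (f (y t) (u t)) \<le> B" using velocity_bounded[OF c u] by blast
    have "norm (y b - y a) \<le> B * (b - a)" if ab: "0 \<le> a" "a \<le> b" "b \<le> T" for a b
    proof -
      have "integral {0..b} (\<lambda>s. f (y s) (u s)) = integral {0..a} (\<lambda>s. f (y s) (u s)) + integral {a..b} (\<lambda>s. f (y s) (u s))"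
        using ab velocity_integrable[OF c u] by (intro Henstock_Kurzweil_Integration.integral_combine[symmetric]) auto
      then have "y b - y a = integral {a..b} (\<lambda>s. f (y s) (u s))"
        using integral_unique[OF I[of a]] integral_unique[OF I[of b]] ab by (simp add: algebra_simps)
      moreover have "((\<lambda>s. f (y s) (u s)) has_integral integral {a..b} (\<lambda>s. f (y s) (u s))) (cbox a b)"
        using velocity_integrable[OF c u, of a b] ab by (simp add: has_integral_integral)
      then have "norm (integral {a..b} (\<lambda>s. f (y s) (u s))) \<le> B * measure lborel (cbox a b)"
        by (rule has_integral_bound[rotated]) (use B ab in auto)
      ultimately show ?thesis using ab by simp
    qed
    then show "\<exists>C\<ge>0. \<forall>a b. 0 \<le> a \<longrightarrow> a \<le> b \<longrightarrow> b \<le> T \<longrightarrow> norm (y b - y a) \<le> C * (b - a)"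
      using B(1) by (intro exI[of _ B]) auto
  qed
  define \<phi> where "\<phi> s = (if 0 \<le> s then f (y s) (u s) else 0)" for s
  have "\<phi> integrable_on {a..b}" for a b
  proof -
    have "(\<lambda>s. f (y s) (u s)) integrable_on {0..b} \<inter> {a..b}"
      using velocity_integrable[OF c u, of "max 0 a" b] by (auto simp: Int_atLeastAtMost max_def split: if_splits)
    then have "(\<lambda>s. if s \<in> {0..b} then f (y s) (u s) else 0) integrable_on {a..b}"
      by (subst integrable_restrict_Int)
    then show ?thesis by (rule integrable_eq) (auto simp: \<phi>_def)
  qed
  from AE_has_vector_derivative_integral[OF this]
  have "AE t in lborel. t > 0 \<longrightarrow> ((\<lambda>x. integral {0..x} \<phi>) has_vector_derivative \<phi> t) (at t)" .
  then show "AE t in lborel. t > 0 \<longrightarrow> (y has_vector_derivative f (y t) (u t)) (at t)"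
  proof eventually_elim
    case (elim t)
    show ?case
    proof
      assume t: "t > 0"
      have "((\<lambda>x. y0 + integral {0..x} \<phi>) has_vector_derivative (0 + \<phi> t)) (at t)"
        using elim t by (intro has_vector_derivative_add) (auto intro: derivative_intros)
      then have "(y has_vector_derivative (0 + \<phi> t)) (at t)"
      proof (rule has_vector_derivative_transform_within_open[of _ _ _ "{0<..}"])
        fix x :: real assume x: "x \<in> {0<..}"
        have "integral {0..x} \<phi> = integral {0..x} (\<lambda>s. f (y s) (u s))"
          by (rule integral_cong) (auto simp: \<phi>_def)
        then show "y0 + integral {0..x} \<phi> = y x" using integral_unique[OF I[of x]] x by simp
      qed (use t in auto)
      then show "(y has_vector_derivative f (y t) (u t)) (at t)" using t by (simp add: \<phi>_def)
    qed
  qed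
qed

lemma trajectory_solution:
  assumes u: "u \<in> controls U"
  shows "integral_solution f u y0 (trajectory f u y0)"
proof -
  have "\<exists>y. is_solution f u y0 y"
    using integral_solution_exists[OF u] integral_solution_imp_is_solution[OF u] by metis
  from someI_ex[OF this] show ?thesis
    unfolding trajectory_def by (rule is_solution_imp_integral_solution)
qed

lemma trajectory_continuous: "u \<in> controls U \<Longrightarrow> continuous_on {0..} (trajectory f u y0)"
  using trajectory_solution by (auto simp: integral_solution_def)

lemma trajectory_has_integral:
  "u \<in> controls U \<Longrightarrow> 0 \<le> t \<Longrightarrow>
    ((\<lambda>s. f (trajectory f u y0 s) (u s)) has_integral (trajectory f u y0 t - y0)) {0..t}"
  using trajectory_solution by (auto simp: integral_solution_def)

lemma trajectory_0: "u \<in> controls U \<Longrightarrow> trajectory f u y0 0 = y0"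
  using trajectory_solution[THEN integral_solution_imp_is_solution[rotated]] by (auto simp: is_solution_def)

lemma trajectory_dist:
  assumes "u \<in> controls U" "u' \<in> controls U" "\<And>s. 0 \<le> s \<Longrightarrow> s < t \<Longrightarrow> u s = u' s" "0 \<le> t"
  shows "norm (trajectory f u y t - trajectory f u' y' t) \<le> norm (y - y') * exp (L * t)"
  using integral_solution_dist trajectory_solution assms by blast

lemma trajectory_cong:
  assumes "u \<in> controls U" "u' \<in> controls U" "\<And>s. 0 \<le> s \<Longrightarrow> s < t \<Longrightarrow> u s = u' s" "0 \<le> t"
  shows "trajectory f u y t = trajectory f u' y t"
  using trajectory_dist[OF assms, of y y] by simp

lemma trajectory_shift:
  assumes u: "u \<in> controls U" and s: "0 \<le> s" and t: "0 \<le> t"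
  shows "trajectory f (\<lambda>r. u (r + s)) (trajectory f u y s) t = trajectory f u y (t + s)"
proof -
  let ?y = "trajectory f u y" and ?u = "\<lambda>r. u (r + s)"
  have u': "?u \<in> controls U" using u s by (rule shift_in_controls)
  have "integral_solution f ?u (?y s) (\<lambda>t. ?y (t + s))"
    unfolding integral_solution_def
  proof (intro conjI allI impI)
    show "continuous_on {0..} (\<lambda>t. ?y (t + s))"
      by (rule continuous_on_compose2[OF trajectory_continuous[OF u]]) (use s in \<open>auto intro!: continuous_intros\<close>)
    fix t :: real assume t: "0 \<le> t"
    let ?h = "\<lambda>r. f (?y r) (u r)"
    have i: "?h integrable_on {a..b}" if "0 \<le> a" for a b
      using velocity_integrable[OF trajectory_continuous[OF u] u that] .
    have "integral {0..s} ?h + integral {s..t + s} ?h = integral {0..t + s} ?h"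
      using s t i by (intro Henstock_Kurzweil_Integration.integral_combine) auto
    then have "integral {s..t + s} ?h = ?y (t + s) - ?y s"
      using integral_unique[OF trajectory_has_integral[OF u, of s y]]
        integral_unique[OF trajectory_has_integral[OF u, of "t + s" y]] s t by (simp add: algebra_simps)
    then have "(?h has_integral (?y (t + s) - ?y s)) {s..t + s}" using i[OF s] by (metis has_integral_integral)
    from has_integral_shift_real_ivl[OF this, of s]
    show "((\<lambda>r. f (?y (r + s)) (u (r + s))) has_integral (?y (t + s) - ?y s)) {0..t}" by simp
  qed
  from integral_solution_dist[OF trajectory_solution[OF u'] this u' u' _ t, of "?y s"]
  show ?thesis by simp
qed

end

section \<open>Shadowing trajectories by piecewise constant controls\<close>

text \<open>
  A compact set is cut into finitely many small Borel pieces, each labelled by a point of the set close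
  to it. This is what makes the selections below measurable.
\<close>

lemma net_index:
  fixes S :: "'b::{metric_space, second_countable_topology} set"
  assumes S: "compact S" and d: "0 < d"
  obtains xs :: "'b list" and idx :: "'b \<Rightarrow> nat"
  where "set xs \<subseteq> S" "idx \<in> borel \<rightarrow>\<^sub>M count_space UNIV" "\<And>z. idx z \<le> length xs"
    "\<And>z. z \<in> S \<Longrightarrow> idx z < length xs \<and> dist (xs ! idx z) z < d"
proof -
  obtain K where K: "finite K" "K \<subseteq> S" "S \<subseteq> (\<Union>x\<in>K. ball x d)"
    using seq_compact_imp_totally_bounded[of S] S d compact_imp_seq_compact by blast
  obtain xs where xs: "set xs = K" using finite_list[OF K(1)] by blast
  define idx where "idx z = (LEAST i. i = length xs \<or> (i < length xs \<and> z \<in> ball (xs ! i) d))" for z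
  have "idx \<in> borel \<rightarrow>\<^sub>M count_space UNIV"
    unfolding idx_def
  proof (rule measurable_Least)
    fix i
    have "open {z. i = length xs \<or> (i < length xs \<and> z \<in> ball (xs ! i) d)}"
      by (cases "i = length xs"; cases "i < length xs") (simp_all only: simp_thms Collect_mem_eq open_ball open_UNIV open_empty Collect_const if_True if_False)
    then show "Measurable.pred borel (\<lambda>z. i = length xs \<or> (i < length xs \<and> z \<in> ball (xs ! i) d))"
      unfolding pred_def by (simp only: space_borel UNIV_I simp_thms borel_open)
  qed
  moreover have "idx z \<le> length xs" for z unfolding idx_def by (rule Least_le) simp
  moreover have "idx z < length xs \<and> dist (xs ! idx z) z < d" if z: "z \<in> S" for z
  proof -
    have "\<exists>i. i < length xs \<and> z \<in> ball (xs ! i) d"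
      using K(3) z xs by (metis (no_types, lifting) UN_E in_mono in_set_conv_nth)
    then obtain i where i: "i < length xs" "z \<in> ball (xs ! i) d" by blast
    have "idx z = length xs \<or> (idx z < length xs \<and> z \<in> ball (xs ! idx z) d)"
      unfolding idx_def by (rule LeastI[of _ "length xs"]) simp
    moreover have "idx z \<le> i" unfolding idx_def by (rule Least_le) (use i in simp)
    ultimately show ?thesis using i by auto
  qed
  ultimately show ?thesis using that[of xs idx] xs K(2) by blast
qed

locale compact_nonexpansive_problem =
  fixes U :: "'u::{metric_space, second_countable_topology} set"
    and f :: "'a::euclidean_space \<Rightarrow> 'u \<Rightarrow> 'a"
    and g :: "'a \<Rightarrow> 'u \<Rightarrow> real"
    and Y :: "'a set"
  assumes compact_nonexpansive: "compact_nonexpansive U f g Y"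
begin

sublocale control_system U f g
  using compact_nonexpansive unfolding compact_nonexpansive_def by unfold_locales blast

lemma compact_Y: "compact Y"
  and trajectory_in_Y: "\<lbrakk>y \<in> Y; u \<in> controls U; 0 \<le> t\<rbrakk> \<Longrightarrow> trajectory f u y t \<in> Y"
  and nonexpansive: "(SUP a\<in>U. INF b\<in>U. (y1 - y2) \<bullet> (f y1 a - f y2 b)) \<le> 0"
  using compact_nonexpansive unfolding compact_nonexpansive_def by blast+

lemma U_nonempty: "U \<noteq> {}"
  using problem unfolding control_problem_def by blast

definition A where "A = (SOME A. A > 0 \<and> (\<forall>y\<in>Y. \<forall>u\<in>U. norm (f y u) \<le> A))"

lemma A_pos: "A > 0" and f_bound: "y \<in> Y \<Longrightarrow> u \<in> U \<Longrightarrow> norm (f y u) \<le> A"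
proof -
  obtain a where a: "a > 0" "\<And>y u. u \<in> U \<Longrightarrow> norm (f y u) \<le> a * (1 + norm y)" using f_growth by blast
  obtain b where b: "b > 0" "\<And>y. y \<in> Y \<Longrightarrow> norm y \<le> b"
    using compact_imp_bounded[OF compact_Y] bounded_pos by blast
  have "norm (f y u) \<le> a * (1 + b)" if "y \<in> Y" "u \<in> U" for y u
    using a(2)[OF that(2), of y] b(2)[OF that(1)] a(1) by (smt (verit) mult_left_mono)
  moreover have "a * (1 + b) > 0" using a b by simp
  ultimately have "\<exists>A. A > 0 \<and> (\<forall>y\<in>Y. \<forall>u\<in>U. norm (f y u) \<le> A)" by blast
  from someI_ex[OF this] show "A > 0" "y \<in> Y \<Longrightarrow> u \<in> U \<Longrightarrow> norm (f y u) \<le> A"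
    unfolding A_def by blast+
qed

definition D where "D = (SOME D. D > 0 \<and> (\<forall>p\<in>Y. \<forall>q\<in>Y. norm (p - q) \<le> D))"

lemma D_pos: "D > 0" and Y_diam: "p \<in> Y \<Longrightarrow> q \<in> Y \<Longrightarrow> norm (p - q) \<le> D"
proof -
  obtain b where b: "b > 0" "\<And>y. y \<in> Y \<Longrightarrow> norm y \<le> b"
    using compact_imp_bounded[OF compact_Y] bounded_pos by blast
  have "norm (p - q) \<le> 2 * b" if "p \<in> Y" "q \<in> Y" for p q
    using b(2)[OF that(1)] b(2)[OF that(2)] norm_triangle_ineq4[of p q] by simp
  then have "\<exists>D. D > 0 \<and> (\<forall>p\<in>Y. \<forall>q\<in>Y. norm (p - q) \<le> D)" using b(1) by (intro exI[of _ "2 * b"]) auto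
  from someI_ex[OF this] show "D > 0" "p \<in> Y \<Longrightarrow> q \<in> Y \<Longrightarrow> norm (p - q) \<le> D"
    unfolding D_def by blast+
qed

lemma trajectory_lipschitz:
  assumes y: "y \<in> Y" and u: "u \<in> controls U" and s: "0 \<le> s" and t: "0 \<le> t"
  shows "norm (trajectory f u y t - trajectory f u y s) \<le> A * \<bar>t - s\<bar>"
proof -
  have *: "norm (trajectory f u z t - z) \<le> A * t" if z: "z \<in> Y" and u: "u \<in> controls U" and t: "0 \<le> t" for z u t
  proof -
    have "((\<lambda>s. f (trajectory f u z s) (u s)) has_integral (trajectory f u z t - z)) (cbox 0 t)"
      using trajectory_has_integral[OF u t] by simp
    then have "norm (trajectory f u z t - z) \<le> A * measure lborel (cbox 0 t)"
    proof (rule has_integral_bound[rotated])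
      fix x assume "x \<in> cbox 0 t"
      then show "norm (f (trajectory f u z x) (u x)) \<le> A"
        using f_bound[OF trajectory_in_Y[OF z u]] controls_in[OF u] by simp
    qed (use A_pos in simp)
    then show ?thesis using t by simp
  qed
  have **: "norm (trajectory f u y t - trajectory f u y s) \<le> A * (t - s)" if "0 \<le> s" "s \<le> t" for s t
    using *[OF trajectory_in_Y[OF y u, of s] shift_in_controls[OF u, of s], of "t - s"]
      trajectory_shift[OF u, of s "t - s" y] that by simp
  show ?thesis
    using **[of s t] **[of t s] s t by (cases "s \<le> t") (auto simp: norm_minus_commute)
qed

text \<open>
  With \<open>\<phi> a = (p - q) \<bullet> f p a\<close> and \<open>\<psi> b = (p - q) \<bullet> f q b\<close> the hypothesis says \<open>sup \<phi> \<le> sup \<psi>\<close>, so an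
  action \<open>b\<close> that nearly maximizes \<open>\<psi>\<close> works for all \<open>a\<close> simultaneously.
\<close>

lemma near_best_response:
  assumes pq: "p \<in> Y" "q \<in> Y" and e: "0 < e"
  obtains b where "b \<in> U" "\<And>a. a \<in> U \<Longrightarrow> (p - q) \<bullet> (f p a - f q b) \<le> e"
proof -
  define \<phi> where "\<phi> a = (p - q) \<bullet> f p a" for a
  define \<psi> where "\<psi> b = (p - q) \<bullet> f q b" for b
  have b\<phi>: "\<bar>\<phi> a\<bar> \<le> norm (p - q) * A" if "a \<in> U" for a
    unfolding \<phi>_def using f_bound[OF pq(1) that]
    by (meson Cauchy_Schwarz_ineq2 mult_left_mono norm_ge_zero order_trans)
  have b\<psi>: "\<bar>\<psi> a\<bar> \<le> norm (p - q) * A" if "a \<in> U" for a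
    unfolding \<psi>_def using f_bound[OF pq(2) that]
    by (meson Cauchy_Schwarz_ineq2 mult_left_mono norm_ge_zero order_trans)
  have bdd: "bdd_above (\<phi> ` U)" using b\<phi> by (intro bdd_aboveI2[where M="norm (p - q) * A"]) (auto simp: abs_le_iff)
  have below: "bdd_below ((\<lambda>b. (p - q) \<bullet> (f p a - f q b)) ` U)" if "a \<in> U" for a
    using b\<phi>[OF that] b\<psi> 
    by (intro bdd_belowI2[where m="- 2 * (norm (p - q) * A)"]) (force simp: inner_diff_right \<phi>_def \<psi>_def abs_le_iff)
  have "bdd_above ((\<lambda>a. INF b\<in>U. (p - q) \<bullet> (f p a - f q b)) ` U)"
  proof (rule bdd_aboveI2[where M="2 * (norm (p - q) * A)"])
    fix a assume a: "a \<in> U"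
    have "(INF b\<in>U. (p - q) \<bullet> (f p a - f q b)) \<le> (p - q) \<bullet> (f p a - f q a)"
      by (rule cINF_lower[OF below[OF a] a])
    also have "\<dots> \<le> 2 * (norm (p - q) * A)" using b\<phi>[OF a] b\<psi>[OF a] by (simp add: inner_diff_right \<phi>_def \<psi>_def abs_le_iff)
    finally show "(INF b\<in>U. (p - q) \<bullet> (f p a - f q b)) \<le> 2 * (norm (p - q) * A)" .
  qed
  then have inf0: "(INF b\<in>U. (p - q) \<bullet> (f p a - f q b)) \<le> 0" if "a \<in> U" for a
    using nonexpansive[of p q] cSUP_upper[OF that] by (meson order_trans)
  obtain a0 where a0: "a0 \<in> U" "(SUP a\<in>U. \<phi> a) - e / 2 < \<phi> a0"
    using less_cSUP_iff[OF U_nonempty bdd, of "(SUP a\<in>U. \<phi> a) - e / 2"] e by auto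
  have "(INF b\<in>U. (p - q) \<bullet> (f p a0 - f q b)) < e / 2" using inf0[OF a0(1)] e by simp
  then obtain b where b: "b \<in> U" "(p - q) \<bullet> (f p a0 - f q b) < e / 2"
    using iffD1[OF cINF_less_iff[OF U_nonempty below[OF a0(1)]]] by blast
  have "(p - q) \<bullet> (f p a - f q b) \<le> e" if "a \<in> U" for a
    using cSUP_upper[OF that bdd] a0(2) b(2) by (simp add: inner_diff_right \<phi>_def)
  then show ?thesis using b(1) that by blast
qed

text \<open>
  The response to \<open>(p, q)\<close> remains good nearby, because \<open>f\<close> is Lipschitz in the state; so it can be
  chosen constant on each piece of a finite partition of \<open>Y \<times> Y\<close>.
\<close>

lemma finite_selector:
  assumes e: "0 < e"
  shows "\<exists>(m::nat) (B::nat \<Rightarrow> 'u) (sel::'a \<times> 'a \<Rightarrow> nat). (\<forall>n. B n \<in> U) \<and>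
     sel \<in> borel \<rightarrow>\<^sub>M count_space UNIV \<and> (\<forall>z. sel z < m) \<and>
     (\<forall>p\<in>Y. \<forall>q\<in>Y. \<forall>a\<in>U. (p - q) \<bullet> (f p a - f q (B (sel (p, q)))) \<le> e)"
proof -
  define c where "c = 4 * A + 2 * D * L"
  define d where "d = e / (2 * c)"
  have den: "c > 0" using A_pos D_pos L_nonneg by (simp add: c_def add_pos_nonneg)
  have d: "d > 0" using e den by (simp add: d_def)
  have dd: "c * d = e / 2" using den by (simp add: d_def)
  obtain xs :: "('a \<times> 'a) list" and sel where xs: "set xs \<subseteq> Y \<times> Y"
    and sel: "sel \<in> borel \<rightarrow>\<^sub>M count_space UNIV" "\<And>z. sel z \<le> length xs"
    "\<And>z. z \<in> Y \<times> Y \<Longrightarrow> sel z < length xs \<and> dist (xs ! sel z) z < d"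
    by (rule net_index[OF compact_Times[OF compact_Y compact_Y] d]) (rule that, assumption+)
  have "\<exists>b. b \<in> U \<and> (z \<in> Y \<times> Y \<longrightarrow> (\<forall>a\<in>U. (fst z - snd z) \<bullet> (f (fst z) a - f (snd z) b) \<le> e / 2))" for z
  proof (cases "z \<in> Y \<times> Y")
    case True
    then show ?thesis using near_best_response[of "fst z" "snd z" "e / 2"] e by (metis half_gt_zero mem_Times_iff)
  qed (use U_nonempty in auto)
  then have "\<forall>z. \<exists>b. b \<in> U \<and> (z \<in> Y \<times> Y \<longrightarrow> (\<forall>a\<in>U. (fst z - snd z) \<bullet> (f (fst z) a - f (snd z) b) \<le> e / 2))" ..
  from choice[OF this] obtain b where ball:
    "\<forall>z. b z \<in> U \<and> (z \<in> Y \<times> Y \<longrightarrow> (\<forall>a\<in>U. (fst z - snd z) \<bullet> (f (fst z) a - f (snd z) (b z)) \<le> e / 2))" ..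
  then have b: "b z \<in> U"
    "z \<in> Y \<times> Y \<Longrightarrow> a \<in> U \<Longrightarrow> (fst z - snd z) \<bullet> (f (fst z) a - f (snd z) (b z)) \<le> e / 2" for z a
    using spec[OF ball, of z] by blast+
  define B where "B n = b (xs ! n)" for n
  have "sel z < Suc (length xs)" for z using sel(2) by (rule le_imp_less_Suc)
  moreover have "(p - q) \<bullet> (f p a - f q (B (sel (p, q)))) \<le> e" if p: "p \<in> Y" and q: "q \<in> Y" and a: "a \<in> U" for p q a
  proof -
    have n: "sel (p, q) < length xs" "dist (xs ! sel (p, q)) (p, q) < d" using sel(3)[of "(p, q)"] p q by auto
    define p' q' where "p' = fst (xs ! sel (p, q))" and "q' = snd (xs ! sel (p, q))"
    define a' where "a' = B (sel (p, q))"
    have in': "xs ! sel (p, q) \<in> Y \<times> Y" using n(1) xs nth_mem by blast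
    then have Y': "p' \<in> Y" "q' \<in> Y" by (auto simp: p'_def q'_def)
    have "dist p' p \<le> dist (xs ! sel (p, q)) (p, q)" "dist q' q \<le> dist (xs ! sel (p, q)) (p, q)"
      unfolding p'_def q'_def using dist_fst_le[of "xs ! sel (p, q)" "(p, q)"] dist_snd_le[of "xs ! sel (p, q)" "(p, q)"] by simp_all
    then have d': "norm (p - p') \<le> d" "norm (q - q') \<le> d" using n(2) by (auto simp: dist_norm norm_minus_commute)
    have a': "a' \<in> U" unfolding a'_def B_def by (rule b(1))
    have X: "norm (f p a - f q a') \<le> 2 * A"
      using f_bound[OF p a] f_bound[OF q a'] norm_triangle_ineq4[of "f p a" "f q a'"] by simp
    have "(f p a - f q a') - (f p' a - f q' a') = (f p a - f p' a) - (f q a' - f q' a')" by simp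
    then have "norm ((f p a - f q a') - (f p' a - f q' a')) \<le> norm (f p a - f p' a) + norm (f q a' - f q' a')"
      by (metis norm_triangle_ineq4)
    also have "\<dots> \<le> L * norm (p - p') + L * norm (q - q')" by (intro add_mono f_lipschitz a a')
    also have "\<dots> \<le> L * d + L * d" using d' L_nonneg by (intro add_mono mult_left_mono) auto
    finally have X': "norm ((f p a - f q a') - (f p' a - f q' a')) \<le> 2 * L * d" by (simp add: mult_ac)
    have pq: "norm ((p - q) - (p' - q')) \<le> 2 * d"
      using norm_triangle_ineq4[of "p - p'" "q - q'"] d' by (simp add: algebra_simps)
    have "(p - q) \<bullet> (f p a - f q a') = (p' - q') \<bullet> (f p' a - f q' a')
        + ((p - q) - (p' - q')) \<bullet> (f p a - f q a') + (p' - q') \<bullet> ((f p a - f q a') - (f p' a - f q' a'))"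
      by (simp add: algebra_simps inner_diff_left inner_diff_right)
    also have "\<dots> \<le> e / 2 + 2 * d * (2 * A) + D * (2 * L * d)"
    proof (intro add_mono)
      show "(p' - q') \<bullet> (f p' a - f q' a') \<le> e / 2"
        using b(2)[OF in' a] unfolding p'_def q'_def a'_def B_def .
      show "((p - q) - (p' - q')) \<bullet> (f p a - f q a') \<le> 2 * d * (2 * A)"
        by (rule order_trans[OF norm_cauchy_schwarz], rule mult_mono) (use pq X d in auto)
      show "(p' - q') \<bullet> ((f p a - f q a') - (f p' a - f q' a')) \<le> D * (2 * L * d)"
        by (rule order_trans[OF norm_cauchy_schwarz], rule mult_mono) (use Y_diam[OF Y'] X' D_pos in auto)
    qed
    also have "\<dots> = e / 2 + c * d" by (simp add: c_def algebra_simps)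
    finally show ?thesis using dd by (simp add: a'_def)
  qed
  ultimately show ?thesis
    using b(1) sel(1) by (intro exI[of _ "Suc (length xs)"] exI[of _ B] exI[of _ sel]) (auto simp: B_def)
qed

definition C where "C = 2 + 4 * D * L * A + 4 * A\<^sup>2"

lemma C_pos: "C > 0"
  unfolding C_def using D_pos L_nonneg A_pos by (simp add: add_pos_nonneg)

text \<open>
  Expand \<open>\<parallel>(y1 - y2) + w\<parallel>\<^sup>2\<close>, where \<open>w\<close> is the difference of the displacements. The scalar product of
  \<open>y1 - y2\<close> with \<open>w\<close> is at most of order \<open>d\<^sup>2\<close> by the choice of \<open>b\<close> and the Lipschitz property, and
  \<open>\<parallel>w\<parallel>\<^sup>2\<close> is of order \<open>d\<^sup>2\<close> because the velocities are bounded.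
\<close>

lemma one_step:
  assumes Y: "y1 \<in> Y" "y2 \<in> Y" and u: "u \<in> controls U" and v: "v \<in> controls U" and d: "0 < d"
    and vb: "\<And>r. 0 \<le> r \<Longrightarrow> r < d \<Longrightarrow> v r = b"
    and b: "b \<in> U" "\<And>a. a \<in> U \<Longrightarrow> (y1 - y2) \<bullet> (f y1 a - f y2 b) \<le> d" and t: "0 \<le> t" "t \<le> d"
  shows "(norm (trajectory f u y1 t - trajectory f v y2 t))\<^sup>2 \<le> (norm (y1 - y2))\<^sup>2 + C * d\<^sup>2"
proof -
  let ?p = "trajectory f u y1" and ?q = "trajectory f v y2"
  define w where "w = (?p t - y1) - (?q t - y2)"
  have "((\<lambda>s. f (?q s) b) has_integral (?q t - y2)) {0..t}"
    by (rule has_integral_spike[OF _ _ trajectory_has_integral[OF v t(1)], of "{d}"]) (use vb t in auto)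
  from has_integral_diff[OF trajectory_has_integral[OF u t(1), of y1] this]
  have I: "((\<lambda>s. f (?p s) (u s) - f (?q s) b) has_integral w) {0..t}" by (simp add: w_def)
  have pq: "norm (?p s - y1) \<le> A * d" "norm (?q s - y2) \<le> A * d" if "s \<in> {0..t}" for s
  proof -
    have "A * s \<le> A * d" using that t A_pos by simp
    then show "norm (?p s - y1) \<le> A * d" "norm (?q s - y2) \<le> A * d"
      using trajectory_lipschitz[OF Y(1) u, of 0 s] trajectory_lipschitz[OF Y(2) v, of 0 s] that
        trajectory_0[OF u] trajectory_0[OF v] by (force simp: abs_of_nonneg)+
  qed
  have "(y1 - y2) \<bullet> w \<le> t * (d + D * (2 * L * A * d))"
  proof -
    have "((\<lambda>s. (y1 - y2) \<bullet> (f (?p s) (u s) - f (?q s) b)) has_integral ((y1 - y2) \<bullet> w)) {0..t}"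
      using has_integral_linear[OF I bounded_linear_inner_right[of "y1 - y2"]] by (simp add: o_def)
    moreover have "((\<lambda>s. d + D * (2 * L * A * d)) has_integral (t * (d + D * (2 * L * A * d)))) {0..t}"
      using has_integral_const_real[of "d + D * (2 * L * A * d)" 0 t] t by simp
    ultimately show ?thesis
    proof (rule has_integral_le)
      fix s assume s: "s \<in> {0..t}"
      have us: "u s \<in> U" using controls_in[OF u] s by simp
      have "(f (?p s) (u s) - f (?q s) b) - (f y1 (u s) - f y2 b) = (f (?p s) (u s) - f y1 (u s)) - (f (?q s) b - f y2 b)" by simp
      then have "norm ((f (?p s) (u s) - f (?q s) b) - (f y1 (u s) - f y2 b)) \<le> norm (f (?p s) (u s) - f y1 (u s)) + norm (f (?q s) b - f y2 b)"
        by (metis norm_triangle_ineq4)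
      also have "\<dots> \<le> L * norm (?p s - y1) + L * norm (?q s - y2)" by (intro add_mono f_lipschitz us b)
      also have "\<dots> \<le> L * (A * d) + L * (A * d)" using pq[OF s] L_nonneg by (intro add_mono mult_left_mono) auto
      finally have X: "norm ((f (?p s) (u s) - f (?q s) b) - (f y1 (u s) - f y2 b)) \<le> 2 * L * A * d" by (simp add: mult_ac)
      have "(y1 - y2) \<bullet> (f (?p s) (u s) - f (?q s) b) = (y1 - y2) \<bullet> (f y1 (u s) - f y2 b) +
         (y1 - y2) \<bullet> ((f (?p s) (u s) - f (?q s) b) - (f y1 (u s) - f y2 b))" by (simp add: inner_diff_right)
      also have "\<dots> \<le> d + D * (2 * L * A * d)"
      proof (rule add_mono)
        show "(y1 - y2) \<bullet> (f y1 (u s) - f y2 b) \<le> d" by (rule b(2)[OF us])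
        show "(y1 - y2) \<bullet> ((f (?p s) (u s) - f (?q s) b) - (f y1 (u s) - f y2 b)) \<le> D * (2 * L * A * d)"
          by (rule order_trans[OF norm_cauchy_schwarz], rule mult_mono) (use Y_diam[OF Y] X D_pos in auto)
      qed
      finally show "(y1 - y2) \<bullet> (f (?p s) (u s) - f (?q s) b) \<le> d + D * (2 * L * A * d)" .
    qed
  qed
  also have "\<dots> \<le> d * (d + D * (2 * L * A * d))"
    using t d D_pos L_nonneg A_pos by (intro mult_right_mono) auto
  finally have 1: "2 * ((y1 - y2) \<bullet> w) \<le> (2 + 4 * D * L * A) * d\<^sup>2" by (simp add: algebra_simps power2_eq_square)
  have "norm w \<le> 2 * A * d"
    unfolding w_def using pq[of t] t norm_triangle_ineq4[of "?p t - y1" "?q t - y2"] by simp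
  then have 2: "(norm w)\<^sup>2 \<le> 4 * A\<^sup>2 * d\<^sup>2"
    using power_mono[of "norm w" "2 * A * d" 2] by (simp add: power_mult_distrib)
  have "?p t - ?q t = (y1 - y2) + w" by (simp add: w_def)
  then have "(norm (?p t - ?q t))\<^sup>2 = (norm (y1 - y2))\<^sup>2 + 2 * ((y1 - y2) \<bullet> w) + (norm w)\<^sup>2"
    by (simp add: power2_norm_eq_inner inner_add_left inner_add_right inner_commute)
  then show ?thesis using 1 2 unfolding C_def by (simp add: algebra_simps)
qed

end

locale shadow_grid = compact_nonexpansive_problem U f g Y
  for U :: "'u::{metric_space, second_countable_topology} set"
    and f :: "'a::euclidean_space \<Rightarrow> 'u \<Rightarrow> 'a" and g Y +
  fixes h :: real
  assumes h_pos: "0 < h"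
begin

text \<open>
  A harmonic sequence of steps: the grid reaches every time, while the squares of the steps are
  summable with a sum of order \<open>h\<^sup>2\<close>.
\<close>

definition step where "step k = h / real (Suc k)"

definition \<tau> where "\<tau> k = (\<Sum>i<k. step i)"

lemma step_pos: "0 < step k" using h_pos by (simp add: step_def)

lemma step_le: "step k \<le> h"
  using h_pos by (simp add: step_def field_simps)

lemma \<tau>_0 [simp]: "\<tau> 0 = 0" and \<tau>_Suc: "\<tau> (Suc k) = \<tau> k + step k"
  by (simp_all add: \<tau>_def)

lemma \<tau>_mono: "m \<le> n \<Longrightarrow> \<tau> m \<le> \<tau> n"
  by (induction rule: dec_induct) (auto simp: \<tau>_Suc intro: order_trans less_imp_le[OF step_pos] add_increasing2)

lemma \<tau>_nonneg: "0 \<le> \<tau> k"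
  using \<tau>_mono[of 0 k] by simp

lemma \<tau>_at_top: "filterlim \<tau> at_top sequentially"
proof -
  have "\<tau> = (\<lambda>k. h * harm k)"
    by (auto simp: fun_eq_iff \<tau>_def step_def harm_altdef sum_distrib_left divide_inverse)
  moreover have "filterlim (\<lambda>k. h * harm k) at_top sequentially"
    using h_pos by (intro filterlim_tendsto_pos_mult_at_top[OF tendsto_const] harm_at_top) auto
  ultimately show ?thesis by simp
qed

lemma sum_step_sq: "(\<Sum>i\<in>{m..<n}. (step i)\<^sup>2) \<le> 2 * h\<^sup>2"
proof -
  have "(\<Sum>i<n. (step i)\<^sup>2) \<le> h\<^sup>2 * (2 - 1 / (if n = 0 then 1 else real n))" for n
  proof (induction n)
    case (Suc n)
    have "1 / (real (Suc n))\<^sup>2 \<le> 1 / (if n = 0 then 1 else real n) - 1 / real (Suc n)" if "n > 0"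
    proof -
      have "1 / (real (Suc n))\<^sup>2 \<le> 1 / (real n * real (Suc n))"
        by (rule frac_le) (use that in \<open>auto simp: power2_eq_square\<close>)
      also have "\<dots> = 1 / real n - 1 / real (Suc n)" using that by (simp add: field_simps)
      finally show ?thesis using that by simp
    qed
    then have "2 - 1 / (if n = 0 then 1 else real n) + 1 / (real (Suc n))\<^sup>2 \<le> 2 - 1 / real (Suc n)"
      if "n > 0" using that by simp
    then have "h\<^sup>2 * (2 - 1 / (if n = 0 then 1 else real n) + 1 / (real (Suc n))\<^sup>2) \<le> h\<^sup>2 * (2 - 1 / real (Suc n))"
      if "n > 0" using that by (intro mult_left_mono) auto
    then show ?case using Suc by (cases "n = 0") (auto simp: step_def power_divide algebra_simps)
  qed simp
  also have "h\<^sup>2 * (2 - 1 / (if n = 0 then 1 else real n)) \<le> h\<^sup>2 * 2"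
    by (intro mult_left_mono) auto
  finally have "(\<Sum>i<n. (step i)\<^sup>2) \<le> 2 * h\<^sup>2" by simp
  moreover have "(\<Sum>i\<in>{m..<n}. (step i)\<^sup>2) \<le> (\<Sum>i<n. (step i)\<^sup>2)" by (intro sum_mono2) auto
  ultimately show ?thesis by linarith
qed

definition cell :: "real \<Rightarrow> nat" where "cell t = (LEAST k. t < \<tau> (Suc k))"

lemma cell_upper: "t < \<tau> (Suc (cell t))"
proof -
  obtain k where "t < \<tau> k" using \<tau>_at_top
    by (metis (mono_tags, lifting) eventually_sequentially filterlim_at_top_dense order_refl)
  then have "t < \<tau> (Suc k)" using \<tau>_mono[of k "Suc k"] by simp
  then show ?thesis unfolding cell_def by (rule LeastI)
qed

lemma cell_lower: "0 \<le> t \<Longrightarrow> \<tau> (cell t) \<le> t"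
proof (cases "cell t")
  case (Suc k)
  then have "\<not> t < \<tau> (Suc k)" using not_less_Least[of k "\<lambda>k. t < \<tau> (Suc k)"] by (auto simp: cell_def)
  then show ?thesis using Suc by simp
qed simp

lemma cell_eq: "\<tau> k \<le> t \<Longrightarrow> t < \<tau> (Suc k) \<Longrightarrow> cell t = k"
  using cell_upper[of t] cell_lower[of t] \<tau>_mono[of "Suc (cell t)" k] \<tau>_mono[of "Suc k" "cell t"] \<tau>_nonneg[of k]
  by (cases "cell t" k rule: linorder_cases) auto

lemma cell_measurable [measurable]: "cell \<in> borel \<rightarrow>\<^sub>M count_space UNIV"
  unfolding cell_def by measurable

definition selector :: "real \<Rightarrow> nat \<times> (nat \<Rightarrow> 'u) \<times> ('a \<times> 'a \<Rightarrow> nat)" where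
  "selector e = (SOME (m, B, sel). (\<forall>n. B n \<in> U) \<and>
     sel \<in> borel \<rightarrow>\<^sub>M count_space UNIV \<and> (\<forall>z. sel z < m) \<and>
     (\<forall>p\<in>Y. \<forall>q\<in>Y. \<forall>a\<in>U. (p - q) \<bullet> (f p a - f q (B (sel (p, q)))) \<le> e))"

definition digits where "digits k = fst (selector (step k))"
definition B where "B k = fst (snd (selector (step k)))"
definition sel where "sel k = snd (snd (selector (step k)))"

lemma B_in: "B k n \<in> U" and sel_measurable: "sel k \<in> borel \<rightarrow>\<^sub>M count_space UNIV"
  and sel_less: "sel k z < digits k"
  and sel_best: "\<lbrakk>p \<in> Y; q \<in> Y; a \<in> U\<rbrakk> \<Longrightarrow> (p - q) \<bullet> (f p a - f q (B k (sel k (p, q)))) \<le> step k"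
proof -
  have "\<exists>s :: nat \<times> (nat \<Rightarrow> 'u) \<times> ('a \<times> 'a \<Rightarrow> nat). case s of (m, b, c) \<Rightarrow> (\<forall>n. b n \<in> U) \<and>
     c \<in> borel \<rightarrow>\<^sub>M count_space UNIV \<and> (\<forall>z. c z < m) \<and>
     (\<forall>p\<in>Y. \<forall>q\<in>Y. \<forall>a\<in>U. (p - q) \<bullet> (f p a - f q (b (c (p, q)))) \<le> step k)"
    unfolding split_paired_Ex prod.case by (rule finite_selector[OF step_pos])
  from someI_ex[OF this, folded selector_def]
  show "B k n \<in> U" "sel k \<in> borel \<rightarrow>\<^sub>M count_space UNIV" "sel k z < digits k"
    "\<lbrakk>p \<in> Y; q \<in> Y; a \<in> U\<rbrakk> \<Longrightarrow> (p - q) \<bullet> (f p a - f q (B k (sel k (p, q)))) \<le> step k"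
    unfolding digits_def B_def sel_def by (auto simp: split_def simp del: split_paired_All)
qed

definition ctrl :: "(nat \<Rightarrow> nat) \<Rightarrow> real \<Rightarrow> 'u" where
  "ctrl \<sigma> t = B (cell t) (\<sigma> (cell t))"

lemma ctrl_in_controls: "ctrl \<sigma> \<in> controls U"
proof -
  have 1: "(\<lambda>k. B k (\<sigma> k)) \<in> count_space UNIV \<rightarrow>\<^sub>M restrict_space borel U"
    using B_in by (simp add: space_restrict_space)
  have 2: "cell \<in> half_line \<rightarrow>\<^sub>M count_space UNIV"
    by (rule measurable_restrict_space1) measurable
  have "ctrl \<sigma> = (\<lambda>t. B (cell t) (\<sigma> (cell t)))" by (auto simp: fun_eq_iff ctrl_def)
  then show ?thesis unfolding controls_def using measurable_compose[OF 2 1] by simp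
qed

lemma ctrl_const: "\<tau> k \<le> t \<Longrightarrow> t < \<tau> (Suc k) \<Longrightarrow> ctrl \<sigma> t = B k (\<sigma> k)"
  unfolding ctrl_def by (simp add: cell_eq)

abbreviation path where "path \<sigma> y \<equiv> trajectory f (ctrl \<sigma>) y"

lemma path_cong:
  assumes "\<And>k. \<tau> k < t \<Longrightarrow> \<sigma> k = \<sigma>' k" "0 \<le> t"
  shows "path \<sigma> y t = path \<sigma>' y t"
proof (rule trajectory_cong[OF ctrl_in_controls ctrl_in_controls _ assms(2)])
  fix s assume "0 \<le> s" "s < t"
  then have "\<tau> (cell s) < t" using cell_lower[of s] by simp
  then show "ctrl \<sigma> s = ctrl \<sigma>' s" unfolding ctrl_def using assms(1) by simp
qed

text \<open>
  The states at the grid times under the feedback that plays digit \<open>\<pi> k x\<close> in state \<open>x\<close> at step \<open>k\<close>.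
\<close>

primrec run :: "(nat \<Rightarrow> 'a \<Rightarrow> nat) \<Rightarrow> 'a \<Rightarrow> nat \<Rightarrow> 'a" where
  "run \<pi> y 0 = y"
| "run \<pi> y (Suc k) = trajectory f (\<lambda>_. B k (\<pi> k (run \<pi> y k))) (run \<pi> y k) (step k)"

lemma path_run: "path (\<lambda>k. \<pi> k (run \<pi> y k)) y (\<tau> k) = run \<pi> y k"
proof (induction k)
  case (Suc k)
  let ?\<sigma> = "\<lambda>k. \<pi> k (run \<pi> y k)"
  have "path ?\<sigma> y (\<tau> (Suc k)) = trajectory f (\<lambda>r. ctrl ?\<sigma> (r + \<tau> k)) (path ?\<sigma> y (\<tau> k)) (step k)"
    using trajectory_shift[OF ctrl_in_controls[of ?\<sigma>], of "\<tau> k" "step k" y] \<tau>_nonneg step_pos[of k]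
    by (simp add: \<tau>_Suc add.commute)
  also have "\<dots> = trajectory f (\<lambda>_. B k (?\<sigma> k)) (path ?\<sigma> y (\<tau> k)) (step k)"
  proof (rule trajectory_cong)
    show "(\<lambda>r. ctrl ?\<sigma> (r + \<tau> k)) \<in> controls U" by (rule shift_in_controls[OF ctrl_in_controls \<tau>_nonneg])
    show "(\<lambda>_. B k (?\<sigma> k)) \<in> controls U" by (rule const_in_controls[OF B_in])
    show "ctrl ?\<sigma> (s + \<tau> k) = B k (?\<sigma> k)" if "0 \<le> s" "s < step k" for s
      by (rule ctrl_const) (use that in \<open>auto simp: \<tau>_Suc\<close>)
  qed (use step_pos[of k] in simp)
  finally show ?case using Suc by simp
qed (simp add: trajectory_0[OF ctrl_in_controls])

definition err where "err = sqrt (2 * C) * h"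

lemma err_pos: "0 < err" using C_pos h_pos by (simp add: err_def)

text \<open>
  By \<open>one_step\<close>, each step adds at most \<open>C\<close> times the square of its length to the squared distance,
  and these squares have sum at most \<open>2 h\<^sup>2\<close>. The shadowing may begin at any grid time \<open>\<tau> n\<close>.
\<close>

lemma shadow:
  assumes Y: "y1 \<in> Y" "y2 \<in> Y" and u: "u \<in> controls U"
    and \<sigma>: "\<And>k. n \<le> k \<Longrightarrow> \<sigma> k = sel k (trajectory f u y1 (\<tau> k - \<tau> n), path \<sigma> y2 (\<tau> k))"
    and t: "0 \<le> t"
  shows "norm (trajectory f u y1 t - path \<sigma> y2 (\<tau> n + t)) \<le> norm (y1 - path \<sigma> y2 (\<tau> n)) + err"
proof -
  let ?p = "trajectory f u y1"
  define q where "q = path \<sigma> y2"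
  define d where "d = norm (y1 - q (\<tau> n))"
  have qY: "q t \<in> Y" if "0 \<le> t" for t unfolding q_def by (rule trajectory_in_Y[OF Y(2) ctrl_in_controls that])
  have within: "(norm (?p (\<tau> k - \<tau> n + r) - q (\<tau> k + r)))\<^sup>2 \<le> (norm (?p (\<tau> k - \<tau> n) - q (\<tau> k)))\<^sup>2 + C * (step k)\<^sup>2"
    if k: "n \<le> k" and r: "0 \<le> r" "r \<le> step k" for k r
  proof -
    have nn: "0 \<le> \<tau> k - \<tau> n" using \<tau>_mono[OF k] by simp
    have "trajectory f (\<lambda>r. u (r + (\<tau> k - \<tau> n))) (?p (\<tau> k - \<tau> n)) r = ?p (\<tau> k - \<tau> n + r)"
      using trajectory_shift[OF u nn r(1), of y1] by (simp add: add.commute)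
    moreover have "trajectory f (\<lambda>r. ctrl \<sigma> (r + \<tau> k)) (q (\<tau> k)) r = q (\<tau> k + r)"
      using trajectory_shift[OF ctrl_in_controls[of \<sigma>] \<tau>_nonneg[of k] r(1), of y2] by (simp add: add.commute q_def)
    moreover have "(norm (trajectory f (\<lambda>r. u (r + (\<tau> k - \<tau> n))) (?p (\<tau> k - \<tau> n)) r -
         trajectory f (\<lambda>r. ctrl \<sigma> (r + \<tau> k)) (q (\<tau> k)) r))\<^sup>2 \<le> (norm (?p (\<tau> k - \<tau> n) - q (\<tau> k)))\<^sup>2 + C * (step k)\<^sup>2"
    proof (rule one_step[where b="B k (\<sigma> k)"])
      show "?p (\<tau> k - \<tau> n) \<in> Y" by (rule trajectory_in_Y[OF Y(1) u nn])
      show "q (\<tau> k) \<in> Y" by (rule qY[OF \<tau>_nonneg])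
      show "(\<lambda>r. u (r + (\<tau> k - \<tau> n))) \<in> controls U" by (rule shift_in_controls[OF u nn])
      show "(\<lambda>r. ctrl \<sigma> (r + \<tau> k)) \<in> controls U" by (rule shift_in_controls[OF ctrl_in_controls \<tau>_nonneg])
      show "ctrl \<sigma> (r + \<tau> k) = B k (\<sigma> k)" if "0 \<le> r" "r < step k" for r
        by (rule ctrl_const) (use that in \<open>auto simp: \<tau>_Suc\<close>)
      show "B k (\<sigma> k) \<in> U" by (rule B_in)
      show "(?p (\<tau> k - \<tau> n) - q (\<tau> k)) \<bullet> (f (?p (\<tau> k - \<tau> n)) a - f (q (\<tau> k)) (B k (\<sigma> k))) \<le> step k" if "a \<in> U" for a
        unfolding \<sigma>[OF k, folded q_def]
        by (rule sel_best[OF trajectory_in_Y[OF Y(1) u nn] qY[OF \<tau>_nonneg] that])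
    qed (use r step_pos in auto)
    ultimately show ?thesis by simp
  qed
  have grid: "(norm (?p (\<tau> k - \<tau> n) - q (\<tau> k)))\<^sup>2 \<le> d\<^sup>2 + C * (\<Sum>i\<in>{n..<k}. (step i)\<^sup>2)" if "n \<le> k" for k
    using that
  proof (induction k rule: dec_induct)
    case base
    show ?case by (simp add: d_def trajectory_0[OF u])
  next
    case (step k)
    have "(norm (?p (\<tau> (Suc k) - \<tau> n) - q (\<tau> (Suc k))))\<^sup>2 \<le> (norm (?p (\<tau> k - \<tau> n) - q (\<tau> k)))\<^sup>2 + C * (local.step k)\<^sup>2"
      using within[of k "local.step k"] step step_pos[of k] by (simp add: \<tau>_Suc algebra_simps)
    also have "\<dots> \<le> d\<^sup>2 + C * (\<Sum>i\<in>{n..<Suc k}. (local.step i)\<^sup>2)"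
      using step by (simp add: algebra_simps)
    finally show ?case .
  qed
  define k where "k = cell (\<tau> n + t)"
  have k1: "\<tau> k \<le> \<tau> n + t" "\<tau> n + t < \<tau> (Suc k)"
    unfolding k_def using cell_lower[of "\<tau> n + t"] cell_upper[of "\<tau> n + t"] t \<tau>_nonneg[of n] by auto
  have nk: "n \<le> k"
  proof (rule ccontr)
    assume "\<not> n \<le> k"
    then have "\<tau> (Suc k) \<le> \<tau> n" by (intro \<tau>_mono) simp
    then show False using k1 t by simp
  qed
  have "(norm (?p t - q (\<tau> n + t)))\<^sup>2 \<le> (norm (?p (\<tau> k - \<tau> n) - q (\<tau> k)))\<^sup>2 + C * (step k)\<^sup>2"
    using within[OF nk, of "\<tau> n + t - \<tau> k"] k1 by (simp add: \<tau>_Suc)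
  also have "\<dots> \<le> d\<^sup>2 + C * (\<Sum>i\<in>{n..<Suc k}. (step i)\<^sup>2)"
    using grid[OF nk] nk by (simp add: algebra_simps)
  also have "\<dots> \<le> d\<^sup>2 + C * (2 * h\<^sup>2)"
    using sum_step_sq[of n "Suc k"] C_pos by (intro add_left_mono mult_left_mono) auto
  also have "\<dots> = d\<^sup>2 + err\<^sup>2" using C_pos by (simp add: err_def power_mult_distrib)
  also have "\<dots> \<le> (d + err)\<^sup>2" using err_pos by (simp add: power2_sum d_def)
  finally show ?thesis using err_pos unfolding q_def d_def by (auto intro: power2_le_imp_le)
qed

definition admissible where "admissible \<sigma> \<longleftrightarrow> (\<forall>k. \<sigma> k < digits k)"

text \<open>
  The state reached at time \<open>\<tau> n\<close> with the digits \<open>\<sigma>0\<close> becomes the initial state of a shadowing path, and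
  the whole is again coded by one digit sequence.
\<close>

lemma shadow_from:
  assumes Y: "y1 \<in> Y" "y2 \<in> Y" and u: "u \<in> controls U" and adm: "admissible \<sigma>0"
  obtains \<sigma> where "admissible \<sigma>" "\<And>k. k < n \<Longrightarrow> \<sigma> k = \<sigma>0 k"
    "\<And>t. 0 \<le> t \<Longrightarrow> norm (trajectory f u y1 t - path \<sigma> y2 (\<tau> n + t)) \<le> norm (y1 - path \<sigma>0 y2 (\<tau> n)) + err"
proof -
  define \<pi> where "\<pi> k x = (if k < n then \<sigma>0 k else sel k (trajectory f u y1 (\<tau> k - \<tau> n), x))" for k x
  define \<sigma> where "\<sigma> = (\<lambda>k. \<pi> k (run \<pi> y2 k))"
  have run: "path \<sigma> y2 (\<tau> k) = run \<pi> y2 k" for k unfolding \<sigma>_def by (rule path_run)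
  have 1: "\<sigma> k = \<sigma>0 k" if "k < n" for k using that by (simp add: \<sigma>_def \<pi>_def)
  have 2: "\<sigma> k = sel k (trajectory f u y1 (\<tau> k - \<tau> n), path \<sigma> y2 (\<tau> k))" if "n \<le> k" for k
    unfolding run using that by (simp add: \<sigma>_def \<pi>_def)
  have "admissible \<sigma>" using adm sel_less by (auto simp: admissible_def \<sigma>_def \<pi>_def)
  moreover have "path \<sigma> y2 (\<tau> n) = path \<sigma>0 y2 (\<tau> n)"
  proof (rule path_cong[OF _ \<tau>_nonneg])
    fix k assume "\<tau> k < \<tau> n"
    then have "k < n" using \<tau>_mono[of n k] by (cases "n \<le> k") auto
    then show "\<sigma> k = \<sigma>0 k" by (rule 1)
  qed
  ultimately show ?thesis using that[of \<sigma>] 1 shadow[OF Y u 2] by simp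
qed

lemma admissible_0: "admissible (\<lambda>_. 0)"
  unfolding admissible_def using sel_less by (metis gr0I not_less_zero)

lemma shadow_exists:
  assumes "y1 \<in> Y" "y2 \<in> Y" "u \<in> controls U"
  obtains \<sigma> where "admissible \<sigma>"
    "\<And>t. 0 \<le> t \<Longrightarrow> norm (trajectory f u y1 t - path \<sigma> y2 t) \<le> norm (y1 - y2) + err"
  by (rule shadow_from[OF assms admissible_0, of 0]) (auto simp: trajectory_0[OF ctrl_in_controls] intro: that)

text \<open>
  After an arbitrary delay \<open>s\<close> the state is close to one of finitely many states that are reached at
  grid times, since the reachable set lies in the compact set \<open>Y\<close>. From that state one shadows the
  remaining trajectory.
\<close>

lemma finitely_many_shifts:
  assumes y: "y \<in> Y"
  obtains F where "finite F" "\<And>s u. 0 \<le> s \<Longrightarrow> u \<in> controls U \<Longrightarrow>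
    \<exists>k\<in>F. \<exists>\<sigma>. admissible \<sigma> \<and> (\<forall>t\<ge>0. norm (trajectory f u y (t + s) - path \<sigma> y (\<tau> k + t)) \<le> 2 * err + (A + 1) * h)"
proof -
  define S where "S = {(k :: nat, \<sigma>). admissible \<sigma>}"
  define e where "e z = path (snd z) y (\<tau> (fst z))" for z
  have eY: "e z \<in> Y" for z unfolding e_def by (rule trajectory_in_Y[OF y ctrl_in_controls \<tau>_nonneg])
  obtain K where K: "finite K" "Y \<subseteq> (\<Union>x\<in>K. ball x (h / 2))"
    using seq_compact_imp_totally_bounded[of Y] compact_Y h_pos compact_imp_seq_compact by (metis half_gt_zero)
  define pick where "pick x = (SOME z. z \<in> S \<and> e z \<in> ball x (h / 2))" for x
  define F where "F = (\<lambda>x. fst (pick x)) ` K"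
  have "\<exists>k\<in>F. \<exists>\<sigma>. admissible \<sigma> \<and> (\<forall>t\<ge>0. norm (trajectory f u y (t + s) - path \<sigma> y (\<tau> k + t)) \<le> 2 * err + (A + 1) * h)"
    if s: "0 \<le> s" and u: "u \<in> controls U" for s u
  proof -
    obtain \<sigma>1 where \<sigma>1: "admissible \<sigma>1" "\<And>t. 0 \<le> t \<Longrightarrow> norm (trajectory f u y t - path \<sigma>1 y t) \<le> err"
      using shadow_exists[OF y y u] by auto
    define n where "n = cell s"
    have n: "\<tau> n \<le> s" "s - \<tau> n \<le> h"
      using cell_lower[OF s] cell_upper[of s] step_le[of n] by (auto simp: n_def \<tau>_Suc)
    have z: "(n, \<sigma>1) \<in> S" using \<sigma>1 by (simp add: S_def)
    obtain x where x: "x \<in> K" "e (n, \<sigma>1) \<in> ball x (h / 2)" using eY K(2) by blast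
    have px: "pick x \<in> S \<and> e (pick x) \<in> ball x (h / 2)"
      unfolding pick_def by (rule someI[of _ "(n, \<sigma>1)"]) (use x z in simp)
    define k \<sigma>2 where "k = fst (pick x)" and "\<sigma>2 = snd (pick x)"
    have \<sigma>2: "admissible \<sigma>2" using px by (auto simp: S_def \<sigma>2_def)
    have d1: "norm (trajectory f u y s - path \<sigma>1 y s) \<le> err" by (rule \<sigma>1(2)[OF s])
    have d2: "norm (path \<sigma>1 y s - path \<sigma>1 y (\<tau> n)) \<le> A * h"
    proof -
      have "norm (path \<sigma>1 y s - path \<sigma>1 y (\<tau> n)) \<le> A * \<bar>s - \<tau> n\<bar>"
        by (rule trajectory_lipschitz[OF y ctrl_in_controls \<tau>_nonneg s])
      also have "\<dots> \<le> A * h" using n A_pos by (intro mult_left_mono) auto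
      finally show ?thesis .
    qed
    have d3: "norm (path \<sigma>1 y (\<tau> n) - path \<sigma>2 y (\<tau> k)) \<le> h"
    proof -
      have "dist (e (n, \<sigma>1)) (e (pick x)) \<le> dist x (e (n, \<sigma>1)) + dist x (e (pick x))" by (rule dist_triangle3)
      then show ?thesis using x(2) px by (simp add: e_def k_def \<sigma>2_def dist_norm)
    qed
    have d: "norm (trajectory f u y s - path \<sigma>2 y (\<tau> k)) \<le> err + (A + 1) * h"
      using norm_triangle_ineq[of "trajectory f u y s - path \<sigma>1 y s" "path \<sigma>1 y s - path \<sigma>1 y (\<tau> n)"]
        norm_triangle_ineq[of "trajectory f u y s - path \<sigma>1 y (\<tau> n)" "path \<sigma>1 y (\<tau> n) - path \<sigma>2 y (\<tau> k)"] d1 d2 d3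
      by (simp add: algebra_simps)
    obtain \<sigma> where \<sigma>: "admissible \<sigma>" "\<And>t. 0 \<le> t \<Longrightarrow> norm (trajectory f (\<lambda>r. u (r + s)) (trajectory f u y s) t - path \<sigma> y (\<tau> k + t))
        \<le> norm (trajectory f u y s - path \<sigma>2 y (\<tau> k)) + err"
      using shadow_from[OF trajectory_in_Y[OF y u s] y shift_in_controls[OF u s] \<sigma>2, of k] by metis
    have "norm (trajectory f u y (t + s) - path \<sigma> y (\<tau> k + t)) \<le> 2 * err + (A + 1) * h" if "0 \<le> t" for t
      using \<sigma>(2)[OF that] d trajectory_shift[OF u s that, of y] by simp
    moreover have "k \<in> F" using x(1) by (auto simp: F_def k_def)
    ultimately show ?thesis using \<sigma>(1) by blast
  qed
  then show ?thesis using that[of F] K(1) by (simp add: F_def)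
qed

end

section \<open>Evaluations and the total variation of their shifts\<close>

lemma staircase_approximation:
  fixes x :: real
  assumes x: "0 \<le> x" "x \<le> 1" and n: "0 < n"
  shows "\<bar>(\<Sum>i\<in>{1..n}. of_bool (real i / real n \<le> x)) / real n - x\<bar> \<le> 1 / real n"
proof -
  define m where "m = nat \<lfloor>real n * x\<rfloor>"
  have fl: "real m \<le> real n * x" "real n * x < real m + 1"
    unfolding m_def using x by (auto simp: of_nat_nat)
  have "real m \<le> real n" using fl(1) x n by (smt (verit) mult_left_le of_nat_0_le_iff)
  then have mn: "m \<le> n" by simp
  have "{i\<in>{1..n}. real i / real n \<le> x} = {1..m}"
  proof (intro set_eqI iffI)
    fix i assume "i \<in> {i\<in>{1..n}. real i / real n \<le> x}"
    then have "1 \<le> i" "real i \<le> real n * x" using n by (auto simp: field_simps)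
    then have "real i < real m + 1" using fl by simp
    then show "i \<in> {1..m}" using \<open>1 \<le> i\<close> by auto
  next
    fix i assume i: "i \<in> {1..m}"
    then have "real i \<le> real n * x" using fl(1) by (smt (verit) atLeastAtMost_iff of_nat_mono)
    then show "i \<in> {i\<in>{1..n}. real i / real n \<le> x}" using i mn n by (auto simp: field_simps)
  qed
  then have "(\<Sum>i\<in>{1..n}. of_bool (real i / real n \<le> x)) = real m"
    by (simp add: sum.If_cases of_bool_def Int_def)
  moreover have "real m / real n \<le> x" "x \<le> real m / real n + 1 / real n" using fl n by (simp_all add: field_simps)
  ultimately show ?thesis by simp
qed

text \<open>
  The expectation of a \<open>[0, 1]\<close>-valued variable is the integral over \<open>x\<close> of the probabilities of its
  level sets; here this integral is replaced by its Riemann sums.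
\<close>

lemma (in prob_space) expectation_diff_le_level_sets:
  fixes X X' :: "'a \<Rightarrow> real"
  assumes [measurable]: "X \<in> borel_measurable M" "X' \<in> borel_measurable M"
    and X: "\<And>w. w \<in> space M \<Longrightarrow> X w \<in> {0..1}" and X': "\<And>w. w \<in> space M \<Longrightarrow> X' w \<in> {0..1}"
    and lev: "\<And>x. \<bar>prob {w\<in>space M. x \<le> X w} - prob {w\<in>space M. x \<le> X' w}\<bar> \<le> \<eta>"
  shows "\<bar>expectation X - expectation X'\<bar> \<le> \<eta>"
proof (rule field_le_epsilon)
  fix e :: real assume e: "0 < e"
  obtain n where n: "0 < n" "2 / real n < e"
    using reals_Archimedean2[of "2 / e"] e
    by (metis divide_less_eq less_trans mult.commute of_nat_0_less_iff zero_less_divide_iff zero_less_numeral)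
  define S where "S Z w = (\<Sum>i\<in>{1..n}. of_bool (real i / real n \<le> Z w)) / real n" for Z :: "'a \<Rightarrow> real" and w
  have *: "\<bar>expectation Z - (\<Sum>i\<in>{1..n}. prob {w\<in>space M. real i / real n \<le> Z w}) / real n\<bar> \<le> 1 / real n"
    if [measurable]: "Z \<in> borel_measurable M" and Z: "\<And>w. w \<in> space M \<Longrightarrow> Z w \<in> {0..1}" for Z
  proof -
    have iZ: "integrable M Z" by (rule integrable_const_bound[where B=1]) (use Z in auto)
    have iB: "integrable M (\<lambda>w. of_bool (real i / real n \<le> Z w) :: real)" for i
      by (rule integrable_const_bound[where B=1]) auto
    have iS: "integrable M (S Z)" unfolding S_def by (intro integrable_divide Bochner_Integration.integrable_sum iB)
    have "expectation (\<lambda>w. of_bool (real i / real n \<le> Z w) :: real) = prob {w\<in>space M. real i / real n \<le> Z w}" for i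
    proof -
      have "expectation (\<lambda>w. of_bool (real i / real n \<le> Z w) :: real) = expectation (indicator {w\<in>space M. real i / real n \<le> Z w})"
        by (rule Bochner_Integration.integral_cong) auto
      then show ?thesis by simp
    qed
    then have "expectation (S Z) = (\<Sum>i\<in>{1..n}. prob {w\<in>space M. real i / real n \<le> Z w}) / real n"
      unfolding S_def integral_divide_zero Bochner_Integration.integral_sum[OF iB] by simp
    moreover have "\<bar>expectation Z - expectation (S Z)\<bar> \<le> 1 / real n"
    proof -
      have "\<bar>expectation (\<lambda>w. Z w - S Z w)\<bar> \<le> expectation (\<lambda>w. \<bar>Z w - S Z w\<bar>)"
        by (rule integral_abs_bound)
      also have "\<dots> \<le> expectation (\<lambda>w. 1 / real n)"
      proof (rule integral_mono)
        fix w assume "w \<in> space M"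
        then show "\<bar>Z w - S Z w\<bar> \<le> 1 / real n"
          using staircase_approximation[of "Z w" n] Z[of w] n unfolding S_def by (simp add: abs_minus_commute)
      qed (use iZ iS in auto)
      finally show ?thesis using iZ iS by (simp add: prob_space)
    qed
    ultimately show ?thesis by simp
  qed
  let ?P = "\<lambda>Z. (\<Sum>i\<in>{1..n}. prob {w\<in>space M. real i / real n \<le> Z w})"
  have "\<bar>?P X - ?P X'\<bar> \<le> (\<Sum>i\<in>{1..n}. \<eta>)"
    unfolding sum_subtractf[symmetric] by (rule order_trans[OF sum_abs], rule sum_mono, rule lev)
  then have "\<bar>?P X / real n - ?P X' / real n\<bar> \<le> \<eta>"
    using n by (simp add: diff_divide_distrib[symmetric] divide_le_eq mult.commute)
  moreover have "\<bar>expectation X - ?P X / real n\<bar> \<le> 1 / real n" by (rule *) (use X in auto)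
  moreover have "\<bar>expectation X' - ?P X' / real n\<bar> \<le> 1 / real n" by (rule *) (use X' in auto)
  moreover have "1 / real n + 1 / real n < e" using n(2) by simp
  ultimately show "\<bar>expectation X - expectation X'\<bar> \<le> \<eta> + e" by linarith
qed

lemma space_half_line: "space half_line = {0..}"
  by (simp add: space_restrict_space)

lemma evaluationsD:
  assumes "\<theta> \<in> evaluations"
  shows "prob_space \<theta>" "sets \<theta> = sets half_line" "space \<theta> = {0..}"
  using assms sets_eq_imp_space_eq[of \<theta> half_line] by (auto simp: evaluations_def space_half_line)

lemma borel_measurable_evaluation:
  "\<theta> \<in> evaluations \<Longrightarrow> k \<in> borel_measurable half_line \<Longrightarrow> k \<in> borel_measurable \<theta>"
  by (subst measurable_cong_sets[OF evaluationsD(2) refl])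

lemma sets_half_line: "Q \<in> sets half_line \<longleftrightarrow> Q \<in> sets borel \<and> Q \<subseteq> {0..}"
  by (simp add: sets_restrict_space_iff conj_commute)

lemma TV_bounds:
  assumes "\<theta> \<in> evaluations"
  shows "Q \<in> sets half_line \<Longrightarrow> \<bar>measure \<theta> Q - measure \<theta> ((\<lambda>t. t + s) ` Q)\<bar> \<le> TV s \<theta>"
    and "0 \<le> TV s \<theta>" and "TV s \<theta> \<le> 1"
proof -
  interpret prob_space \<theta> by (rule evaluationsD(1)[OF assms])
  have le1: "\<bar>measure \<theta> Q - measure \<theta> ((\<lambda>t. t + s) ` Q)\<bar> \<le> 1" for Q
    using prob_le_1[of Q] prob_le_1[of "(\<lambda>t. t + s) ` Q"] measure_nonneg[of \<theta> Q] measure_nonneg[of \<theta> "(\<lambda>t. t + s) ` Q"]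
    by linarith
  have bdd: "bdd_above ((\<lambda>Q. \<bar>measure \<theta> Q - measure \<theta> ((\<lambda>t. t + s) ` Q)\<bar>) ` sets half_line)"
    using le1 by (intro bdd_aboveI2[where M=1])
  show 1: "\<bar>measure \<theta> Q - measure \<theta> ((\<lambda>t. t + s) ` Q)\<bar> \<le> TV s \<theta>" if "Q \<in> sets half_line" for Q
    unfolding TV_def by (rule cSUP_upper[OF that bdd])
  show "0 \<le> TV s \<theta>" using 1[of "{}"] by simp
  show "TV s \<theta> \<le> 1" unfolding TV_def by (rule cSUP_least) (use le1 in \<open>auto intro: sets.empty_sets\<close>)
qed

lemma TV_le_SUP:
  assumes "\<theta> \<in> evaluations" "(SUP s\<in>{0..S}. TV s \<theta>) \<le> \<eta>" "0 \<le> s" "s \<le> S"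
  shows "TV s \<theta> \<le> \<eta>"
proof -
  have "bdd_above ((\<lambda>s. TV s \<theta>) ` {0..S})" using TV_bounds(3)[OF assms(1)] by (intro bdd_aboveI2[where M=1])
  then have "TV s \<theta> \<le> (SUP s\<in>{0..S}. TV s \<theta>)" using assms by (intro cSUP_upper) auto
  then show ?thesis using assms by simp
qed

text \<open>
  The set where \<open>k(t + s) \<ge> c\<close>, translated by \<open>s\<close>, is the part of the set where \<open>k \<ge> c\<close> beyond \<open>s\<close>, and
  the mass of \<open>[0, s)\<close> is at most \<open>TV s \<theta>\<close>. So the level sets of the two integrands differ in
  probability by at most \<open>2 TV s \<theta>\<close>; rescaling from \<open>[-M, M]\<close> to \<open>[0, 1]\<close> gives the factor \<open>4 M\<close>.
\<close>

lemma integral_shift_TV: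
  fixes k :: "real \<Rightarrow> real"
  assumes \<theta>: "\<theta> \<in> evaluations" and k: "k \<in> borel_measurable half_line"
    and M: "0 < M" "\<And>t. 0 \<le> t \<Longrightarrow> \<bar>k t\<bar> \<le> M" and s: "0 \<le> s"
  shows "\<bar>(LINT t|\<theta>. k (t + s)) - (LINT t|\<theta>. k t)\<bar> \<le> 4 * M * TV s \<theta>"
proof -
  interpret prob_space \<theta> by (rule evaluationsD(1)[OF \<theta>])
  note sp = evaluationsD(3)[OF \<theta>]
  have "(\<lambda>t. t + s) \<in> half_line \<rightarrow>\<^sub>M half_line" by (rule measurable_restrict_space3) (use s in auto)
  then have ks': "(\<lambda>t. k (t + s)) \<in> borel_measurable half_line" using k by (rule measurable_compose)
  have ks [measurable]: "(\<lambda>t. k (t + s)) \<in> borel_measurable \<theta>" by (rule borel_measurable_evaluation[OF \<theta> ks'])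
  have k' [measurable]: "k \<in> borel_measurable \<theta>" by (rule borel_measurable_evaluation[OF \<theta> k])
  define X where "X Z t = (Z t + M) / (2 * M)" for Z :: "real \<Rightarrow> real" and t
  have X01: "X Z t \<in> {0..1}" if "\<bar>Z t\<bar> \<le> M" for Z t
    using that M(1) by (auto simp: X_def field_simps abs_le_iff)
  have EX: "expectation (X Z) = (expectation Z + M) / (2 * M)" if [measurable]: "Z \<in> borel_measurable \<theta>" and "\<And>t. t \<in> space \<theta> \<Longrightarrow> \<bar>Z t\<bar> \<le> M" for Z
  proof -
    have "integrable \<theta> Z" by (rule integrable_const_bound[where B=M]) (use that in auto)
    then show ?thesis unfolding X_def by (simp add: prob_space)
  qed
  have "\<bar>expectation (X (\<lambda>t. k (t + s))) - expectation (X k)\<bar> \<le> 2 * TV s \<theta>"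
  proof (rule expectation_diff_le_level_sets)
    show "X (\<lambda>t. k (t + s)) \<in> borel_measurable \<theta>" "X k \<in> borel_measurable \<theta>" unfolding X_def by measurable
    show "X (\<lambda>t. k (t + s)) w \<in> {0..1}" "X k w \<in> {0..1}" if "w \<in> space \<theta>" for w
      using X01[of "\<lambda>t. k (t + s)" w] X01[of k w] M(2)[of "w + s"] M(2)[of w] that sp s by simp_all
    fix x :: real
    define c where "c = 2 * M * x - M"
    have lev: "x \<le> X Z t \<longleftrightarrow> c \<le> Z t" for Z t using M(1) by (auto simp: X_def c_def field_simps)
    define Q where "Q = {t \<in> {0..}. c \<le> k (t + s)}"
    have "{t \<in> space half_line. c \<le> k (t + s)} \<in> sets half_line" using ks' by measurable
    then have Q: "Q \<in> sets half_line" unfolding Q_def space_half_line .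
    have Qs: "(\<lambda>t. t + s) ` Q = {t \<in> {s..}. c \<le> k t}"
    proof (intro set_eqI iffI)
      fix t assume "t \<in> {t \<in> {s..}. c \<le> k t}"
      then have "t - s \<in> Q" by (auto simp: Q_def)
      then show "t \<in> (\<lambda>t. t + s) ` Q" by (rule rev_image_eqI) simp
    qed (auto simp: Q_def)
    have Z0: "(\<lambda>t. t + s) ` {0..} = {s..}"
      using s by (auto simp: image_iff intro!: bexI[of _ "t - s" for t])
    have 1: "\<bar>prob Q - prob {t \<in> {s..}. c \<le> k t}\<bar> \<le> TV s \<theta>"
      using TV_bounds(1)[OF \<theta> Q, of s] unfolding Qs .
    have "{0..} \<in> sets half_line" using sets.top[of half_line] by (simp add: space_half_line)
    then have 2: "\<bar>prob {0..} - prob {s..}\<bar> \<le> TV s \<theta>"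
      using TV_bounds(1)[OF \<theta>, of "{0..}" s] unfolding Z0 by blast
    have m: "{s..} \<in> sets \<theta>" "{0..<s} \<in> sets \<theta>" "{0..} \<in> sets \<theta>"
      using evaluationsD(2)[OF \<theta>] s by (auto simp: sets_half_line)
    have m2: "{t \<in> {s..}. c \<le> k t} \<in> sets \<theta>" "{t \<in> {0..<s}. c \<le> k t} \<in> sets \<theta>"
    proof -
      have "{t \<in> space \<theta>. c \<le> k t} \<in> sets \<theta>" by measurable
      then have lev: "{t \<in> {0..}. c \<le> k t} \<in> sets \<theta>" unfolding sp .
      have "{t \<in> {s..}. c \<le> k t} = {t \<in> {0..}. c \<le> k t} \<inter> {s..}"
        "{t \<in> {0..<s}. c \<le> k t} = {t \<in> {0..}. c \<le> k t} \<inter> {0..<s}" using s by force+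
      then show "{t \<in> {s..}. c \<le> k t} \<in> sets \<theta>" "{t \<in> {0..<s}. c \<le> k t} \<in> sets \<theta>"
        using sets.Int[OF lev m(1)] sets.Int[OF lev m(2)] by (simp_all only:)
    qed
    have "prob {0..} = prob {s..} + prob {0..<s}"
    proof -
      have "{0..} = {s..} \<union> {0..<s}" "{s..} \<inter> {0..<s} = {}" using s by auto
      then show ?thesis using finite_measure_Union[of "{s..}" "{0..<s}"] m by auto
    qed
    moreover have "prob {t \<in> {0..}. c \<le> k t} = prob {t \<in> {s..}. c \<le> k t} + prob {t \<in> {0..<s}. c \<le> k t}"
    proof -
      have "{t \<in> {0..}. c \<le> k t} = {t \<in> {s..}. c \<le> k t} \<union> {t \<in> {0..<s}. c \<le> k t}"
        "{t \<in> {s..}. c \<le> k t} \<inter> {t \<in> {0..<s}. c \<le> k t} = {}" using s by force+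
      then show ?thesis using finite_measure_Union[OF m2] by auto
    qed
    moreover have "prob {t \<in> {0..<s}. c \<le> k t} \<le> prob {0..<s}"
      by (rule finite_measure_mono) (use m in auto)
    moreover have "0 \<le> prob {t \<in> {0..<s}. c \<le> k t}" by simp
    ultimately have "\<bar>prob Q - prob {t \<in> {0..}. c \<le> k t}\<bar> \<le> 2 * TV s \<theta>" using 1 2 by linarith
    then show "\<bar>prob {w \<in> space \<theta>. x \<le> X (\<lambda>t. k (t + s)) w} - prob {w \<in> space \<theta>. x \<le> X k w}\<bar> \<le> 2 * TV s \<theta>"
      unfolding lev sp Q_def .
  qed
  moreover have "expectation (X (\<lambda>t. k (t + s))) = ((LINT t|\<theta>. k (t + s)) + M) / (2 * M)"
    by (rule EX) (use M s sp in auto)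
  moreover have "expectation (X k) = ((LINT t|\<theta>. k t) + M) / (2 * M)"
    by (rule EX) (use M s sp in auto)
  ultimately have "\<bar>((LINT t|\<theta>. k (t + s)) + M) / (2 * M) - ((LINT t|\<theta>. k t) + M) / (2 * M)\<bar> \<le> 2 * TV s \<theta>" by simp
  then have "\<bar>(LINT t|\<theta>. k (t + s)) - (LINT t|\<theta>. k t)\<bar> / (2 * M) \<le> 2 * TV s \<theta>"
    using M(1) by (simp add: diff_divide_distrib[symmetric])
  then show ?thesis using M(1) by (simp add: field_simps)
qed

definition density_evaluation :: "(real \<Rightarrow> real) \<Rightarrow> real measure" where
  "density_evaluation \<phi> = restrict_space (density lborel \<phi>) {0..}"

text \<open>
  Abel and Cesaro means have decreasing densities. For such a density the mass of a set decreases under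
  translation to the right, and the loss is largest for the whole half-line; so the total variation is
  the mass of \<open>[0, s)\<close>, which is at most \<open>s\<close> times the density at 0.
\<close>

locale decreasing_density =
  fixes \<phi> :: "real \<Rightarrow> real"
  assumes meas [measurable]: "\<phi> \<in> borel_measurable borel"
    and nonneg: "\<And>t. 0 \<le> \<phi> t" and zero: "\<And>t. t < 0 \<Longrightarrow> \<phi> t = 0"
    and prob: "prob_space (density lborel \<phi>)"
    and decreasing: "\<And>s t. 0 \<le> s \<Longrightarrow> s \<le> t \<Longrightarrow> \<phi> t \<le> \<phi> s"
begin

lemma integrable_density: "integrable lborel \<phi>"
proof -
  have "emeasure (density lborel \<phi>) UNIV = 1" using prob_space.emeasure_space_1[OF prob] by simp
  then have "(\<integral>\<^sup>+x. ennreal (\<phi> x) \<partial>lborel) = 1" by (simp add: emeasure_density)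
  then show ?thesis using nonneg by (intro integrableI_nonneg) auto
qed

lemma integral_evaluation:
  fixes k :: "real \<Rightarrow> real"
  assumes k: "k \<in> borel_measurable half_line"
  shows "(LINT t|density_evaluation \<phi>. k t) = (LINT t:{0..}|lborel. \<phi> t * k t)"
proof -
  have [measurable]: "(\<lambda>t. indicator {0..} t * k t) \<in> borel_measurable borel"
    using k borel_measurable_restrict_space_iff[of "{0..}" borel k] by simp
  have "(LINT t|density_evaluation \<phi>. k t) = (LINT t|density lborel \<phi>. indicator {0..} t * k t)"
    unfolding density_evaluation_def real_scaleR_def[symmetric] by (rule integral_restrict_space) simp
  also have "\<dots> = (LINT t|lborel. \<phi> t *\<^sub>R (indicator {0..} t * k t))"
    by (rule integral_density) (use nonneg in auto)
  finally show ?thesis by (simp add: set_lebesgue_integral_def mult_ac)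
qed

lemma measure_density: "S \<in> sets borel \<Longrightarrow> measure (density lborel \<phi>) S = (LINT t|lborel. \<phi> t * indicator S t)"
proof -
  assume [measurable]: "S \<in> sets borel"
  interpret prob_space "density lborel \<phi>" by (rule prob)
  have "measure (density lborel \<phi>) S = (LINT t|density lborel \<phi>. indicator S t)" by simp
  also have "\<dots> = (LINT t|lborel. \<phi> t *\<^sub>R indicator S t)" by (rule integral_density) (use nonneg in auto)
  finally show ?thesis by simp
qed

lemma evaluation: "density_evaluation \<phi> \<in> evaluations"
proof -
  have "measure (density lborel \<phi>) {0..} = (LINT t|lborel. \<phi> t * indicator {0..} t)" by (simp add: measure_density)
  also have "\<dots> = (LINT t|lborel. \<phi> t * indicator UNIV t)"
    by (rule Bochner_Integration.integral_cong) (use zero in \<open>auto simp: indicator_def not_le\<close>)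
  also have "\<dots> = measure (density lborel \<phi>) UNIV" by (simp add: measure_density)
  also have "\<dots> = 1" using prob_space.prob_space[OF prob] by simp
  finally have "emeasure (density lborel \<phi>) {0..} = 1"
    by (simp add: finite_measure.emeasure_eq_measure[OF prob_space.finite_measure[OF prob]])
  then have "prob_space (density_evaluation \<phi>)"
    unfolding density_evaluation_def by (intro prob_spaceI) (simp add: space_restrict_space emeasure_restrict_space)
  then show ?thesis
    unfolding evaluations_def density_evaluation_def
    by (auto intro!: sets_restrict_space_cong)
qed

lemma TV_evaluation:
  assumes s: "0 \<le> s"
  shows "TV s (density_evaluation \<phi>) \<le> s * \<phi> 0"
  unfolding TV_def
proof (rule cSUP_least)
  show "sets half_line \<noteq> {}" by (auto intro: sets.empty_sets)
  fix Q assume "Q \<in> sets half_line"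
  then have Q [measurable]: "Q \<in> sets borel" and Q0: "Q \<subseteq> {0..}" by (auto simp: sets_half_line)
  have ind: "indicator ((\<lambda>t. t + s) ` Q) (s + t) = (indicator Q t :: real)" for Q t
    by (auto simp: indicator_def image_iff)
  have Qs': "(\<lambda>t. t + s) ` Q = (\<lambda>t. t - s) -` Q \<inter> space borel"
    by (auto simp: image_iff) (metis add.commute diff_add_cancel)
  have Qs [measurable]: "(\<lambda>t. t + s) ` Q \<in> sets borel"
    unfolding Qs' by measurable
  have ish: "integrable lborel (\<lambda>t. \<phi> (s + t))"
    using lborel_integrable_real_affine[OF integrable_density, of 1 s] by simp
  have i1: "integrable lborel (\<lambda>t. \<phi> t * indicator S t)" if "S \<in> sets borel" for S
    using integrable_real_mult_indicator[OF _ integrable_density, of S] that by simp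
  have i2: "integrable lborel (\<lambda>t. \<phi> (s + t) * indicator S t)" if "S \<in> sets borel" for S
    using integrable_real_mult_indicator[OF _ ish, of S] that by simp
  have shift: "(LINT t|lborel. \<phi> t * indicator ((\<lambda>t. t + s) ` S) t) = (LINT t|lborel. \<phi> (s + t) * indicator S t)" for S
    using lborel_integral_real_affine[of 1 "\<lambda>t. \<phi> t * indicator ((\<lambda>t. t + s) ` S) t" s] by (simp add: ind)
  have Z0: "(\<lambda>t. t + s) ` {0..} = {s..}"
    using s by (auto simp: image_iff intro!: bexI[of _ "t - s" for t])
  have m: "measure (density_evaluation \<phi>) S = measure (density lborel \<phi>) S" if "S \<subseteq> {0..}" for S
    unfolding density_evaluation_def by (rule measure_restrict_space) (use that in auto)
  have sub: "(\<lambda>t. t + s) ` Q \<subseteq> {0..}" using Q0 s by auto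
  have "measure (density_evaluation \<phi>) Q - measure (density_evaluation \<phi>) ((\<lambda>t. t + s) ` Q)
     = (LINT t|lborel. \<phi> t * indicator Q t) - (LINT t|lborel. \<phi> (s + t) * indicator Q t)"
    by (simp add: m Q0 sub measure_density shift)
  also have "\<dots> = (LINT t|lborel. (\<phi> t - \<phi> (s + t)) * indicator Q t)"
    using i1[OF Q] i2[OF Q] by (simp add: left_diff_distrib)
  finally have eq: "measure (density_evaluation \<phi>) Q - measure (density_evaluation \<phi>) ((\<lambda>t. t + s) ` Q)
     = (LINT t|lborel. (\<phi> t - \<phi> (s + t)) * indicator Q t)" .
  have "0 \<le> (LINT t|lborel. (\<phi> t - \<phi> (s + t)) * indicator Q t)"
    by (rule Bochner_Integration.integral_nonneg) (use Q0 s decreasing in \<open>auto simp: indicator_def\<close>)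
  moreover have "(LINT t|lborel. (\<phi> t - \<phi> (s + t)) * indicator Q t) \<le> s * \<phi> 0"
  proof -
    have "(LINT t|lborel. (\<phi> t - \<phi> (s + t)) * indicator Q t) \<le> (LINT t|lborel. (\<phi> t - \<phi> (s + t)) * indicator {0..} t)"
    proof (rule integral_mono)
      show "integrable lborel (\<lambda>t. (\<phi> t - \<phi> (s + t)) * indicator Q t)" using i1[OF Q] i2[OF Q] by (simp add: left_diff_distrib)
      show "integrable lborel (\<lambda>t. (\<phi> t - \<phi> (s + t)) * indicator {0..} t)"
        using i1[of "{0..}"] i2[of "{0..}"] by (simp add: left_diff_distrib)
    qed (use Q0 s decreasing in \<open>auto simp: indicator_def\<close>)
    also have "\<dots> = (LINT t|lborel. \<phi> t * indicator {0..} t) - (LINT t|lborel. \<phi> (s + t) * indicator {0..} t)"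
      using i1[of "{0..}"] i2[of "{0..}"] by (simp add: left_diff_distrib)
    also have "(LINT t|lborel. \<phi> (s + t) * indicator {0..} t) = (LINT t|lborel. \<phi> t * indicator {s..} t)"
      using shift[of "{0..}"] unfolding Z0 by simp
    also have "(LINT t|lborel. \<phi> t * indicator {0..} t) - (LINT t|lborel. \<phi> t * indicator {s..} t)
        = (LINT t|lborel. \<phi> t * indicator {0..} t - \<phi> t * indicator {s..} t)"
      using i1[of "{0..}"] i1[of "{s..}"] by simp
    also have "\<dots> \<le> (LINT t|lborel. \<phi> 0 * indicator {0..s} t)"
    proof (rule integral_mono)
      show "integrable lborel (\<lambda>t. \<phi> t * indicator {0..} t - \<phi> t * indicator {s..} t)"
        using i1[of "{0..}"] i1[of "{s..}"] by simp
      show "integrable lborel (\<lambda>t. \<phi> 0 * indicator {0..s} t)"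
        by (intro integrable_mult_right integrable_real_indicator) (use s in auto)
    qed (use s decreasing nonneg in \<open>auto simp: indicator_def\<close>)
    also have "\<dots> = s * \<phi> 0" using s by simp
    finally show ?thesis .
  qed
  ultimately show "\<bar>measure (density_evaluation \<phi>) Q - measure (density_evaluation \<phi>) ((\<lambda>t. t + s) ` Q)\<bar> \<le> s * \<phi> 0"
    unfolding eq by simp
qed

end

definition abel :: "real \<Rightarrow> real measure" where
  "abel \<rho> = density_evaluation (exponential_density \<rho>)"

definition cesaro :: "real \<Rightarrow> real measure" where
  "cesaro T = density_evaluation (\<lambda>t. indicator {0..T} t / T)"

lemma decreasing_density_exponential:
  assumes \<rho>: "0 < \<rho>"
  shows "decreasing_density (exponential_density \<rho>)"
proof (rule decreasing_density.intro)
  show "prob_space (density lborel (exponential_density \<rho>))" by (rule prob_space_exponential_density[OF \<rho>])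
  show "exponential_density \<rho> t \<le> exponential_density \<rho> s" if "0 \<le> s" "s \<le> t" for s t
    using that \<rho> by (simp add: exponential_density_def)
  show "0 \<le> exponential_density \<rho> t" for t using \<rho> by (simp add: exponential_density_def)
  show "exponential_density \<rho> t = 0" if "t < 0" for t using that by (simp add: exponential_density_def)
qed simp

lemma decreasing_density_uniform:
  assumes T: "0 < T"
  shows "decreasing_density (\<lambda>t. indicator {0..T} t / T)"
proof (rule decreasing_density.intro)
  have "(\<integral>\<^sup>+x. ennreal (indicator {0..T} x / T) \<partial>lborel) = (\<integral>\<^sup>+x. ennreal (1 / T) * indicator {0..T} x \<partial>lborel)"
    by (rule nn_integral_cong) (auto simp: indicator_def)
  also have "\<dots> = 1" using T by (simp add: nn_integral_cmult_indicator ennreal_mult[symmetric])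
  finally show "prob_space (density lborel (\<lambda>x. ennreal (indicator {0..T} x / T)))"
    by (intro prob_spaceI) (simp add: emeasure_density)
qed (use T in \<open>auto simp: indicator_def\<close>)

lemma abel_evaluation: "0 < \<rho> \<Longrightarrow> abel \<rho> \<in> evaluations"
  unfolding abel_def by (rule decreasing_density.evaluation[OF decreasing_density_exponential])

lemma cesaro_evaluation: "0 < T \<Longrightarrow> cesaro T \<in> evaluations"
  unfolding cesaro_def by (rule decreasing_density.evaluation[OF decreasing_density_uniform])

lemma TV_abel: "0 < \<rho> \<Longrightarrow> 0 \<le> s \<Longrightarrow> TV s (abel \<rho>) \<le> s * \<rho>"
  unfolding abel_def using decreasing_density.TV_evaluation[OF decreasing_density_exponential, of \<rho> s]
  by (simp add: exponential_density_def)

lemma TV_cesaro: "0 < T \<Longrightarrow> 0 \<le> s \<Longrightarrow> TV s (cesaro T) \<le> s / T"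
  unfolding cesaro_def using decreasing_density.TV_evaluation[OF decreasing_density_uniform, of T s] by simp

lemma integral_abel:
  fixes k :: "real \<Rightarrow> real"
  assumes "0 < \<rho>" "k \<in> borel_measurable half_line"
  shows "(LINT t|abel \<rho>. k t) = (LINT t:{0..}|lborel. \<rho> * exp (- \<rho> * t) * k t)"
  unfolding abel_def decreasing_density.integral_evaluation[OF decreasing_density_exponential assms(2), OF assms(1)]
  by (rule set_lebesgue_integral_cong) (auto simp: exponential_density_def mult_ac)

lemma integral_cesaro:
  fixes k :: "real \<Rightarrow> real"
  assumes "0 < T" "k \<in> borel_measurable half_line"
  shows "(LINT t|cesaro T. k t) = 1 / T * (LINT t:{0..T}|lborel. k t)"
proof -
  have "(LINT t|cesaro T. k t) = (LINT t:{0..}|lborel. indicator {0..T} t / T * k t)"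
    unfolding cesaro_def by (rule decreasing_density.integral_evaluation[OF decreasing_density_uniform assms(2), OF assms(1)])
  also have "\<dots> = (LINT t:{0..T}|lborel. 1 / T * k t)"
    unfolding set_lebesgue_integral_def by (rule Bochner_Integration.integral_cong) (auto simp: indicator_def)
  finally show ?thesis by simp
qed

section \<open>The limit value\<close>

text \<open>
  Each shifted integral of \<open>k\<close> with respect to \<open>\<theta>\<close> is close to the unshifted one, except for shifts beyond
  \<open>T\<close>, which have little mass under \<open>\<theta>'\<close>. Averaging over the shifts and exchanging the integrals gives an
  average of values that are at least \<open>c\<close>.
\<close>

lemma average_of_shifts:
  fixes k :: "real \<Rightarrow> real"
  assumes \<theta>: "\<theta> \<in> evaluations" and \<theta>': "\<theta>' \<in> evaluations" and k: "k \<in> borel_measurable half_line"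
    and M: "0 < M" "\<And>t. 0 \<le> t \<Longrightarrow> \<bar>k t\<bar> \<le> M"
    and TV: "\<And>r. 0 \<le> r \<Longrightarrow> r \<le> T \<Longrightarrow> TV r \<theta> \<le> \<eta>" and \<eta>: "0 \<le> \<eta>"
    and tail: "measure \<theta>' {T<..} \<le> \<delta>" and T: "0 \<le> T"
    and low: "\<And>t. 0 \<le> t \<Longrightarrow> c \<le> (LINT r|\<theta>'. k (r + t))"
  shows "c \<le> (LINT t|\<theta>. k t) + 4 * M * \<eta> + 2 * M * \<delta>"
proof -
  interpret A: prob_space \<theta> by (rule evaluationsD(1)[OF \<theta>])
  interpret B: prob_space \<theta>' by (rule evaluationsD(1)[OF \<theta>'])
  interpret P: pair_prob_space \<theta>' \<theta> ..
  have [measurable]: "k \<in> borel_measurable half_line" by (rule k)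
  have sets2: "sets (\<theta>' \<Otimes>\<^sub>M \<theta>) = sets (half_line \<Otimes>\<^sub>M half_line)"
    by (rule sets_pair_measure_cong[OF evaluationsD(2)[OF \<theta>'] evaluationsD(2)[OF \<theta>]])
  have "(\<lambda>z. fst z + snd z) \<in> half_line \<Otimes>\<^sub>M half_line \<rightarrow>\<^sub>M half_line"
  proof (rule measurable_restrict_space2)
    have "fst \<in> half_line \<Otimes>\<^sub>M half_line \<rightarrow>\<^sub>M borel" "snd \<in> half_line \<Otimes>\<^sub>M half_line \<rightarrow>\<^sub>M borel"
      by (rule measurable_compose[OF measurable_fst], rule measurable_restrict_space1, simp,
          rule measurable_compose[OF measurable_snd], rule measurable_restrict_space1, simp)
    then show "(\<lambda>z. fst z + snd z) \<in> half_line \<Otimes>\<^sub>M half_line \<rightarrow>\<^sub>M borel" by (rule borel_measurable_add)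
  qed (auto simp: space_pair_measure space_half_line)
  then have "(\<lambda>z. k (fst z + snd z)) \<in> borel_measurable (half_line \<Otimes>\<^sub>M half_line)"
    by (rule measurable_compose[OF _ k])
  then have km: "(\<lambda>(r, t). k (r + t)) \<in> borel_measurable (\<theta>' \<Otimes>\<^sub>M \<theta>)"
    by (simp add: split_def measurable_cong_sets[OF sets2 refl])
  have int: "integrable (\<theta>' \<Otimes>\<^sub>M \<theta>) (\<lambda>(r, t). k (r + t))"
  proof (rule P.integrable_const_bound[where B=M, OF _ km])
    show "AE z in \<theta>' \<Otimes>\<^sub>M \<theta>. norm (case z of (r, t) \<Rightarrow> k (r + t)) \<le> M"
      using M(2) by (auto simp: space_pair_measure evaluationsD(3)[OF \<theta>] evaluationsD(3)[OF \<theta>'])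
  qed
  define h where "h r = (LINT t|\<theta>. k (r + t))" for r
  have ih: "integrable \<theta>' h" unfolding h_def using P.integrable_fst[OF int] .
  have tailset: "{T<..} \<in> sets \<theta>'" using T by (auto simp: evaluationsD(2)[OF \<theta>'] sets_half_line)
  have "c = (LINT t|\<theta>. c)" by (simp add: A.prob_space)
  also have "\<dots> \<le> (LINT t|\<theta>. (LINT r|\<theta>'. k (r + t)))"
  proof (rule integral_mono)
    show "integrable \<theta> (\<lambda>t. LINT r|\<theta>'. k (r + t))" using P.integrable_snd[OF int] .
  qed (use low evaluationsD(3)[OF \<theta>] in auto)
  also have "\<dots> = (LINT r|\<theta>'. h r)" unfolding h_def by (rule P.Fubini_integral[OF int])
  also have "\<dots> \<le> (LINT r|\<theta>'. (LINT t|\<theta>. k t) + 4 * M * \<eta> + 2 * M * indicator {T<..} r)"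
  proof (rule integral_mono[OF ih])
    show "integrable \<theta>' (\<lambda>r. (LINT t|\<theta>. k t) + 4 * M * \<eta> + 2 * M * indicator {T<..} r)"
      using tailset by (auto intro!: Bochner_Integration.integrable_add integrable_mult_right integrable_real_indicator simp: B.emeasure_eq_measure)
    fix r assume "r \<in> space \<theta>'"
    then have r: "0 \<le> r" using evaluationsD(3)[OF \<theta>'] by simp
    have bnd: "\<bar>(LINT t|\<theta>. k (s + t))\<bar> \<le> M" if "0 \<le> s" for s
    proof -
      have "\<bar>(LINT t|\<theta>. k (s + t))\<bar> \<le> (LINT t|\<theta>. \<bar>k (s + t)\<bar>)" by (rule integral_abs_bound)
      also have "\<dots> \<le> (LINT t|\<theta>. M)"
        by (rule integral_mono') (use M that evaluationsD(3)[OF \<theta>] in auto)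
      finally show ?thesis by (simp add: A.prob_space)
    qed
    show "h r \<le> (LINT t|\<theta>. k t) + 4 * M * \<eta> + 2 * M * indicator {T<..} r"
    proof (cases "r \<le> T")
      case True
      have "\<bar>(LINT t|\<theta>. k (t + r)) - (LINT t|\<theta>. k t)\<bar> \<le> 4 * M * TV r \<theta>"
        by (rule integral_shift_TV[OF \<theta> k M r])
      also have "\<dots> \<le> 4 * M * \<eta>" using TV[OF r True] M(1) by simp
      finally show ?thesis using True by (simp add: h_def add.commute)
    next
      case False
      have "0 \<le> 4 * M * \<eta>" using \<eta> M(1) by (intro mult_nonneg_nonneg) auto
      moreover have "h r \<le> M" using bnd[OF r] by (simp add: h_def)
      moreover have "- M \<le> (LINT t|\<theta>. k t)" using bnd[of 0] by simp
      ultimately have "h r \<le> (LINT t|\<theta>. k t) + 4 * M * \<eta> + 2 * M" by linarith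
      then show ?thesis using False by simp
    qed
  qed
  also have "\<dots> = (LINT t|\<theta>. k t) + 4 * M * \<eta> + 2 * M * measure \<theta>' {T<..}"
  proof -
    have "integrable \<theta>' (indicat_real {T<..})"
      using tailset by (intro integrable_real_indicator) (auto simp: B.emeasure_eq_measure)
    then show ?thesis using sets.sets_into_space[OF tailset] by (simp add: B.prob_space Int_absorb2)
  qed
  also have "\<dots> \<le> (LINT t|\<theta>. k t) + 4 * M * \<eta> + 2 * M * \<delta>" using tail M(1) by simp
  finally show ?thesis .
qed

lemma evaluation_tail:
  assumes \<theta>: "\<theta> \<in> evaluations" and e: "0 < e"
  obtains T where "0 < T" "measure \<theta> {T<..} \<le> e"
proof -
  interpret prob_space \<theta> by (rule evaluationsD(1)[OF \<theta>])
  have s: "{0..real n} \<in> sets \<theta>" "{real n<..} \<in> sets \<theta>" for n by (auto simp: evaluationsD(2)[OF \<theta>] sets_half_line)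
  have "(\<lambda>n. prob {0..real n}) \<longlonglongrightarrow> prob (\<Union>n. {0..real n})"
    by (rule finite_Lim_measure_incseq) (use s in \<open>auto simp: incseq_def\<close>)
  moreover have "(\<Union>n. {0..real n}) = space \<theta>"
    using real_arch_simple by (auto simp: evaluationsD(3)[OF \<theta>])
  ultimately have "(\<lambda>n. prob {0..real n}) \<longlonglongrightarrow> 1" by (simp add: prob_space)
  then have "\<forall>\<^sub>F n in sequentially. 1 - e < prob {0..real n}" by (rule order_tendstoD) (use e in simp)
  then obtain N where N: "\<And>n. n \<ge> N \<Longrightarrow> 1 - e < prob {0..real n}" by (auto simp: eventually_sequentially)
  define n where "n = Suc N"
  have "{real n<..} = space \<theta> - {0..real n}" by (auto simp: evaluationsD(3)[OF \<theta>])
  then have "prob {real n<..} = 1 - prob {0..real n}" using prob_compl[OF s(1)] by simp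
  then show ?thesis using N[of n] that[of "real n"] by (simp add: n_def)
qed

lemma integral_evaluation_mono:
  fixes k k' :: "real \<Rightarrow> real"
  assumes \<theta>: "\<theta> \<in> evaluations" and k: "k \<in> borel_measurable half_line" "k' \<in> borel_measurable half_line"
    and M: "\<And>t. 0 \<le> t \<Longrightarrow> \<bar>k t\<bar> \<le> M" "\<And>t. 0 \<le> t \<Longrightarrow> \<bar>k' t\<bar> \<le> M"
    and le: "\<And>t. 0 \<le> t \<Longrightarrow> k t \<le> k' t + e"
  shows "(LINT t|\<theta>. k t) \<le> (LINT t|\<theta>. k' t) + e"
proof -
  interpret prob_space \<theta> by (rule evaluationsD(1)[OF \<theta>])
  have i: "integrable \<theta> k" "integrable \<theta> k'"
    by (rule integrable_const_bound[where B=M], use M evaluationsD(3)[OF \<theta>] borel_measurable_evaluation[OF \<theta>] k in auto)+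
  have "(LINT t|\<theta>. k t) \<le> (LINT t|\<theta>. k' t + e)"
    by (rule integral_mono) (use i le evaluationsD(3)[OF \<theta>] in auto)
  then show ?thesis using i by (simp add: prob_space)
qed

context compact_nonexpansive_problem
begin

text \<open>
  In a compact nonexpansive problem the running cost is a function of the state alone.
\<close>

definition G where "G y = g y (SOME a. a \<in> U)"

lemma SOME_in_U: "(SOME a. a \<in> U) \<in> U"
  using U_nonempty by (simp add: some_in_eq)

lemma running_cost_eq:
  assumes "u \<in> controls U" "0 \<le> t"
  shows "running_cost f g u y t = G (trajectory f u y t)"
  using compact_nonexpansive controls_in[OF assms] SOME_in_U
  unfolding running_cost_def G_def compact_nonexpansive_def by blast

lemma G_continuous: "continuous_on Y G"
  using compact_nonexpansive SOME_in_U unfolding G_def compact_nonexpansive_def by blast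

definition M where "M = (SOME M. 0 < M \<and> (\<forall>y. \<bar>G y\<bar> \<le> M))"

lemma M_pos: "0 < M" and G_bound: "\<bar>G y\<bar> \<le> M"
proof -
  obtain m where m: "\<And>y. \<bar>G y\<bar> \<le> m"
    using problem SOME_in_U unfolding control_problem_def G_def by blast
  have "0 < \<bar>m\<bar> + 1 \<and> (\<forall>y. \<bar>G y\<bar> \<le> \<bar>m\<bar> + 1)" using m by (auto intro: order_trans[OF m])
  from someI[of "\<lambda>M. 0 < M \<and> (\<forall>y. \<bar>G y\<bar> \<le> M)", OF this]
  show "0 < M" "\<bar>G y\<bar> \<le> M" unfolding M_def by blast+
qed

abbreviation cost where "cost u y t \<equiv> G (trajectory f u y t)"

lemma cost_continuous:
  assumes "y \<in> Y" "u \<in> controls U"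
  shows "continuous_on {0..} (cost u y)"
  by (rule continuous_on_compose2[OF G_continuous trajectory_continuous[OF assms(2)]])
    (use trajectory_in_Y[OF assms] in auto)

lemma cost_measurable: "y \<in> Y \<Longrightarrow> u \<in> controls U \<Longrightarrow> cost u y \<in> borel_measurable half_line"
  by (rule continuous_on_halfline_measurable[OF cost_continuous])

lemma cost_shift_measurable:
  assumes "y \<in> Y" "u \<in> controls U" "0 \<le> s"
  shows "(\<lambda>t. cost u y (t + s)) \<in> borel_measurable half_line"
proof -
  have "(\<lambda>t. t + s) \<in> half_line \<rightarrow>\<^sub>M half_line" by (rule measurable_restrict_space3) (use assms in auto)
  then show ?thesis by (rule measurable_compose[OF _ cost_measurable[OF assms(1,2)]])
qed

lemma payoff_eq:
  assumes "\<theta> \<in> evaluations" "u \<in> controls U"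
  shows "payoff f g \<theta> y u = (LINT t|\<theta>. cost u y t)"
  unfolding payoff_def
  by (rule Bochner_Integration.integral_cong) (use evaluationsD(3)[OF assms(1)] running_cost_eq[OF assms(2)] in auto)

lemma integral_cost_bound:
  assumes \<theta>: "\<theta> \<in> evaluations"
  shows "\<bar>(LINT t|\<theta>. G (w t))\<bar> \<le> M"
proof -
  interpret prob_space \<theta> by (rule evaluationsD(1)[OF \<theta>])
  have "\<bar>(LINT t|\<theta>. G (w t))\<bar> \<le> (LINT t|\<theta>. \<bar>G (w t)\<bar>)" by (rule integral_abs_bound)
  also have "\<dots> \<le> (LINT t|\<theta>. M)" by (rule integral_mono') (use M_pos G_bound in auto)
  finally show ?thesis by (simp add: prob_space)
qed

lemma integral_cost_bounds:
  assumes "\<theta> \<in> evaluations"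
  shows "- M \<le> (LINT t|\<theta>. G (w t))" "(LINT t|\<theta>. G (w t)) \<le> M"
  using integral_cost_bound[OF assms, of w] by linarith+

lemma controls_nonempty: "controls U \<noteq> {}"
  using const_in_controls SOME_in_U by blast

abbreviation V where "V \<theta> y \<equiv> eval_value U f g \<theta> y"

lemma V_le:
  assumes "\<theta> \<in> evaluations" "u \<in> controls U"
  shows "V \<theta> y \<le> (LINT t|\<theta>. cost u y t)"
proof -
  have "- M \<le> payoff f g \<theta> y u" if "u \<in> controls U" for u
    unfolding payoff_eq[OF assms(1) that] by (rule integral_cost_bounds(1)[OF assms(1)])
  then have "bdd_below (payoff f g \<theta> y ` controls U)" by (intro bdd_belowI2)
  then show ?thesis
    unfolding eval_value_def payoff_eq[OF assms, symmetric] by (rule cINF_lower[OF _ assms(2)])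
qed

lemma V_greatest:
  assumes "\<theta> \<in> evaluations" "\<And>u. u \<in> controls U \<Longrightarrow> c \<le> (LINT t|\<theta>. cost u y t)"
  shows "c \<le> V \<theta> y"
  unfolding eval_value_def by (rule cINF_greatest[OF controls_nonempty]) (use assms payoff_eq in auto)

lemma V_approx:
  assumes "\<theta> \<in> evaluations" "0 < e"
  obtains u where "u \<in> controls U" "(LINT t|\<theta>. cost u y t) \<le> V \<theta> y + e"
proof (rule ccontr)
  assume "\<not> thesis"
  then have "V \<theta> y + e \<le> (LINT t|\<theta>. cost u y t)" if "u \<in> controls U" for u
    using that \<open>\<And>u. u \<in> controls U \<Longrightarrow> (LINT t|\<theta>. cost u y t) \<le> V \<theta> y + e \<Longrightarrow> thesis\<close> by (meson linear)
  then have "V \<theta> y + e \<le> V \<theta> y" by (intro V_greatest[OF assms(1)])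
  then show False using assms(2) by simp
qed

text \<open>
  The value of the player who chooses the initial delay and the control against \<open>\<theta>\<close>; \<open>V_star\<close> is its
  supremum over all evaluations.
\<close>

definition W where "W \<theta> y = (INF s\<in>{0..}. INF u\<in>controls U. LINT t|\<theta>. running_cost f g u y (t + s))"

lemma W_eq:
  assumes "\<theta> \<in> evaluations" "u \<in> controls U" "0 \<le> s"
  shows "(LINT t|\<theta>. running_cost f g u y (t + s)) = (LINT t|\<theta>. cost u y (t + s))"
  by (rule Bochner_Integration.integral_cong) (use assms evaluationsD(3)[OF assms(1)] running_cost_eq[OF assms(2)] in auto)

lemma W_le:
  assumes \<theta>: "\<theta> \<in> evaluations" and u: "u \<in> controls U" and s: "0 \<le> s"
  shows "W \<theta> y \<le> (LINT t|\<theta>. cost u y (t + s))"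
proof -
  have b: "- M \<le> (LINT t|\<theta>. running_cost f g u y (t + s))" if "u \<in> controls U" "0 \<le> s" for u s
    unfolding W_eq[OF \<theta> that] by (rule integral_cost_bounds(1)[OF \<theta>])
  have "W \<theta> y \<le> (INF u\<in>controls U. LINT t|\<theta>. running_cost f g u y (t + s))"
    unfolding W_def
    by (rule cINF_lower, rule bdd_belowI2[where m="- M"]) (use s b in \<open>auto intro!: cINF_greatest[OF controls_nonempty]\<close>)
  also have "\<dots> \<le> (LINT t|\<theta>. running_cost f g u y (t + s))"
    by (rule cINF_lower[OF _ u], rule bdd_belowI2[where m="- M"]) (use s b in auto)
  finally show ?thesis unfolding W_eq[OF \<theta> u s] .
qed

lemma W_greatest:
  assumes \<theta>: "\<theta> \<in> evaluations" and c: "\<And>u s. u \<in> controls U \<Longrightarrow> 0 \<le> s \<Longrightarrow> c \<le> (LINT t|\<theta>. cost u y (t + s))"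
  shows "c \<le> W \<theta> y"
  unfolding W_def by (intro cINF_greatest controls_nonempty) (use W_eq[OF \<theta>] c in auto)

abbreviation Vs where "Vs y \<equiv> V_star U f g y"

lemma cesaro1: "cesaro 1 \<in> evaluations"
  by (rule cesaro_evaluation) simp

lemma W_le_M: "\<theta> \<in> evaluations \<Longrightarrow> W \<theta> y \<le> M"
  by (rule order_trans[OF W_le[OF _ const_in_controls[OF SOME_in_U] order_refl] integral_cost_bounds(2)])

lemma W_le_Vs: "\<theta> \<in> evaluations \<Longrightarrow> W \<theta> y \<le> Vs y"
  unfolding V_star_def W_def[symmetric]
  by (rule cSUP_upper) (auto intro!: bdd_aboveI2[where M=M] W_le_M)

lemma Vs_le: "(\<And>\<theta>. \<theta> \<in> evaluations \<Longrightarrow> W \<theta> y \<le> c) \<Longrightarrow> Vs y \<le> c"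
  unfolding V_star_def W_def[symmetric] by (rule cSUP_least) (use cesaro1 in auto)

lemma Vs_approx:
  assumes "0 < e"
  obtains \<theta> where "\<theta> \<in> evaluations" "Vs y - e \<le> W \<theta> y"
proof (rule ccontr)
  assume "\<not> thesis"
  then have "W \<theta> y \<le> Vs y - e" if "\<theta> \<in> evaluations" for \<theta>
    using that \<open>\<And>\<theta>. \<theta> \<in> evaluations \<Longrightarrow> Vs y - e \<le> W \<theta> y \<Longrightarrow> thesis\<close> by (meson linear)
  then have "Vs y \<le> Vs y - e" by (rule Vs_le)
  then show False using assms by simp
qed

text \<open>
  After any delay, a nearly optimal evaluation \<open>\<theta>'\<close> guarantees \<open>V\<^sup>* - \<epsilon> / 3\<close>; hence so does the average
  over shifts distributed according to \<open>\<theta>'\<close>.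
\<close>

lemma limit_value_lower:
  assumes y: "y \<in> Y" and e: "0 < e"
  obtains \<eta> S where "0 < \<eta>" "0 < S"
    "\<And>\<theta>. \<theta> \<in> evaluations \<Longrightarrow> (\<And>s. 0 \<le> s \<Longrightarrow> s \<le> S \<Longrightarrow> TV s \<theta> \<le> \<eta>) \<Longrightarrow> Vs y - e \<le> V \<theta> y"
proof -
  obtain \<theta>' where \<theta>': "\<theta>' \<in> evaluations" "Vs y - e / 3 \<le> W \<theta>' y" using Vs_approx[of "e / 3"] e by auto
  have "0 < e / (6 * M)" using e M_pos by simp
  then obtain T where T: "0 < T" "measure \<theta>' {T<..} \<le> e / (6 * M)" using evaluation_tail[OF \<theta>'(1)] by blast
  show ?thesis
  proof (rule that)
    show "0 < e / (12 * M)" "0 < T" using e M_pos T by auto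
    fix \<theta> assume \<theta>: "\<theta> \<in> evaluations" and TV: "\<And>s. 0 \<le> s \<Longrightarrow> s \<le> T \<Longrightarrow> TV s \<theta> \<le> e / (12 * M)"
    show "Vs y - e \<le> V \<theta> y"
    proof (rule V_greatest[OF \<theta>])
      fix u assume u: "u \<in> controls U"
      have "W \<theta>' y \<le> (LINT t|\<theta>. cost u y t) + 4 * M * (e / (12 * M)) + 2 * M * (e / (6 * M))"
        by (rule average_of_shifts[OF \<theta> \<theta>'(1) cost_measurable[OF y u] M_pos G_bound TV _ T(2)])
          (use e M_pos T W_le[OF \<theta>'(1) u] in auto)
      moreover have "4 * M * (e / (12 * M)) = e / 3" "2 * M * (e / (6 * M)) = e / 3" using M_pos by simp_all
      ultimately show "Vs y - e \<le> (LINT t|\<theta>. cost u y t)" using \<theta>'(2) by linarith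
    qed
  qed
qed

lemma G_uniformly_continuous:
  assumes "0 < e"
  obtains d where "0 < d" "\<And>y y'. y \<in> Y \<Longrightarrow> y' \<in> Y \<Longrightarrow> norm (y - y') \<le> d \<Longrightarrow> \<bar>G y - G y'\<bar> \<le> e"
proof -
  have "uniformly_continuous_on Y G" using compact_uniformly_continuous[OF G_continuous compact_Y] .
  then obtain d where d: "0 < d" "\<And>y y'. y \<in> Y \<Longrightarrow> y' \<in> Y \<Longrightarrow> dist y' y < d \<Longrightarrow> dist (G y') (G y) < e"
    unfolding uniformly_continuous_on_def using assms by meson
  show ?thesis
  proof (rule that[of "d / 2"])
    show "0 < d / 2" using d by simp
    fix y y' assume "y \<in> Y" "y' \<in> Y" "norm (y - y') \<le> d / 2"
    then show "\<bar>G y - G y'\<bar> \<le> e" using d(1) d(2)[of y' y] by (simp add: dist_norm dist_real_def)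
  qed
qed

end

text \<open>
  A grid that is so fine that all errors of shadowing change the running cost by at most \<open>\<epsilon>\<close>.
\<close>

locale fine_grid = shadow_grid U f g Y h
  for U :: "'u::{metric_space, second_countable_topology} set"
    and f :: "'a::euclidean_space \<Rightarrow> 'u \<Rightarrow> 'a" and g Y h +
  fixes \<epsilon> :: real
  assumes eps_pos: "0 < \<epsilon>"
    and fine: "\<And>y y'. \<lbrakk>y \<in> Y; y' \<in> Y; norm (y - y') \<le> (2 * sqrt (2 * C) + A + 2) * h\<rbrakk> \<Longrightarrow> \<bar>G y - G y'\<bar> \<le> \<epsilon>"
begin

lemma fine_bounds: "h + err \<le> (2 * sqrt (2 * C) + A + 2) * h" "2 * err + (A + 1) * h \<le> (2 * sqrt (2 * C) + A + 2) * h"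
  using h_pos A_pos C_pos err_pos unfolding err_def by (simp_all add: algebra_simps)

lemma cost_shadow:
  assumes Y: "y1 \<in> Y" "y2 \<in> Y" and near: "norm (y1 - y2) \<le> h" and u: "u \<in> controls U"
  obtains \<sigma> where "admissible \<sigma>" "\<And>t. 0 \<le> t \<Longrightarrow> \<bar>cost u y1 t - G (path \<sigma> y2 t)\<bar> \<le> \<epsilon>"
proof -
  obtain \<sigma> where \<sigma>: "admissible \<sigma>" "\<And>t. 0 \<le> t \<Longrightarrow> norm (trajectory f u y1 t - path \<sigma> y2 t) \<le> norm (y1 - y2) + err"
    using shadow_exists[OF Y u] by blast
  show ?thesis
  proof (rule that[OF \<sigma>(1)])
    fix t :: real assume t: "0 \<le> t"
    show "\<bar>cost u y1 t - G (path \<sigma> y2 t)\<bar> \<le> \<epsilon>"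
      by (rule fine[OF trajectory_in_Y[OF Y(1) u t] trajectory_in_Y[OF Y(2) ctrl_in_controls t]])
        (use \<sigma>(2)[OF t] near fine_bounds(1) in linarith)
  qed
qed

lemma cost_finitely_many_shifts:
  assumes y: "y \<in> Y"
  obtains F where "finite F" "\<And>s u. 0 \<le> s \<Longrightarrow> u \<in> controls U \<Longrightarrow>
    \<exists>k\<in>F. \<exists>\<sigma>. admissible \<sigma> \<and> (\<forall>t\<ge>0. \<bar>cost u y (t + s) - G (path \<sigma> y (t + \<tau> k))\<bar> \<le> \<epsilon>)"
proof -
  obtain F where F: "finite F" "\<And>s u. 0 \<le> s \<Longrightarrow> u \<in> controls U \<Longrightarrow>
    \<exists>k\<in>F. \<exists>\<sigma>. admissible \<sigma> \<and> (\<forall>t\<ge>0. norm (trajectory f u y (t + s) - path \<sigma> y (\<tau> k + t)) \<le> 2 * err + (A + 1) * h)"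
    using finitely_many_shifts[OF y] by blast
  have "\<exists>k\<in>F. \<exists>\<sigma>. admissible \<sigma> \<and> (\<forall>t\<ge>0. \<bar>cost u y (t + s) - G (path \<sigma> y (t + \<tau> k))\<bar> \<le> \<epsilon>)"
    if s: "0 \<le> s" and u: "u \<in> controls U" for s u
  proof -
    obtain k \<sigma> where k: "k \<in> F" "admissible \<sigma>"
      "\<And>t. t \<ge> 0 \<Longrightarrow> norm (trajectory f u y (t + s) - path \<sigma> y (\<tau> k + t)) \<le> 2 * err + (A + 1) * h"
      using F(2)[OF s u] by blast
    have "\<bar>cost u y (t + s) - G (path \<sigma> y (t + \<tau> k))\<bar> \<le> \<epsilon>" if t: "0 \<le> t" for t
    proof (rule fine)
      show "trajectory f u y (t + s) \<in> Y" using trajectory_in_Y[OF y u] s t by simp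
      show "path \<sigma> y (t + \<tau> k) \<in> Y" using trajectory_in_Y[OF y ctrl_in_controls] \<tau>_nonneg[of k] t by simp
      show "norm (trajectory f u y (t + s) - path \<sigma> y (t + \<tau> k)) \<le> (2 * sqrt (2 * C) + A + 2) * h"
        using k(3)[OF t] fine_bounds(2) by (simp add: add.commute)
    qed
    then show ?thesis using k by blast
  qed
  then show ?thesis using F(1) that by blast
qed

lemma V_near:
  assumes Y: "y1 \<in> Y" "y2 \<in> Y" and near: "norm (y1 - y2) \<le> h" and \<theta>: "\<theta> \<in> evaluations"
  shows "V \<theta> y2 \<le> V \<theta> y1 + \<epsilon>"
proof -
  have "V \<theta> y2 - \<epsilon> \<le> V \<theta> y1"
  proof (rule V_greatest[OF \<theta>])
    fix u assume u: "u \<in> controls U"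
    obtain \<sigma> where \<sigma>: "\<And>t. 0 \<le> t \<Longrightarrow> \<bar>cost u y1 t - G (path \<sigma> y2 t)\<bar> \<le> \<epsilon>" using cost_shadow[OF Y near u] by blast
    have "(LINT t|\<theta>. G (path \<sigma> y2 t)) \<le> (LINT t|\<theta>. cost u y1 t) + \<epsilon>"
    proof (rule integral_evaluation_mono[OF \<theta> cost_measurable[OF Y(2) ctrl_in_controls] cost_measurable[OF Y(1) u] G_bound G_bound])
      fix t :: real assume "0 \<le> t"
      then show "G (path \<sigma> y2 t) \<le> cost u y1 t + \<epsilon>" using \<sigma>[of t] by (simp add: abs_le_iff)
    qed
    then show "V \<theta> y2 - \<epsilon> \<le> (LINT t|\<theta>. cost u y1 t)" using V_le[OF \<theta> ctrl_in_controls, of y2 \<sigma>] by simp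
  qed
  then show ?thesis by simp
qed

lemma Vs_near:
  assumes Y: "y1 \<in> Y" "y2 \<in> Y" and near: "norm (y1 - y2) \<le> h"
  shows "Vs y2 \<le> Vs y1 + \<epsilon>"
proof (rule Vs_le)
  fix \<theta> assume \<theta>: "\<theta> \<in> evaluations"
  have "W \<theta> y2 - \<epsilon> \<le> W \<theta> y1"
  proof (rule W_greatest[OF \<theta>])
    fix u s assume u: "u \<in> controls U" and s: "(0::real) \<le> s"
    obtain \<sigma> where \<sigma>: "\<And>t. 0 \<le> t \<Longrightarrow> \<bar>cost u y1 t - G (path \<sigma> y2 t)\<bar> \<le> \<epsilon>" using cost_shadow[OF Y near u] by blast
    have "(LINT t|\<theta>. G (path \<sigma> y2 (t + s))) \<le> (LINT t|\<theta>. cost u y1 (t + s)) + \<epsilon>"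
    proof (rule integral_evaluation_mono[OF \<theta> cost_shift_measurable[OF Y(2) ctrl_in_controls s] cost_shift_measurable[OF Y(1) u s] G_bound G_bound])
      fix t :: real assume "0 \<le> t"
      then show "G (path \<sigma> y2 (t + s)) \<le> cost u y1 (t + s) + \<epsilon>" using \<sigma>[of "t + s"] s by (simp add: abs_le_iff)
    qed
    then show "W \<theta> y2 - \<epsilon> \<le> (LINT t|\<theta>. cost u y1 (t + s))" using W_le[OF \<theta> ctrl_in_controls s, of y2 \<sigma>] by simp
  qed
  then show "W \<theta> y2 \<le> Vs y1 + \<epsilon>" using W_le_Vs[OF \<theta>, of y1] by simp
qed

text \<open>
  A delay in the definition of \<open>W\<close> can be replaced by one of finitely many delays, all of them at most
  \<open>S\<close>, and these do not change the payoff of a regular evaluation much. So \<open>V\<close> is not much larger than \<open>W\<close>.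
\<close>

lemma V_le_Vs:
  assumes y: "y \<in> Y"
  obtains S where "0 < S"
    "\<And>\<theta> \<eta>. \<theta> \<in> evaluations \<Longrightarrow> (\<And>s. 0 \<le> s \<Longrightarrow> s \<le> S \<Longrightarrow> TV s \<theta> \<le> \<eta>) \<Longrightarrow> V \<theta> y \<le> Vs y + \<epsilon> + 4 * M * \<eta>"
proof -
  obtain F where F: "finite F" "\<And>s u. 0 \<le> s \<Longrightarrow> u \<in> controls U \<Longrightarrow>
    \<exists>k\<in>F. \<exists>\<sigma>. admissible \<sigma> \<and> (\<forall>t\<ge>0. \<bar>cost u y (t + s) - G (path \<sigma> y (t + \<tau> k))\<bar> \<le> \<epsilon>)"
    using cost_finitely_many_shifts[OF y] by blast
  define S where "S = Max (insert 1 (\<tau> ` F))"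
  have S: "0 < S" "k \<in> F \<Longrightarrow> \<tau> k \<le> S" for k
    unfolding S_def using F(1) by (auto intro: less_le_trans[OF zero_less_one] Max_ge)
  show ?thesis
  proof (rule that[OF S(1)])
    fix \<theta> \<eta> assume \<theta>: "\<theta> \<in> evaluations" and TV: "\<And>s. 0 \<le> s \<Longrightarrow> s \<le> S \<Longrightarrow> TV s \<theta> \<le> \<eta>"
    have "V \<theta> y - 4 * M * \<eta> - \<epsilon> \<le> W \<theta> y"
    proof (rule W_greatest[OF \<theta>])
      fix u s assume u: "u \<in> controls U" and s: "(0::real) \<le> s"
      obtain k \<sigma> where k: "k \<in> F" and \<sigma>: "\<And>t. 0 \<le> t \<Longrightarrow> \<bar>cost u y (t + s) - G (path \<sigma> y (t + \<tau> k))\<bar> \<le> \<epsilon>"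
        using F(2)[OF s u] by blast
      have "(LINT t|\<theta>. G (path \<sigma> y (t + \<tau> k))) \<le> (LINT t|\<theta>. cost u y (t + s)) + \<epsilon>"
      proof (rule integral_evaluation_mono[OF \<theta> cost_shift_measurable[OF y ctrl_in_controls \<tau>_nonneg] cost_shift_measurable[OF y u s] G_bound G_bound])
        fix t :: real assume "0 \<le> t"
        then show "G (path \<sigma> y (t + \<tau> k)) \<le> cost u y (t + s) + \<epsilon>" using \<sigma>[of t] by (simp add: abs_le_iff)
      qed
      moreover have "\<bar>(LINT t|\<theta>. G (path \<sigma> y (t + \<tau> k))) - (LINT t|\<theta>. G (path \<sigma> y t))\<bar> \<le> 4 * M * TV (\<tau> k) \<theta>"
        by (rule integral_shift_TV[OF \<theta> cost_measurable[OF y ctrl_in_controls] M_pos G_bound \<tau>_nonneg])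
      moreover have "4 * M * TV (\<tau> k) \<theta> \<le> 4 * M * \<eta>" using TV[OF \<tau>_nonneg S(2)[OF k]] M_pos by simp
      moreover have "V \<theta> y \<le> (LINT t|\<theta>. G (path \<sigma> y t))" by (rule V_le[OF \<theta> ctrl_in_controls])
      ultimately show "V \<theta> y - 4 * M * \<eta> - \<epsilon> \<le> (LINT t|\<theta>. cost u y (t + s))" by linarith
    qed
    then show "V \<theta> y \<le> Vs y + \<epsilon> + 4 * M * \<eta>" using W_le_Vs[OF \<theta>, of y] by simp
  qed
qed

end

context compact_nonexpansive_problem
begin

lemma fine_grid_exists:
  assumes e: "0 < e"
  obtains h where "fine_grid U f g Y h e"
proof -
  obtain d where d: "0 < d" "\<And>y y'. y \<in> Y \<Longrightarrow> y' \<in> Y \<Longrightarrow> norm (y - y') \<le> d \<Longrightarrow> \<bar>G y - G y'\<bar> \<le> e"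
    using G_uniformly_continuous[OF e] by blast
  define c where "c = 2 * sqrt (2 * C) + A + 2"
  have c: "0 < c" unfolding c_def using C_pos A_pos by (simp add: add_pos_pos)
  have "fine_grid U f g Y (d / c) e"
  proof unfold_locales
    show "0 < d / c" "0 < e" using c d e by auto
    fix y y' assume "y \<in> Y" "y' \<in> Y" "norm (y - y') \<le> (2 * sqrt (2 * C) + A + 2) * (d / c)"
    then show "\<bar>G y - G y'\<bar> \<le> e" using d(2) c unfolding c_def[symmetric] by simp
  qed
  then show ?thesis by (rule that)
qed

lemma limit_value_pointwise:
  assumes y: "y \<in> Y" and e: "0 < e"
  obtains \<eta> S where "0 < \<eta>" "0 < S"
    "\<And>\<theta>. \<theta> \<in> evaluations \<Longrightarrow> (\<And>s. 0 \<le> s \<Longrightarrow> s \<le> S \<Longrightarrow> TV s \<theta> \<le> \<eta>) \<Longrightarrow> \<bar>V \<theta> y - Vs y\<bar> \<le> e"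
proof -
  obtain h where "fine_grid U f g Y h (e / 2)" using fine_grid_exists[of "e / 2"] e by auto
  then interpret fine_grid U f g Y h "e / 2" .
  obtain S1 where S1: "0 < S1"
    "\<And>\<theta> \<eta>. \<theta> \<in> evaluations \<Longrightarrow> (\<And>s. 0 \<le> s \<Longrightarrow> s \<le> S1 \<Longrightarrow> TV s \<theta> \<le> \<eta>) \<Longrightarrow> V \<theta> y \<le> Vs y + e / 2 + 4 * M * \<eta>"
    using V_le_Vs[OF y] by blast
  obtain \<eta>2 S2 where S2: "0 < \<eta>2" "0 < S2"
    "\<And>\<theta>. \<theta> \<in> evaluations \<Longrightarrow> (\<And>s. 0 \<le> s \<Longrightarrow> s \<le> S2 \<Longrightarrow> TV s \<theta> \<le> \<eta>2) \<Longrightarrow> Vs y - e \<le> V \<theta> y"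
    using limit_value_lower[OF y e] by blast
  define \<eta> where "\<eta> = min \<eta>2 (e / (8 * M))"
  show ?thesis
  proof (rule that[of \<eta> "max S1 S2"])
    show "0 < \<eta>" "0 < max S1 S2" using S1 S2 e M_pos by (auto simp: \<eta>_def)
    fix \<theta> assume \<theta>: "\<theta> \<in> evaluations" and TV: "\<And>s. 0 \<le> s \<Longrightarrow> s \<le> max S1 S2 \<Longrightarrow> TV s \<theta> \<le> \<eta>"
    have "V \<theta> y \<le> Vs y + e / 2 + 4 * M * (e / (8 * M))"
      by (rule S1(2)[OF \<theta>]) (use TV in \<open>force simp: \<eta>_def\<close>)
    moreover have "4 * M * (e / (8 * M)) = e / 2" using M_pos by simp
    moreover have "Vs y - e \<le> V \<theta> y" by (rule S2(3)[OF \<theta>]) (use TV in \<open>force simp: \<eta>_def\<close>)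
    ultimately show "\<bar>V \<theta> y - Vs y\<bar> \<le> e" by (simp add: abs_le_iff)
  qed
qed

text \<open>
  The pointwise estimates hold with common constants on a finite net of \<open>Y\<close>, and equicontinuity extends
  them to all of \<open>Y\<close>.
\<close>

theorem limit_value_uniform:
  assumes e: "0 < e"
  obtains \<eta> S where "0 < \<eta>" "0 < S"
    "\<And>\<theta> y. \<theta> \<in> evaluations \<Longrightarrow> (\<And>s. 0 \<le> s \<Longrightarrow> s \<le> S \<Longrightarrow> TV s \<theta> \<le> \<eta>) \<Longrightarrow> y \<in> Y \<Longrightarrow> \<bar>V \<theta> y - Vs y\<bar> \<le> e"
proof -
  obtain h where "fine_grid U f g Y h (e / 3)" using fine_grid_exists[of "e / 3"] e by auto
  then interpret fine_grid U f g Y h "e / 3" .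
  obtain K where K: "finite K" "K \<subseteq> Y" "Y \<subseteq> (\<Union>x\<in>K. ball x h)"
    using seq_compact_imp_totally_bounded[of Y] compact_Y h_pos compact_imp_seq_compact by metis
  have "\<forall>x\<in>K. \<exists>z. 0 < fst z \<and> 0 < snd z \<and>
    (\<forall>\<theta>\<in>evaluations. (\<forall>s. 0 \<le> s \<longrightarrow> s \<le> snd z \<longrightarrow> TV s \<theta> \<le> fst z) \<longrightarrow> \<bar>V \<theta> x - Vs x\<bar> \<le> e / 3)"
  proof
    fix x assume "x \<in> K"
    then have xY: "x \<in> Y" using K(2) by blast
    have e3: "0 < e / 3" using e by simp
    obtain \<eta> S where "0 < \<eta>" "0 < S"
      "\<And>\<theta>. \<theta> \<in> evaluations \<Longrightarrow> (\<And>s. 0 \<le> s \<Longrightarrow> s \<le> S \<Longrightarrow> TV s \<theta> \<le> \<eta>) \<Longrightarrow> \<bar>V \<theta> x - Vs x\<bar> \<le> e / 3"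
      using limit_value_pointwise[OF xY e3] by blast
    then show "\<exists>z. 0 < fst z \<and> 0 < snd z \<and>
      (\<forall>\<theta>\<in>evaluations. (\<forall>s. 0 \<le> s \<longrightarrow> s \<le> snd z \<longrightarrow> TV s \<theta> \<le> fst z) \<longrightarrow> \<bar>V \<theta> x - Vs x\<bar> \<le> e / 3)"
      by (intro exI[of _ "(\<eta>, S)"]) auto
  qed
  from bchoice[OF this] obtain z where z: "\<forall>x\<in>K. 0 < fst (z x) \<and> 0 < snd (z x) \<and>
    (\<forall>\<theta>\<in>evaluations. (\<forall>s. 0 \<le> s \<longrightarrow> s \<le> snd (z x) \<longrightarrow> TV s \<theta> \<le> fst (z x)) \<longrightarrow> \<bar>V \<theta> x - Vs x\<bar> \<le> e / 3)" ..
  define \<eta> where "\<eta> = Min (insert 1 ((\<lambda>x. fst (z x)) ` K))"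
  define S where "S = Max (insert 1 ((\<lambda>x. snd (z x)) ` K))"
  show ?thesis
  proof (rule that)
    show "0 < \<eta>" unfolding \<eta>_def using K(1) z by simp
    show "0 < S" unfolding S_def using K(1) by (intro less_le_trans[OF zero_less_one] Max_ge) auto
    fix \<theta> y assume \<theta>: "\<theta> \<in> evaluations" and TV: "\<And>s. 0 \<le> s \<Longrightarrow> s \<le> S \<Longrightarrow> TV s \<theta> \<le> \<eta>" and y: "y \<in> Y"
    obtain x where x: "x \<in> K" "dist x y < h" using K(3) y by auto
    have xY: "x \<in> Y" using x K by blast
    have n: "norm (x - y) \<le> h" "norm (y - x) \<le> h" using x(2) by (simp_all add: dist_norm norm_minus_commute)
    have "\<eta> \<le> fst (z x)" unfolding \<eta>_def using K(1) x(1) by (intro Min_le) auto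
    moreover have "snd (z x) \<le> S" unfolding S_def using K(1) x(1) by (intro Max_ge) auto
    ultimately have "TV s \<theta> \<le> fst (z x)" if "0 \<le> s" "s \<le> snd (z x)" for s using TV[of s] that by simp
    then have "\<bar>V \<theta> x - Vs x\<bar> \<le> e / 3" using z x(1) \<theta> by blast
    then show "\<bar>V \<theta> y - Vs y\<bar> \<le> e"
      using V_near[OF xY y n(1) \<theta>] V_near[OF y xY n(2) \<theta>] Vs_near[OF xY y n(1)] Vs_near[OF y xY n(2)]
      by linarith
  qed
qed

end

section \<open>Limits of laws on finitely branching digit sequences\<close>

text \<open>
  Ternary expansions with digits 0 and 2 are read off by continuous functions: \<open>ramp\<close> is 0 on the left
  third of the unit interval and 1 on the right third. Continuity allows weak limits of measures to be
  tested on finitely many bits.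
\<close>

definition ramp :: "real \<Rightarrow> real" where "ramp x = max 0 (min 1 (3 * x - 1))"

primrec residual :: "nat \<Rightarrow> real \<Rightarrow> real" where
  "residual 0 x = x"
| "residual (Suc k) x = 3 * residual k x - 2 * ramp (residual k x)"

definition bit_value :: "nat \<Rightarrow> real \<Rightarrow> real" where "bit_value k x = ramp (residual k x)"

definition ternary :: "(nat \<Rightarrow> bool) \<Rightarrow> real" where
  "ternary \<beta> = (\<Sum>k. 2 * of_bool (\<beta> k) / 3 ^ Suc k)"

lemma continuous_bit_value: "isCont (bit_value k) x"
proof -
  have c: "isCont ramp x" for x unfolding ramp_def by (intro continuous_intros)
  have "isCont (residual k) x" for k x
  proof (induction k)
    case (Suc k)
    then have "isCont (\<lambda>x. ramp (residual k x)) x" by (rule isCont_o2[OF _ c])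
    then show ?case using Suc by (auto intro!: continuous_intros)
  qed (simp add: id_def[symmetric])
  then show ?thesis unfolding bit_value_def by (rule isCont_o2[OF _ c])
qed

lemma bit_value_range: "0 \<le> bit_value k x" "bit_value k x \<le> 1"
  by (auto simp: bit_value_def ramp_def)

lemma ternary_summable: "summable (\<lambda>k. 2 * of_bool (\<beta> k) / 3 ^ Suc k :: real)"
  and ternary_bounds: "0 \<le> ternary \<beta>" "ternary \<beta> \<le> 1"
proof -
  have s: "(\<lambda>k. 2 / 3 * (1 / 3) ^ k :: real) sums 1"
    using sums_mult[OF geometric_sums[of "1 / 3 :: real"], of "2 / 3"] by simp
  have le: "2 * of_bool (\<beta> k) / 3 ^ Suc k \<le> (2 / 3 * (1 / 3) ^ k :: real)" for k
    by (auto simp: power_divide)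
  show sm: "summable (\<lambda>k. 2 * of_bool (\<beta> k) / 3 ^ Suc k :: real)"
    by (rule summable_comparison_test'[OF sums_summable[OF s], of 0]) (use le in auto)
  show "0 \<le> ternary \<beta>" unfolding ternary_def by (rule suminf_nonneg[OF sm]) simp
  have "ternary \<beta> \<le> (\<Sum>k. 2 / 3 * (1 / 3) ^ k)"
    unfolding ternary_def by (rule suminf_le[OF le sm sums_summable[OF s]])
  then show "ternary \<beta> \<le> 1" using sums_unique[OF s] by simp
qed

lemma ternary_unfold: "3 * ternary \<beta> = 2 * of_bool (\<beta> 0) + ternary (\<lambda>k. \<beta> (Suc k))"
proof -
  have "ternary \<beta> = (\<Sum>k. 2 * of_bool (\<beta> (Suc k)) / 3 ^ Suc (Suc k)) + 2 * of_bool (\<beta> 0) / 3 ^ Suc 0"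
    unfolding ternary_def using suminf_split_head[OF ternary_summable[of \<beta>]] by simp
  also have "(\<Sum>k. 2 * of_bool (\<beta> (Suc k)) / 3 ^ Suc (Suc k)) = (\<Sum>k. 1 / 3 * (2 * of_bool (\<beta> (Suc k)) / 3 ^ Suc k) :: real)"
    by simp
  also have "\<dots> = 1 / 3 * ternary (\<lambda>k. \<beta> (Suc k))"
    unfolding ternary_def by (rule suminf_mult[OF ternary_summable[of "\<lambda>k. \<beta> (Suc k)"]])
  finally show ?thesis by simp
qed

lemma ramp_ternary: "ramp (ternary \<beta>) = of_bool (\<beta> 0)"
  using ternary_unfold[of \<beta>] ternary_bounds[of "\<lambda>k. \<beta> (Suc k)"] by (auto simp: ramp_def)

lemma bit_value_ternary: "bit_value k (ternary \<beta>) = of_bool (\<beta> k)"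
proof -
  have "residual k (ternary \<beta>) = ternary (\<lambda>j. \<beta> (k + j))"
  proof (induction k)
    case (Suc k)
    show ?case using Suc ternary_unfold[of "\<lambda>j. \<beta> (k + j)"] ramp_ternary[of "\<lambda>j. \<beta> (k + j)"] by simp
  qed simp
  then show ?thesis by (simp add: bit_value_def ramp_ternary)
qed

text \<open>
  Unary coding: digit \<open>k\<close> is the number of true bits among the first \<open>m k - 1\<close> bits in row \<open>k\<close>, so all
  bit sequences code admissible digits.
\<close>

definition bits_to_digits :: "(nat \<Rightarrow> nat) \<Rightarrow> (nat \<Rightarrow> bool) \<Rightarrow> nat \<Rightarrow> nat" where
  "bits_to_digits m \<beta> k = card {l. l < m k - 1 \<and> \<beta> (prod_encode (k, l))}"

definition digits_to_bits :: "(nat \<Rightarrow> nat) \<Rightarrow> nat \<Rightarrow> bool" where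
  "digits_to_bits \<sigma> j = (snd (prod_decode j) < \<sigma> (fst (prod_decode j)))"

lemma bits_to_digits_less: "0 < m k \<Longrightarrow> bits_to_digits m \<beta> k < m k"
proof -
  assume "0 < m k"
  have "card {l. l < m k - 1 \<and> \<beta> (prod_encode (k, l))} \<le> card {..<m k - 1}"
    by (rule card_mono) auto
  then show ?thesis unfolding bits_to_digits_def using \<open>0 < m k\<close> by simp
qed

lemma bits_to_digits_inverse:
  assumes "\<sigma> k < m k"
  shows "bits_to_digits m (digits_to_bits \<sigma>) k = \<sigma> k"
proof -
  have "{l. l < m k - 1 \<and> digits_to_bits \<sigma> (prod_encode (k, l))} = {..<\<sigma> k}"
    using assms by (auto simp: digits_to_bits_def)
  then show ?thesis by (simp add: bits_to_digits_def)
qed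

definition bits_of_real :: "real \<Rightarrow> nat \<Rightarrow> bool" where "bits_of_real x k \<longleftrightarrow> 1 / 2 < bit_value k x"

lemma bits_of_real_ternary: "bits_of_real (ternary \<beta>) = \<beta>"
  by (rule ext) (simp add: bits_of_real_def bit_value_ternary)

text \<open>
  A continuous function that is the indicator of a cylinder on those reals whose first \<open>J\<close> bit values
  are exactly 0 or 1.
\<close>

definition cylinder_weight :: "nat \<Rightarrow> nat set \<Rightarrow> real \<Rightarrow> real" where
  "cylinder_weight J b x = (\<Prod>j<J. if j \<in> b then bit_value j x else 1 - bit_value j x)"

lemma cylinder_weight_interpolates:
  assumes x: "\<And>j. j < J \<Longrightarrow> bit_value j x \<in> {0, 1}"
    and \<Phi>: "\<And>\<beta> \<beta>'. (\<And>j. j < J \<Longrightarrow> \<beta> j = \<beta>' j) \<Longrightarrow> \<Phi> \<beta> = \<Phi> \<beta>'"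
  shows "(\<Sum>b\<in>Pow {..<J}. \<Phi> (\<lambda>j. j \<in> b) * cylinder_weight J b x) = (\<Phi> (bits_of_real x) :: real)"
proof -
  define b0 where "b0 = {j\<in>{..<J}. bits_of_real x j}"
  have w: "cylinder_weight J b x = of_bool (b = b0)" if b: "b \<in> Pow {..<J}" for b
  proof (cases "b = b0")
    case True
    have "(\<Prod>j<J. if j \<in> b then bit_value j x else 1 - bit_value j x) = (\<Prod>j<J. 1)"
      by (rule prod.cong) (use x True in \<open>force simp: b0_def bits_of_real_def\<close>)+
    then show ?thesis using True by (simp add: cylinder_weight_def)
  next
    case False
    then obtain j where j: "j < J" "j \<in> b \<longleftrightarrow> j \<notin> b0" using b by (auto simp: b0_def)
    then have "(if j \<in> b then bit_value j x else 1 - bit_value j x) = 0"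
      using x[OF j(1)] by (auto simp: b0_def bits_of_real_def)
    then have "cylinder_weight J b x = 0" unfolding cylinder_weight_def using j(1)
      by (intro prod_zero bexI[of _ j]) auto
    then show ?thesis using False by simp
  qed
  have "(\<Sum>b\<in>Pow {..<J}. \<Phi> (\<lambda>j. j \<in> b) * cylinder_weight J b x) = (\<Sum>b\<in>Pow {..<J}. if b = b0 then \<Phi> (\<lambda>j. j \<in> b) else 0)"
    by (rule sum.cong) (auto simp: w)
  also have "\<dots> = \<Phi> (\<lambda>j. j \<in> b0)" by (subst sum.delta) (auto simp: b0_def)
  also have "\<dots> = \<Phi> (bits_of_real x)" by (rule \<Phi>) (auto simp: b0_def)
  finally show ?thesis .
qed

lemma integral_uniform_law:
  fixes \<psi> :: "real \<Rightarrow> real"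
  assumes "0 < R" "\<psi> \<in> borel_measurable borel"
  shows "(LINT x|distr (measure_pmf (pmf_of_set {..<R})) borel X. \<psi> x) = (\<Sum>r<R. \<psi> (X r)) / real R"
proof -
  have "(LINT x|distr (measure_pmf (pmf_of_set {..<R})) borel X. \<psi> x) = (LINT r|measure_pmf (pmf_of_set {..<R}). \<psi> (X r))"
    using assms(2) by (intro integral_distr) auto
  also have "\<dots> = (\<Sum>r<R. \<psi> (X r)) / real (card {..<R})"
    by (rule integral_pmf_of_set) (use assms(1) in auto)
  finally show ?thesis by simp
qed

text \<open>
  Laws on digit sequences are transported to laws on the unit interval, where Helly's theorem yields a
  weakly convergent subsequence. The limit is concentrated on reals with exact bit values, because
  \<open>bit_value j * (1 - bit_value j)\<close> is continuous and has integral 0 along the sequence. A function of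
  finitely many digits then agrees almost everywhere with a continuous function, so its expectation
  passes to the limit.
\<close>

theorem limit_law:
  fixes m R :: "nat \<Rightarrow> nat" and X :: "nat \<Rightarrow> nat \<Rightarrow> nat \<Rightarrow> nat"
  assumes m: "\<And>k. 0 < m k" and R: "\<And>N. 0 < R N" and X: "\<And>N r k. r < R N \<Longrightarrow> X N r k < m k"
  obtains M :: "real measure" and dig :: "real \<Rightarrow> nat \<Rightarrow> nat"
  where "prob_space M" "sets M = sets borel"
    "\<And>k. (\<lambda>w. dig w k) \<in> borel \<rightarrow>\<^sub>M count_space UNIV" "\<And>w k. dig w k < m k"
    "\<forall>n H c. (\<forall>\<sigma> \<sigma>'. (\<forall>k<n. \<sigma> k = \<sigma>' k) \<longrightarrow> H \<sigma> = H \<sigma>') \<longrightarrow>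
      (\<forall>\<^sub>F N in sequentially. (\<Sum>r<R N. H (X N r)) / real (R N) \<le> (c :: real)) \<longrightarrow> (LINT w|M. H (dig w)) \<le> c"
proof -
  define \<mu> where "\<mu> N = distr (measure_pmf (pmf_of_set {..<R N})) borel (\<lambda>r. ternary (digits_to_bits (X N r)))" for N
  have rd: "real_distribution (\<mu> N)" for N
    unfolding \<mu>_def by (rule prob_space.real_distribution_distr[OF measure_pmf.prob_space_axioms]) simp
  have int\<mu>: "(LINT x|\<mu> N. \<psi> x) = (\<Sum>r<R N. \<psi> (ternary (digits_to_bits (X N r)))) / real (R N)"
    if "\<psi> \<in> borel_measurable borel" for \<psi> :: "real \<Rightarrow> real" and N
    unfolding \<mu>_def by (rule integral_uniform_law[OF R that])
  have "tight \<mu>"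
    unfolding tight_def
  proof (intro conjI allI impI rd)
    fix e :: real assume e: "0 < e"
    have "measure (\<mu> n) {-1<..1} > 1 - e" for n
    proof -
      have "(\<lambda>r. ternary (digits_to_bits (X n r))) -` {-1<..1} = UNIV"
        by (auto intro!: ternary_bounds(2) less_le_trans[OF _ ternary_bounds(1)])
      then have "measure (\<mu> n) {-1<..1} = 1"
        unfolding \<mu>_def by (subst measure_distr) auto
      then show ?thesis using e by simp
    qed
    then show "\<exists>a b. a < b \<and> (\<forall>n. measure (\<mu> n) {a<..b} > 1 - e)" by (intro exI[of _ "-1"] exI[of _ 1]) auto
  qed
  from tight_imp_convergent_subsubsequence[OF this strict_mono_id]
  obtain q M where q: "strict_mono q" and M: "real_distribution M" and "weak_conv_m (\<mu> \<circ> id \<circ> q) M" by blast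
  then have conv: "weak_conv_m (\<mu> \<circ> q) M" by simp
  interpret M: real_distribution M by (rule M)
  have limit: "(\<lambda>N. (\<Sum>r<R (q N). \<psi> (ternary (digits_to_bits (X (q N) r)))) / real (R (q N))) \<longlonglongrightarrow> (LINT x|M. \<psi> x)"
    if \<psi>: "\<And>x. isCont \<psi> x" "\<And>x. norm (\<psi> x) \<le> B" for \<psi> :: "real \<Rightarrow> real" and B
  proof -
    have "(\<lambda>N. LINT x|(\<mu> \<circ> q) N. \<psi> x) \<longlonglongrightarrow> (LINT x|M. \<psi> x)"
      by (rule weak_conv_imp_integral_bdd_continuous_conv[OF _ M conv \<psi>]) (simp add: rd)
    moreover have "\<psi> \<in> borel_measurable borel"
      using \<psi>(1) by (intro borel_measurable_continuous_onI) (simp add: continuous_at_imp_continuous_on)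
    ultimately show ?thesis by (simp add: int\<mu>)
  qed
  have bm [measurable]: "bit_value j \<in> borel_measurable borel" for j
    by (intro borel_measurable_continuous_onI) (simp add: continuous_at_imp_continuous_on continuous_bit_value)
  define dig where "dig w = bits_to_digits m (bits_of_real w)" for w
  have ae: "AE x in M. bit_value j x \<in> {0, 1}" for j
  proof -
    let ?\<psi> = "\<lambda>x. bit_value j x * (1 - bit_value j x)"
    have nn: "0 \<le> ?\<psi> x" "?\<psi> x \<le> 1" for x using bit_value_range[of j x] by (auto intro: mult_le_one)
    have "(\<lambda>N. (\<Sum>r<R (q N). ?\<psi> (ternary (digits_to_bits (X (q N) r)))) / real (R (q N))) \<longlonglongrightarrow> (LINT x|M. ?\<psi> x)"
      by (rule limit[of ?\<psi> 1]) (use nn in \<open>auto intro!: continuous_intros continuous_bit_value\<close>)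
    then have "(\<lambda>N. 0) \<longlonglongrightarrow> (LINT x|M. ?\<psi> x)" by (simp add: bit_value_ternary)
    then have 0: "(LINT x|M. ?\<psi> x) = 0" by (simp add: LIMSEQ_const_iff)
    have "integrable M ?\<psi>" by (rule M.integrable_const_bound[where B=1]) (use nn in auto)
    then have "AE x in M. ?\<psi> x = 0" using 0 nn by (subst (asm) integral_nonneg_eq_0_iff_AE) auto
    then show ?thesis by eventually_elim auto
  qed
  show ?thesis
  proof (rule that)
    show "prob_space M" by unfold_locales
    show "sets M = sets borel" by simp
    show "dig w k < m k" for w k unfolding dig_def by (rule bits_to_digits_less) (rule m)
    show "(\<lambda>w. dig w k) \<in> borel \<rightarrow>\<^sub>M count_space UNIV" for k
      unfolding dig_def bits_to_digits_def bits_of_real_def by measurable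
    show "\<forall>n H c. (\<forall>\<sigma> \<sigma>'. (\<forall>k<n. \<sigma> k = \<sigma>' k) \<longrightarrow> H \<sigma> = H \<sigma>') \<longrightarrow>
      (\<forall>\<^sub>F N in sequentially. (\<Sum>r<R N. H (X N r)) / real (R N) \<le> (c :: real)) \<longrightarrow> (LINT w|M. H (dig w)) \<le> c"
    proof (intro allI impI)
      fix n c and H :: "(nat \<Rightarrow> nat) \<Rightarrow> real"
      assume H0: "\<forall>\<sigma> \<sigma>'. (\<forall>k<n. \<sigma> k = \<sigma>' k) \<longrightarrow> H \<sigma> = H \<sigma>'"
        and le: "\<forall>\<^sub>F N in sequentially. (\<Sum>r<R N. H (X N r)) / real (R N) \<le> c"
      have H: "H \<sigma> = H \<sigma>'" if "\<And>k. k < n \<Longrightarrow> \<sigma> k = \<sigma>' k" for \<sigma> \<sigma>'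
        using H0 that by simp
      define J where "J = Suc (Max (insert 0 (prod_encode ` (SIGMA k:{..<n}. {..<m k}))))"
      have J: "prod_encode (k, l) < J" if "k < n" "l < m k" for k l
        unfolding J_def using that by (intro le_imp_less_Suc Max_ge) auto
      define \<Phi> where "\<Phi> \<beta> = H (bits_to_digits m \<beta>)" for \<beta>
      have \<Phi>: "\<Phi> \<beta> = \<Phi> \<beta>'" if eq: "\<And>j. j < J \<Longrightarrow> \<beta> j = \<beta>' j" for \<beta> \<beta>'
        unfolding \<Phi>_def
      proof (rule H)
        fix k assume k: "k < n"
        have "{l. l < m k - 1 \<and> \<beta> (prod_encode (k, l))} = {l. l < m k - 1 \<and> \<beta>' (prod_encode (k, l))}"
          using eq[OF J[OF k]] by auto
        then show "bits_to_digits m \<beta> k = bits_to_digits m \<beta>' k" by (simp add: bits_to_digits_def)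
      qed
      define \<Psi> where "\<Psi> x = (\<Sum>b\<in>Pow {..<J}. \<Phi> (\<lambda>j. j \<in> b) * cylinder_weight J b x)" for x
      have cont: "isCont \<Psi> x" for x
      proof -
        have "isCont (\<lambda>x. if j \<in> b then bit_value j x else 1 - bit_value j x) x" for j b
          by (cases "j \<in> b") (auto intro!: continuous_intros continuous_bit_value)
        then have "isCont (cylinder_weight J b) x" for b
          unfolding cylinder_weight_def by (intro continuous_prod)
        then show ?thesis unfolding \<Psi>_def by (intro continuous_intros)
      qed
      have bound: "norm (\<Psi> x) \<le> (\<Sum>b\<in>Pow {..<J}. \<bar>\<Phi> (\<lambda>j. j \<in> b)\<bar>)" for x
      proof -
        have "\<bar>cylinder_weight J b x\<bar> \<le> 1" for b
        proof -
          have "\<bar>if j \<in> b then bit_value j x else 1 - bit_value j x\<bar> \<le> 1" for j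
            using bit_value_range[of j x] by auto
          then show ?thesis unfolding cylinder_weight_def abs_prod by (intro prod_le_1) auto
        qed
        then have "\<bar>\<Phi> (\<lambda>j. j \<in> b) * cylinder_weight J b x\<bar> \<le> \<bar>\<Phi> (\<lambda>j. j \<in> b)\<bar>" for b
          by (simp add: abs_mult mult_left_le)
        then show ?thesis unfolding \<Psi>_def real_norm_def by (intro order_trans[OF sum_abs] sum_mono)
      qed
      have interp: "\<Psi> x = \<Phi> (bits_of_real x)" if bits: "\<And>j. j < J \<Longrightarrow> bit_value j x \<in> {0, 1}" for x
        unfolding \<Psi>_def by (rule cylinder_weight_interpolates, erule bits, rule \<Phi>, blast)
      have val: "\<Psi> (ternary (digits_to_bits (X N r))) = H (X N r)" if "r < R N" for N r
      proof -
        have "\<Psi> (ternary (digits_to_bits (X N r))) = \<Phi> (digits_to_bits (X N r))"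
          by (subst interp) (auto simp: bit_value_ternary bits_of_real_ternary)
        also have "\<dots> = H (X N r)"
          unfolding \<Phi>_def using X[OF that] by (intro H bits_to_digits_inverse)
        finally show ?thesis .
      qed
      have "(\<lambda>N. (\<Sum>r<R (q N). \<Psi> (ternary (digits_to_bits (X (q N) r)))) / real (R (q N))) \<longlonglongrightarrow> (LINT x|M. \<Psi> x)"
        by (rule limit[OF cont bound])
      then have "(\<lambda>N. (\<Sum>r<R (q N). H (X (q N) r)) / real (R (q N))) \<longlonglongrightarrow> (LINT x|M. \<Psi> x)"
        by (simp add: val)
      moreover have "\<forall>\<^sub>F N in sequentially. (\<Sum>r<R (q N). H (X (q N) r)) / real (R (q N)) \<le> c"
        using eventually_subseq[OF q le] .
      ultimately have "(LINT x|M. \<Psi> x) \<le> c" by (intro tendsto_upperbound) auto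
      moreover have "(LINT x|M. \<Psi> x) = (LINT w|M. H (dig w))"
      proof -
        have "AE x in M. \<forall>j\<in>{..<J}. bit_value j x \<in> {0, 1}" using ae by (subst AE_finite_all) auto
        then have "AE x in M. \<Psi> x = H (dig x)"
          by eventually_elim (simp add: interp \<Phi>_def dig_def)
        moreover have "(\<lambda>w. H (dig w)) \<in> borel_measurable borel"
        proof -
          have "H (dig w) = (\<Sum>b\<in>Pow {..<J}. if b = {j\<in>{..<J}. bits_of_real w j} then \<Phi> (\<lambda>j. j \<in> b) else 0)" for w
          proof -
            have "(\<Sum>b\<in>Pow {..<J}. if b = {j\<in>{..<J}. bits_of_real w j} then \<Phi> (\<lambda>j. j \<in> b) else 0) = \<Phi> (\<lambda>j. j \<in> {j\<in>{..<J}. bits_of_real w j})"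
              by (subst sum.delta) auto
            also have "\<dots> = \<Phi> (bits_of_real w)" by (rule \<Phi>) auto
            finally show ?thesis by (simp add: \<Phi>_def dig_def)
          qed
          moreover have "{w. b = {j\<in>{..<J}. bits_of_real w j}} \<in> sets borel" for b
          proof -
            have "{w. b = {j\<in>{..<J}. bits_of_real w j}} = {w. b \<subseteq> {..<J} \<and> (\<forall>j\<in>{..<J}. j \<in> b \<longleftrightarrow> 1 / 2 < bit_value j w)}"
              by (auto simp: bits_of_real_def)
            also have "\<dots> \<in> sets borel" by measurable
            finally show ?thesis .
          qed
          then have "(\<lambda>w. if b = {j\<in>{..<J}. bits_of_real w j} then \<Phi> (\<lambda>j. j \<in> b) else 0) \<in> borel_measurable borel" for b
            by (intro measurable_If) (auto simp: pred_def)
          ultimately show ?thesis by (simp only:) (intro borel_measurable_sum)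
        qed
        moreover have "\<Psi> \<in> borel_measurable borel"
          using cont by (intro borel_measurable_continuous_onI) (simp add: continuous_at_imp_continuous_on)
        ultimately show ?thesis by (intro integral_cong_AE) auto
      qed
      ultimately show "(LINT w|M. H (dig w)) \<le> c" by simp
    qed
  qed
qed

text \<open>
  If only finitely many digits matter at each point, the value is a function of the point and of a
  finite list of numbers, and there are only countably many such lists.
\<close>

lemma digits_measurable:
  fixes dig :: "'w \<Rightarrow> nat \<Rightarrow> nat" and \<Phi> :: "(nat \<Rightarrow> nat) \<Rightarrow> 'z \<Rightarrow> 'c"
  assumes dig: "\<And>k. (\<lambda>z. dig (w z) k) \<in> Z \<rightarrow>\<^sub>M count_space UNIV"
    and n: "n \<in> Z \<rightarrow>\<^sub>M count_space UNIV"
    and \<Phi>: "\<And>\<sigma>. \<Phi> \<sigma> \<in> Z \<rightarrow>\<^sub>M N"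
    and dep: "\<And>z \<sigma> \<sigma>'. z \<in> space Z \<Longrightarrow> (\<And>k. k < n z \<Longrightarrow> \<sigma> k = \<sigma>' k) \<Longrightarrow> \<Phi> \<sigma> z = \<Phi> \<sigma>' z"
  shows "(\<lambda>z. \<Phi> (dig (w z)) z) \<in> Z \<rightarrow>\<^sub>M N"
proof -
  have pre: "(\<lambda>z. map (dig (w z)) [0..<m]) \<in> Z \<rightarrow>\<^sub>M count_space UNIV" for m
  proof (induction m)
    case (Suc m)
    have "(\<lambda>z. (\<lambda>xs z. xs @ [dig (w z) m]) (map (dig (w z)) [0..<m]) z) \<in> Z \<rightarrow>\<^sub>M count_space UNIV"
      by (rule measurable_compose_countable[OF _ Suc.IH], rule measurable_compose[OF dig]) simp
    then show ?case by simp
  qed simp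
  have g: "(\<lambda>z. map (dig (w z)) [0..<n z]) \<in> Z \<rightarrow>\<^sub>M count_space UNIV"
    by (rule measurable_compose_countable[OF pre n])
  define ext where "ext xs i = (if i < length xs then xs ! i else 0)" for xs :: "nat list" and i
  have "(\<lambda>z. \<Phi> (ext (map (dig (w z)) [0..<n z])) z) \<in> Z \<rightarrow>\<^sub>M N"
    by (rule measurable_compose_countable[OF \<Phi> g])
  then show ?thesis
    by (rule measurable_cong[THEN iffD1, rotated]) (auto intro!: dep simp: ext_def)
qed

section \<open>Pure controls that are good on every horizon\<close>

context compact_nonexpansive_problem
begin

lemma Vs_bounds: "- M \<le> Vs y" "Vs y \<le> M"
proof -
  have "- M \<le> W (cesaro 1) y" by (intro W_greatest cesaro1 integral_cost_bounds(1))
  then show "- M \<le> Vs y" using W_le_Vs[OF cesaro1, of y] by simp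
  show "Vs y \<le> M" by (rule Vs_le[OF W_le_M])
qed

lemma cost_integrable: "y \<in> Y \<Longrightarrow> u \<in> controls U \<Longrightarrow> 0 \<le> a \<Longrightarrow> cost u y integrable_on {a..b}"
  by (intro integrable_continuous_real continuous_on_subset[OF cost_continuous]) auto

lemma integral_cost_abs:
  assumes "y \<in> Y" "u \<in> controls U" "0 \<le> a" "a \<le> b"
  shows "\<bar>integral {a..b} (cost u y)\<bar> \<le> M * (b - a)"
proof -
  have "(cost u y has_integral integral {a..b} (cost u y)) (cbox a b)"
    using cost_integrable[OF assms(1-3), of b] by (simp add: has_integral_integral)
  then have "norm (integral {a..b} (cost u y)) \<le> M * measure lborel (cbox a b)"
    by (rule has_integral_bound[rotated]) (use M_pos G_bound in auto)
  then show ?thesis using assms(4) by simp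
qed

lemma integral_cost_shift:
  "integral {0..t} (\<lambda>r. cost u y (r + s)) = integral {s..t + s} (cost u y)"
  using integral_shift_real_ivl[of s s "t + s" "cost u y"] by simp

lemma integral_cost_combine:
  "y \<in> Y \<Longrightarrow> u \<in> controls U \<Longrightarrow> 0 \<le> a \<Longrightarrow> a \<le> b \<Longrightarrow> b \<le> c \<Longrightarrow>
    integral {a..c} (cost u y) = integral {a..b} (cost u y) + integral {b..c} (cost u y)"
  by (intro Henstock_Kurzweil_Integration.integral_combine[symmetric] cost_integrable) auto

lemma cesaro_cost:
  assumes "0 < T" "y \<in> Y" "u \<in> controls U"
  shows "(LINT t|cesaro T. cost u y t) = 1 / T * integral {0..T} (cost u y)"
proof -
  have "set_integrable lborel {0..T} (cost u y)"
    by (rule borel_integrable_atLeastAtMost') (rule continuous_on_subset[OF cost_continuous[OF assms(2,3)]], auto)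
  then show ?thesis
    using integral_cesaro[OF assms(1) cost_measurable[OF assms(2,3)]] by (simp add: set_borel_integral_eq_integral)
qed

text \<open>
  Let \<open>\<Gamma>\<close> be the accumulated excess of the cost over \<open>V\<^sup>* + 3 e\<close> for a control whose average on \<open>[0, T]\<close>
  is at most \<open>V\<^sup>* + 2 e\<close>, and let \<open>s\<close> maximize \<open>\<Gamma>\<close>. From \<open>s\<close> on, the excess never exceeds its value at
  \<open>s\<close>. As \<open>\<Gamma>\<close> ends at or below \<open>- T e\<close> and decreases with bounded speed, \<open>T - s\<close> is at least a fixed multiple
  of \<open>T\<close>.
\<close>

lemma good_start_time:
  assumes y: "y \<in> Y" and e: "0 < e"
  obtains s u where "0 \<le> s" "u \<in> controls U"
    "\<And>t. 0 \<le> t \<Longrightarrow> t \<le> real N \<Longrightarrow> integral {0..t} (\<lambda>r. cost u y (r + s)) \<le> t * (Vs y + 3 * e)"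
proof -
  obtain \<eta> S where S: "0 < \<eta>" "0 < S"
    "\<And>\<theta> y. \<theta> \<in> evaluations \<Longrightarrow> (\<And>s. 0 \<le> s \<Longrightarrow> s \<le> S \<Longrightarrow> TV s \<theta> \<le> \<eta>) \<Longrightarrow> y \<in> Y \<Longrightarrow> \<bar>V \<theta> y - Vs y\<bar> \<le> e"
    using limit_value_uniform[OF e] by blast
  define B where "B = 2 * M + 3 * e"
  have B: "0 < B" using M_pos e by (simp add: B_def)
  define T where "T = max (S / \<eta>) (B * real N / e) + 1"
  have "0 < S / \<eta>" using S by simp
  then have T: "0 < T" "S / \<eta> \<le> T" "B * real N / e \<le> T"
    unfolding T_def by linarith+
  have "\<bar>V (cesaro T) y - Vs y\<bar> \<le> e"
  proof (rule S(3)[OF cesaro_evaluation[OF T(1)] _ y])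
    fix s assume s: "0 \<le> s" "s \<le> S"
    have "TV s (cesaro T) \<le> s / T" by (rule TV_cesaro[OF T(1) s(1)])
    also have "\<dots> \<le> S / T" using s T by (simp add: divide_right_mono)
    also have "\<dots> \<le> \<eta>" using T S by (simp add: field_simps)
    finally show "TV s (cesaro T) \<le> \<eta>" .
  qed
  moreover obtain u where u: "u \<in> controls U" "(LINT t|cesaro T. cost u y t) \<le> V (cesaro T) y + e"
    using V_approx[OF cesaro_evaluation[OF T(1)] e] by blast
  ultimately have "1 / T * integral {0..T} (cost u y) \<le> Vs y + 2 * e"
    using cesaro_cost[OF T(1) y u(1)] by simp
  then have fin: "integral {0..T} (cost u y) \<le> T * (Vs y + 2 * e)" using T(1) by (simp add: field_simps)
  define \<Gamma> where "\<Gamma> t = integral {0..t} (cost u y) - t * (Vs y + 3 * e)" for t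
  have "continuous_on {0..T} \<Gamma>"
    unfolding \<Gamma>_def by (intro continuous_intros indefinite_integral_continuous_1 cost_integrable y u) auto
  then obtain s where s: "s \<in> {0..T}" "\<And>t. t \<in> {0..T} \<Longrightarrow> \<Gamma> t \<le> \<Gamma> s"
    using continuous_attains_sup[of "{0..T}" \<Gamma>] T(1) by (metis atLeastAtMost_iff atLeastatMost_empty_iff2 compact_Icc less_eq_real_def not_less)
  have diff: "\<Gamma> t - \<Gamma> s = integral {s..t} (cost u y) - (t - s) * (Vs y + 3 * e)" if "s \<le> t" for t
    using integral_cost_combine[OF y u(1), of 0 s t] s that by (simp add: \<Gamma>_def algebra_simps)
  have "0 \<le> \<Gamma> s" using s(2)[of 0] T(1) by (simp add: \<Gamma>_def)
  moreover have "\<Gamma> T \<le> - (T * e)" using fin by (simp add: \<Gamma>_def algebra_simps)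
  ultimately have "T * e \<le> - (\<Gamma> T - \<Gamma> s)" by simp
  also have "\<dots> = (T - s) * (Vs y + 3 * e) - integral {s..T} (cost u y)" using diff[of T] s by simp
  also have "\<dots> \<le> (T - s) * (M + 3 * e) + M * (T - s)"
  proof -
    have "(T - s) * (Vs y + 3 * e) \<le> (T - s) * (M + 3 * e)" using Vs_bounds(2)[of y] s by (intro mult_left_mono) auto
    moreover have "- integral {s..T} (cost u y) \<le> M * (T - s)"
      using integral_cost_abs[OF y u(1), of s T] s by (simp add: abs_le_iff)
    ultimately show ?thesis by simp
  qed
  also have "\<dots> = (T - s) * B" by (simp add: B_def algebra_simps)
  finally have "T * e \<le> (T - s) * B" .
  moreover have "B * real N \<le> T * e" using T(3) e by (simp add: field_simps)
  ultimately have "real N * B \<le> (T - s) * B" by (simp add: mult.commute)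
  then have N: "real N \<le> T - s" using B by simp
  show ?thesis
  proof (rule that)
    show "0 \<le> s" using s by simp
    show "u \<in> controls U" by (rule u(1))
    fix t :: real assume t: "0 \<le> t" "t \<le> real N"
    have "\<Gamma> (t + s) \<le> \<Gamma> s" using s t N by (intro s(2)) auto
    then show "integral {0..t} (\<lambda>r. cost u y (r + s)) \<le> t * (Vs y + 3 * e)"
      unfolding integral_cost_shift using diff[of "t + s"] t by simp
  qed
qed

end

context fine_grid
begin

lemma path_dep: "(\<And>k. k < Suc (cell t) \<Longrightarrow> \<sigma> k = \<sigma>' k) \<Longrightarrow> 0 \<le> t \<Longrightarrow> path \<sigma> y t = path \<sigma>' y t"
proof (rule path_cong)
  fix k assume eq: "\<And>k. k < Suc (cell t) \<Longrightarrow> \<sigma> k = \<sigma>' k" and k: "\<tau> k < t"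
  have "k \<le> cell t"
  proof (rule ccontr)
    assume "\<not> k \<le> cell t"
    then show False using \<tau>_mono[of "Suc (cell t)" k] cell_upper[of t] k by simp
  qed
  then show "\<sigma> k = \<sigma>' k" by (intro eq) simp
qed

lemma cell_mono: "0 \<le> s \<Longrightarrow> s \<le> t \<Longrightarrow> cell s \<le> cell t"
proof (rule ccontr)
  assume "0 \<le> s" "s \<le> t" "\<not> cell s \<le> cell t"
  then show False using \<tau>_mono[of "Suc (cell t)" "cell s"] cell_upper[of t] cell_lower[of s] by simp
qed

text \<open>
  The start time depends on the horizon \<open>N\<close>, but it can be replaced by one of finitely many delays.
  Hence the constant \<open>K\<close> that pays for the delay does not depend on \<open>N\<close>.
\<close>

lemma pure_uniform_finite_horizon:
  assumes y: "y \<in> Y"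
  obtains K where "0 \<le> K"
    "\<And>N. \<exists>\<sigma>. admissible \<sigma> \<and> (\<forall>t\<in>{0..real N}. integral {0..t} (cost (ctrl \<sigma>) y) \<le> t * (Vs y + 4 * \<epsilon>) + K)"
proof -
  obtain F where F: "finite F" "\<And>s u. 0 \<le> s \<Longrightarrow> u \<in> controls U \<Longrightarrow>
    \<exists>k\<in>F. \<exists>\<sigma>. admissible \<sigma> \<and> (\<forall>t\<ge>0. \<bar>cost u y (t + s) - G (path \<sigma> y (t + \<tau> k))\<bar> \<le> \<epsilon>)"
    using cost_finitely_many_shifts[OF y] by blast
  define S where "S = Max (insert 0 (\<tau> ` F))"
  have S: "0 \<le> S" "k \<in> F \<Longrightarrow> \<tau> k \<le> S" for k unfolding S_def using F(1) by auto
  have "\<exists>\<sigma>. admissible \<sigma> \<and> (\<forall>t\<in>{0..real N}. integral {0..t} (cost (ctrl \<sigma>) y) \<le> t * (Vs y + 4 * \<epsilon>) + 2 * M * S)" for N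
  proof -
    obtain s u where su: "0 \<le> s" "u \<in> controls U"
      "\<And>t. 0 \<le> t \<Longrightarrow> t \<le> real N \<Longrightarrow> integral {0..t} (\<lambda>r. cost u y (r + s)) \<le> t * (Vs y + 3 * \<epsilon>)"
      using good_start_time[OF y eps_pos] by blast
    obtain k \<sigma> where k: "k \<in> F" "admissible \<sigma>"
      and near: "\<And>t. 0 \<le> t \<Longrightarrow> \<bar>cost u y (t + s) - G (path \<sigma> y (t + \<tau> k))\<bar> \<le> \<epsilon>"
      using F(2)[OF su(1,2)] by blast
    let ?c = "cost (ctrl \<sigma>) y"
    have "integral {0..t} ?c \<le> t * (Vs y + 4 * \<epsilon>) + 2 * M * S" if t: "0 \<le> t" "t \<le> real N" for t
    proof -
      have ci: "(\<lambda>r. cost u y (r + s)) integrable_on {0..t}"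
        using integrable_shift_real_ivl[OF cost_integrable[OF y su(2,1), of "t + s"], of s] by simp
      have ci': "(\<lambda>r. ?c (r + \<tau> k)) integrable_on {0..t}"
        using integrable_shift_real_ivl[OF cost_integrable[OF y ctrl_in_controls \<tau>_nonneg, of \<sigma> k "t + \<tau> k"], of "\<tau> k"] by simp
      have "integral {0..t} (\<lambda>r. ?c (r + \<tau> k)) \<le> integral {0..t} (\<lambda>r. cost u y (r + s) + \<epsilon>)"
      proof (rule integral_le[OF ci'])
        show "(\<lambda>r. cost u y (r + s) + \<epsilon>) integrable_on {0..t}"
          by (rule integrable_add[OF ci integrable_const_ivl])
        fix r assume "r \<in> {0..t}"
        then show "?c (r + \<tau> k) \<le> cost u y (r + s) + \<epsilon>" using near[of r] by (simp add: abs_le_iff)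
      qed
      also have "\<dots> = integral {0..t} (\<lambda>r. cost u y (r + s)) + t * \<epsilon>"
        using Henstock_Kurzweil_Integration.integral_add[OF ci integrable_const_ivl[of \<epsilon> 0 t]] t by simp
      also have "\<dots> \<le> t * (Vs y + 4 * \<epsilon>)" using su(3)[OF t] by (simp add: algebra_simps)
      finally have 1: "integral {\<tau> k..t + \<tau> k} ?c \<le> t * (Vs y + 4 * \<epsilon>)" unfolding integral_cost_shift .
      have 2: "integral {0..t + \<tau> k} ?c = integral {0..\<tau> k} ?c + integral {\<tau> k..t + \<tau> k} ?c"
        "integral {0..t + \<tau> k} ?c = integral {0..t} ?c + integral {t..t + \<tau> k} ?c"
        using t \<tau>_nonneg[of k] by (intro integral_cost_combine[OF y ctrl_in_controls]; simp)+
      have 3: "\<bar>integral {0..\<tau> k} ?c\<bar> \<le> M * \<tau> k" "\<bar>integral {t..t + \<tau> k} ?c\<bar> \<le> M * \<tau> k"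
        using integral_cost_abs[OF y ctrl_in_controls, of 0 "\<tau> k" \<sigma>] integral_cost_abs[OF y ctrl_in_controls, of t "t + \<tau> k" \<sigma>] t \<tau>_nonneg[of k]
        by simp_all
      have "M * \<tau> k \<le> M * S" using S(2)[OF k(1)] M_pos by simp
      then show ?thesis using 1 2 3 by linarith
    qed
    then show ?thesis using k(2) by auto
  qed
  then show ?thesis using that[of "2 * M * S"] S(1) M_pos by simp
qed

lemma integral_path_dep:
  assumes "\<And>k. k < Suc (cell t) \<Longrightarrow> \<sigma> k = \<sigma>' k"
  shows "integral {0..t} (cost (ctrl \<sigma>) y) = integral {0..t} (cost (ctrl \<sigma>') y)"
proof (rule integral_cong)
  fix r assume r: "r \<in> {0..t}"
  then have "cell r \<le> cell t" by (intro cell_mono) auto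
  then have "path \<sigma> y r = path \<sigma>' y r" using r assms by (intro path_dep) auto
  then show "cost (ctrl \<sigma>) y r = cost (ctrl \<sigma>') y r" by simp
qed

text \<open>
  This is the compactness of the space of digit sequences, here deduced from \<open>limit_law\<close> for point
  masses: the limit law is concentrated on sequences that satisfy the bound at all integer times.
\<close>

lemma pure_uniform_digits:
  assumes y: "y \<in> Y"
  obtains \<sigma> K where "0 \<le> K" "admissible \<sigma>"
    "\<forall>t\<ge>0. integral {0..t} (cost (ctrl \<sigma>) y) \<le> t * (Vs y + 4 * \<epsilon>) + K"
proof -
  obtain K where K: "0 \<le> K"
    "\<And>N. \<exists>\<sigma>. admissible \<sigma> \<and> (\<forall>t\<in>{0..real N}. integral {0..t} (cost (ctrl \<sigma>) y) \<le> t * (Vs y + 4 * \<epsilon>) + K)"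
    using pure_uniform_finite_horizon[OF y] by blast
  from choice[OF allI[OF K(2)]] obtain X where X: "\<forall>N. admissible (X N) \<and>
    (\<forall>t\<in>{0..real N}. integral {0..t} (cost (ctrl (X N)) y) \<le> t * (Vs y + 4 * \<epsilon>) + K)" ..
  have dpos: "0 < digits k" for k using sel_less[of k] by (metis gr0I not_less_zero)
  have adm: "X N k < digits k" for N k using X by (simp add: admissible_def)
  define H where "H t \<sigma> = (if integral {0..t} (cost (ctrl \<sigma>) y) \<le> t * (Vs y + 4 * \<epsilon>) + K then 0 else 1 :: real)" for t \<sigma>
  have Hdep: "H t \<sigma> = H t \<sigma>'" if "\<And>k. k < Suc (cell t) \<Longrightarrow> \<sigma> k = \<sigma>' k" for t \<sigma> \<sigma>'
    unfolding H_def using integral_path_dep[OF that] by simp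
  obtain P :: "real measure" and dig where P: "prob_space P" "sets P = sets borel"
    and dig: "\<And>k. (\<lambda>w. dig w k) \<in> borel \<rightarrow>\<^sub>M count_space UNIV" "\<And>w k. dig w k < digits k"
    and lim0: "\<forall>n H c. (\<forall>\<sigma> \<sigma>'. (\<forall>k<n. \<sigma> k = \<sigma>' k) \<longrightarrow> H \<sigma> = H \<sigma>') \<longrightarrow>
      (\<forall>\<^sub>F N in sequentially. (\<Sum>r<(1::nat). H (X N)) / real 1 \<le> (c :: real)) \<longrightarrow> (LINT w|P. H (dig w)) \<le> c"
    by (rule limit_law[of digits "\<lambda>_. 1" "\<lambda>N r. X N", OF dpos zero_less_one adm]) (rule that, assumption+)
  have lim: "(LINT w|P. H (dig w)) \<le> c" if "\<And>\<sigma> \<sigma>'. (\<And>k. k < n \<Longrightarrow> \<sigma> k = \<sigma>' k) \<Longrightarrow> H \<sigma> = H \<sigma>'"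
    "\<forall>\<^sub>F N in sequentially. (\<Sum>r<(1::nat). H (X N)) / real 1 \<le> c" for n H and c :: real
    by (rule lim0[rule_format]) (use that in blast)+
  interpret P: prob_space P by (rule P(1))
  have "AE w in P. H (real n) (dig w) = 0" for n
  proof -
    have nn: "0 \<le> H t \<sigma>" "H t \<sigma> \<le> 1" for t \<sigma> by (auto simp: H_def)
    have "(LINT w|P. H (real n) (dig w)) \<le> 0"
    proof (rule lim[OF Hdep])
      have "(\<Sum>r<(1::nat). H (real n) (X N)) / real 1 \<le> 0" if "n \<le> N" for N
        using X that by (auto simp: H_def)
      then show "\<forall>\<^sub>F N in sequentially. (\<Sum>r<(1::nat). H (real n) (X N)) / real 1 \<le> 0"
        by (auto simp: eventually_sequentially)
    qed assumption
    moreover have "0 \<le> (LINT w|P. H (real n) (dig w))" by (rule Bochner_Integration.integral_nonneg) (rule nn)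
    ultimately have 0: "(LINT w|P. H (real n) (dig w)) = 0" by simp
    have "(\<lambda>w. H (real n) (dig w)) \<in> borel_measurable borel"
      by (rule digits_measurable[where w="\<lambda>w. w" and n="\<lambda>_. Suc (cell (real n))" and \<Phi>="\<lambda>\<sigma> _. H (real n) \<sigma>"],
          rule dig(1), simp, simp, rule Hdep, blast)
    then have "(\<lambda>w. H (real n) (dig w)) \<in> borel_measurable P" using measurable_cong_sets[OF P(2) refl] by blast
    then have "integrable P (\<lambda>w. H (real n) (dig w))"
      by (intro P.integrable_const_bound[where B=1]) (use nn in auto)
    then show ?thesis using 0 nn by (subst (asm) integral_nonneg_eq_0_iff_AE) auto
  qed
  then have "AE w in P. \<forall>n. H (real n) (dig w) = 0" by (simp add: AE_all_countable)
  from eventually_happens'[OF P.ae_filter_bot this] obtain w where w: "\<And>n. H (real n) (dig w) = 0" by blast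
  define \<sigma> where "\<sigma> = dig w"
  have grid: "integral {0..real n} (cost (ctrl \<sigma>) y) \<le> real n * (Vs y + 4 * \<epsilon>) + K" for n
    using w[of n] by (simp add: H_def \<sigma>_def split: if_splits)
  show ?thesis
  proof (rule that[of "K + 2 * M" \<sigma>], goal_cases)
    case 1 show ?case using K M_pos by simp
  next
    case 2 show ?case using dig(2) by (simp add: admissible_def \<sigma>_def)
  next
    case 3 show ?case
    proof (intro allI impI)
      fix t :: real assume t: "0 \<le> t"
      define n where "n = nat \<lfloor>t\<rfloor>"
      have n: "real n \<le> t" "t - real n \<le> 1" using t by (auto simp: n_def) linarith
      have "integral {0..t} (cost (ctrl \<sigma>) y) = integral {0..real n} (cost (ctrl \<sigma>) y) + integral {real n..t} (cost (ctrl \<sigma>) y)"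
        by (rule integral_cost_combine[OF y ctrl_in_controls]) (use n in auto)
      also have "\<dots> \<le> (real n * (Vs y + 4 * \<epsilon>) + K) + M * (t - real n)"
        using grid[of n] integral_cost_abs[OF y ctrl_in_controls, of "real n" t \<sigma>] n by (simp add: abs_le_iff)
      also have "\<dots> \<le> t * (Vs y + 4 * \<epsilon>) + (K + 2 * M)"
      proof -
        have "(t - real n) * (M - (Vs y + 4 * \<epsilon>)) \<le> (t - real n) * (2 * M)"
          using n Vs_bounds(1)[of y] eps_pos by (intro mult_left_mono) auto
        also have "\<dots> \<le> 1 * (2 * M)" using n M_pos by (intro mult_right_mono) auto
        finally show ?thesis by (simp add: algebra_simps)
      qed
      finally show "integral {0..t} (cost (ctrl \<sigma>) y) \<le> t * (Vs y + 4 * \<epsilon>) + (K + 2 * M)" .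
    qed
  qed
qed

end

context compact_nonexpansive_problem
begin

theorem pure_uniform:
  assumes y: "y \<in> Y" and e: "0 < e"
  obtains u K where "0 \<le> K" "u \<in> controls U"
    "\<forall>t\<ge>0. integral {0..t} (cost u y) \<le> t * (Vs y + e) + K"
proof -
  obtain h where "fine_grid U f g Y h (e / 4)" using fine_grid_exists[of "e / 4"] e by auto
  then interpret fine_grid U f g Y h "e / 4" .
  obtain \<sigma> K where "0 \<le> K" "admissible \<sigma>"
    "\<forall>t\<ge>0. integral {0..t} (cost (ctrl \<sigma>) y) \<le> t * (Vs y + 4 * (e / 4)) + K"
    by (rule pure_uniform_digits[OF y]) (rule that, assumption+)
  then show ?thesis using that[of K "ctrl \<sigma>"] ctrl_in_controls by simp
qed

section \<open>Weighted averages\<close>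

text \<open>
  With \<open>F t = integral {0..t} (k - c)\<close>, which is at most \<open>K\<close>, the derivative of
  \<open>\<rho> exp(- \<rho> t) (F t - K)\<close> is at least the integrand of the Abel mean of \<open>k - c\<close>. This function is
  nonpositive and equals \<open>- \<rho> K\<close> at 0.
\<close>

lemma abel_integral_le:
  fixes k :: "real \<Rightarrow> real"
  assumes k: "continuous_on {0..} k" and b: "\<And>t. 0 \<le> t \<Longrightarrow> \<bar>k t\<bar> \<le> B"
    and le: "\<And>t. 0 \<le> t \<Longrightarrow> integral {0..t} k \<le> t * c + K" and \<rho>: "0 < \<rho>"
  shows "(LINT t|abel \<rho>. k t) \<le> c + \<rho> * K"
proof -
  interpret prob_space "abel \<rho>" by (rule evaluationsD(1)[OF abel_evaluation[OF \<rho>]])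
  interpret dd: decreasing_density "exponential_density \<rho>" by (rule decreasing_density_exponential[OF \<rho>])
  define j where "j t = k t - c" for t
  have jc: "continuous_on {0..} j" unfolding j_def by (intro continuous_intros k)
  have km: "k \<in> borel_measurable half_line" "j \<in> borel_measurable half_line"
    by (rule continuous_on_halfline_measurable; fact)+
  define w where "w t = \<rho> * exp (- \<rho> * t) * j t" for t
  have part: "(LINT t:{0..T}|lborel. w t) \<le> \<rho> * K" if T: "0 \<le> T" for T
  proof -
    have wc: "continuous_on {0..T} w"
      unfolding w_def by (intro continuous_intros continuous_on_subset[OF jc]) auto
    have jT: "continuous_on {0..T} j" by (rule continuous_on_subset[OF jc]) auto
    define F where "F t = integral {0..t} j" for t
    have FK: "F t \<le> K" if "0 \<le> t" for t
    proof -
      have "k integrable_on {0..t}"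
        by (intro integrable_continuous_real continuous_on_subset[OF k]) auto
      then have "F t = integral {0..t} k - t * c"
        unfolding F_def j_def using Henstock_Kurzweil_Integration.integral_diff[OF _ integrable_const_ivl[of c 0 t], of k] that by simp
      then show ?thesis using le[OF that] by simp
    qed
    define E where "E t = \<rho> * exp (- \<rho> * t) * (F t - K)" for t
    define E' where "E' t = \<rho> * exp (- \<rho> * t) * j t - \<rho> * (\<rho> * exp (- \<rho> * t)) * (F t - K)" for t
    have "(E' has_integral (E T - E 0)) {0..T}"
    proof (rule fundamental_theorem_of_calculus[OF T])
      fix x assume x: "x \<in> {0..T}"
      have "(F has_real_derivative j x) (at x within {0..T})"
        unfolding F_def using integral_has_real_derivative[OF jT x] .
      then show "(E has_vector_derivative E' x) (at x within {0..T})"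
        unfolding E_def E'_def has_real_derivative_iff_has_vector_derivative[symmetric]
        by (auto intro!: derivative_eq_intros simp: algebra_simps)
    qed
    then have "integral {0..T} w \<le> E T - E 0"
    proof (rule has_integral_le[OF integrable_integral[OF integrable_continuous_real[OF wc]]])
      fix x assume x: "x \<in> {0..T}"
      have "0 \<le> \<rho> * (\<rho> * exp (- \<rho> * x)) * (K - F x)" using FK[of x] x \<rho> by simp
      then show "w x \<le> E' x" by (simp add: w_def E'_def algebra_simps)
    qed
    also have "\<dots> \<le> \<rho> * K"
    proof -
      have "E T \<le> 0" unfolding E_def using FK[OF T] \<rho> by (intro mult_nonneg_nonpos) auto
      moreover have "E 0 = - (\<rho> * K)" by (simp add: E_def F_def)
      ultimately show ?thesis by simp
    qed
    finally show ?thesis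
      using set_borel_integral_eq_integral(2)[OF borel_integrable_atLeastAtMost'[OF wc]] by simp
  qed
  have wi: "integrable lborel (\<lambda>t. indicat_real {0..} t *\<^sub>R w t)"
  proof (rule Bochner_Integration.integrable_bound)
    show "integrable lborel (\<lambda>t. (B + \<bar>c\<bar>) * exponential_density \<rho> t)"
      by (intro integrable_mult_right dd.integrable_density)
    have "w \<in> borel_measurable half_line"
      by (rule continuous_on_halfline_measurable) (auto simp: w_def intro!: continuous_intros jc)
    then show "(\<lambda>t. indicat_real {0..} t *\<^sub>R w t) \<in> borel_measurable lborel"
      using borel_measurable_restrict_space_iff[of "{0..}" borel w] by simp
    show "AE t in lborel. norm (indicat_real {0..} t *\<^sub>R w t) \<le> norm ((B + \<bar>c\<bar>) * exponential_density \<rho> t)"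
    proof (rule AE_I2)
      fix t :: real
      have "\<bar>w t\<bar> \<le> (B + \<bar>c\<bar>) * (\<rho> * exp (- t * \<rho>))" if "0 \<le> t"
      proof -
        have "\<bar>j t\<bar> \<le> B + \<bar>c\<bar>" using b[OF that] by (simp add: j_def)
        then have "(\<rho> * exp (- t * \<rho>)) * \<bar>j t\<bar> \<le> (\<rho> * exp (- t * \<rho>)) * (B + \<bar>c\<bar>)"
          using \<rho> by (intro mult_left_mono) auto
        then show ?thesis using \<rho> by (simp add: w_def abs_mult mult_ac)
      qed
      moreover have "(B + \<bar>c\<bar>) * (\<rho> * exp (- t * \<rho>)) \<le> \<bar>(B + \<bar>c\<bar>) * (\<rho> * exp (- t * \<rho>))\<bar>" by simp
      ultimately show "norm (indicat_real {0..} t *\<^sub>R w t) \<le> norm ((B + \<bar>c\<bar>) * exponential_density \<rho> t)"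
        by (auto simp: indicator_def exponential_density_def)
    qed
  qed
  have "((\<lambda>T. LINT t|lborel. indicator {..T} t *\<^sub>R (indicat_real {0..} t *\<^sub>R w t)) \<longlongrightarrow> (LINT t:{0..}|lborel. w t)) at_top"
    unfolding set_lebesgue_integral_def by (rule tendsto_integral_at_top[OF _ wi]) simp
  moreover have "(LINT t|lborel. indicator {..T} t *\<^sub>R (indicat_real {0..} t *\<^sub>R w t)) = (LINT t:{0..T}|lborel. w t)" for T
    unfolding set_lebesgue_integral_def by (rule Bochner_Integration.integral_cong) (auto simp: indicator_def)
  ultimately have "((\<lambda>T. LINT t:{0..T}|lborel. w t) \<longlongrightarrow> (LINT t:{0..}|lborel. w t)) at_top" by simp
  then have "(LINT t:{0..}|lborel. w t) \<le> \<rho> * K"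
    by (rule tendsto_upperbound) (auto intro!: eventually_at_top_linorderI[of 0] part)
  then have "(LINT t|abel \<rho>. j t) \<le> \<rho> * K" unfolding integral_abel[OF \<rho> km(2)] w_def .
  moreover have "integrable (abel \<rho>) k"
    by (rule integrable_const_bound[where B=B])
      (use b evaluationsD(3)[OF abel_evaluation[OF \<rho>]] borel_measurable_evaluation[OF abel_evaluation[OF \<rho>] km(1)] in auto)
  ultimately show ?thesis unfolding j_def by (simp add: prob_space)
qed

lemma real_of_ereal_between:
  fixes x :: ereal
  assumes "ereal a \<le> x" "x \<le> ereal b"
  shows "a \<le> real_of_ereal x" "real_of_ereal x \<le> b"
  using assms by (cases x; simp)+

definition long_run where
  "long_run u y = real_of_ereal (Limsup at_top (\<lambda>t. ereal (1 / t * integral {0..t} (cost u y))))"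

lemma weighted_term:
  assumes y: "y \<in> Y" and u: "u \<in> controls U" and \<rho>: "0 < \<rho>"
  shows "\<beta> * (LINT s:{0..}|lborel. \<rho> * exp (- \<rho> * s) * running_cost f g u y s) +
        (1 - \<beta>) * real_of_ereal (Limsup at_top (\<lambda>t. ereal (1 / t * (LINT s:{0..t}|lborel. running_cost f g u y s))))
     = \<beta> * (LINT t|abel \<rho>. cost u y t) + (1 - \<beta>) * long_run u y"
proof -
  have "(LINT s:{0..}|lborel. \<rho> * exp (- \<rho> * s) * running_cost f g u y s) = (LINT t|abel \<rho>. cost u y t)"
    unfolding integral_abel[OF \<rho> cost_measurable[OF y u]]
    by (rule set_lebesgue_integral_cong) (auto simp: running_cost_eq[OF u])
  moreover have "(LINT s:{0..t}|lborel. running_cost f g u y s) = integral {0..t} (cost u y)" for t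
  proof -
    have "(LINT s:{0..t}|lborel. running_cost f g u y s) = (LINT s:{0..t}|lborel. cost u y s)"
      by (rule set_lebesgue_integral_cong) (auto simp: running_cost_eq[OF u])
    also have "\<dots> = integral {0..t} (cost u y)"
      by (rule set_borel_integral_eq_integral(2)[OF borel_integrable_atLeastAtMost'])
        (rule continuous_on_subset[OF cost_continuous[OF y u]], auto)
    finally show ?thesis .
  qed
  ultimately show ?thesis unfolding long_run_def by simp
qed

lemma long_run_bounds:
  assumes y: "y \<in> Y" and u: "u \<in> controls U"
    and a: "\<forall>\<^sub>F t in at_top. a \<le> 1 / t * integral {0..t} (cost u y)"
    and b: "\<forall>\<^sub>F t in at_top. 1 / t * integral {0..t} (cost u y) \<le> b"
  shows "a \<le> long_run u y" "long_run u y \<le> b"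
proof -
  have 1: "ereal a \<le> Limsup at_top (\<lambda>t. ereal (1 / t * integral {0..t} (cost u y)))"
    by (rule le_Limsup) (use a in auto)
  have 2: "Limsup at_top (\<lambda>t. ereal (1 / t * integral {0..t} (cost u y))) \<le> ereal b"
    by (rule Limsup_bounded) (use b in auto)
  show "a \<le> long_run u y" "long_run u y \<le> b"
    unfolding long_run_def by (rule real_of_ereal_between[OF 1 2])+
qed

lemma average_bound:
  assumes "y \<in> Y" "u \<in> controls U" "0 < t"
  shows "\<bar>1 / t * integral {0..t} (cost u y)\<bar> \<le> M"
  using integral_cost_abs[OF assms(1,2), of 0 t] assms(3) by (simp add: abs_mult field_simps)

text \<open>
  Each control has Abel and Cesaro means of at least \<open>V\<^sup>* - e\<close>, and the control of \<open>pure_uniform\<close> has both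
  below \<open>V\<^sup>* + 2 e\<close>.
\<close>

theorem weighted_limit:
  assumes \<beta>: "\<beta> \<in> {0<..<1}" and y: "y \<in> Y"
  shows "((\<lambda>\<rho>. weighted_value U f g \<rho> \<beta> y) \<longlongrightarrow> Vs y) (at_right 0)"
proof (rule tendstoI)
  fix e0 :: real assume e0: "0 < e0"
  define e where "e = e0 / 4"
  have e: "0 < e" using e0 by (simp add: e_def)
  obtain \<eta> S where S: "0 < \<eta>" "0 < S"
    "\<And>\<theta> y. \<theta> \<in> evaluations \<Longrightarrow> (\<And>s. 0 \<le> s \<Longrightarrow> s \<le> S \<Longrightarrow> TV s \<theta> \<le> \<eta>) \<Longrightarrow> y \<in> Y \<Longrightarrow> \<bar>V \<theta> y - Vs y\<bar> \<le> e"
    using limit_value_uniform[OF e] by blast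
  obtain u0 K where u0: "0 \<le> K" "u0 \<in> controls U"
    and "\<forall>t\<ge>0. integral {0..t} (cost u0 y) \<le> t * (Vs y + e) + K"
    by (rule pure_uniform[OF y e]) (rule that, assumption+)
  then have u0_le: "integral {0..t} (cost u0 y) \<le> t * (Vs y + e) + K" if "0 \<le> t" for t using that by blast
  have evb: "\<forall>\<^sub>F t in at_top. \<bar>1 / t * integral {0..t} (cost u y)\<bar> \<le> M" if "u \<in> controls U" for u
    by (rule eventually_mono[OF eventually_gt_at_top[of 0]]) (rule average_bound[OF y that])
  have low_run: "Vs y - e \<le> long_run u y" if u: "u \<in> controls U" for u
  proof (rule long_run_bounds(1)[OF y u])
    show "\<forall>\<^sub>F t in at_top. 1 / t * integral {0..t} (cost u y) \<le> M" using evb[OF u] by eventually_elim linarith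
    show "\<forall>\<^sub>F t in at_top. Vs y - e \<le> 1 / t * integral {0..t} (cost u y)"
      using eventually_ge_at_top[of "S / \<eta>"] eventually_gt_at_top[of 0]
    proof eventually_elim
      case (elim T)
      have "\<bar>V (cesaro T) y - Vs y\<bar> \<le> e"
      proof (rule S(3)[OF cesaro_evaluation[OF elim(2)] _ y])
        fix s assume s: "0 \<le> s" "s \<le> S"
        have "TV s (cesaro T) \<le> s / T" by (rule TV_cesaro[OF elim(2) s(1)])
        also have "\<dots> \<le> S / T" using s elim by (simp add: divide_right_mono)
        also have "\<dots> \<le> \<eta>" using elim S by (simp add: field_simps)
        finally show "TV s (cesaro T) \<le> \<eta>" .
      qed
      then show ?case using V_le[OF cesaro_evaluation[OF elim(2)] u, of y] cesaro_cost[OF elim(2) y u] by simp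
    qed
  qed
  have up_run: "long_run u0 y \<le> Vs y + 2 * e"
  proof (rule long_run_bounds(2)[OF y u0(2)])
    show "\<forall>\<^sub>F t in at_top. - M \<le> 1 / t * integral {0..t} (cost u0 y)" using evb[OF u0(2)] by eventually_elim linarith
    show "\<forall>\<^sub>F t in at_top. 1 / t * integral {0..t} (cost u0 y) \<le> Vs y + 2 * e"
      using eventually_ge_at_top[of "K / e"] eventually_gt_at_top[of 0]
    proof eventually_elim
      case (elim t)
      then have "K \<le> t * e" using e by (simp add: field_simps)
      then have "integral {0..t} (cost u0 y) \<le> t * (Vs y + 2 * e)" using u0_le[of t] elim by (simp add: algebra_simps)
      then show ?case using elim by (simp add: field_simps)
    qed
  qed
  have "\<forall>\<^sub>F \<rho> in at_right 0. \<rho> < min (\<eta> / S) (e / (K + 1))"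
    by (rule order_tendstoD) (use S e u0 in \<open>auto intro!: tendsto_eq_intros\<close>)
  moreover have "\<forall>\<^sub>F \<rho> in at_right (0::real). 0 < \<rho>" by (rule eventually_at_right_less)
  ultimately show "\<forall>\<^sub>F \<rho> in at_right 0. dist (weighted_value U f g \<rho> \<beta> y) (Vs y) < e0"
  proof eventually_elim
    case (elim \<rho>)
    then have \<rho>: "0 < \<rho>" "\<rho> < \<eta> / S" "\<rho> < e / (K + 1)" by auto
    have low_abel: "Vs y - e \<le> (LINT t|abel \<rho>. cost u y t)" if u: "u \<in> controls U" for u
    proof -
      have "\<bar>V (abel \<rho>) y - Vs y\<bar> \<le> e"
      proof (rule S(3)[OF abel_evaluation[OF \<rho>(1)] _ y])
        fix s assume s: "0 \<le> s" "s \<le> S"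
        have "TV s (abel \<rho>) \<le> s * \<rho>" by (rule TV_abel[OF \<rho>(1) s(1)])
        also have "\<dots> \<le> S * \<rho>" using s \<rho> by simp
        also have "\<dots> \<le> \<eta>" using \<rho>(2) S by (simp add: field_simps)
        finally show "TV s (abel \<rho>) \<le> \<eta>" .
      qed
      then show ?thesis using V_le[OF abel_evaluation[OF \<rho>(1)] u, of y] by simp
    qed
    have low: "Vs y - e \<le> \<beta> * (LINT t|abel \<rho>. cost u y t) + (1 - \<beta>) * long_run u y" if u: "u \<in> controls U" for u
    proof -
      have "\<beta> * (Vs y - e) \<le> \<beta> * (LINT t|abel \<rho>. cost u y t)" using low_abel[OF u] \<beta> by simp
      moreover have "(1 - \<beta>) * (Vs y - e) \<le> (1 - \<beta>) * long_run u y" using low_run[OF u] \<beta> by simp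
      ultimately show ?thesis by (simp add: algebra_simps)
    qed
    have eq: "weighted_value U f g \<rho> \<beta> y = (INF u\<in>controls U. \<beta> * (LINT t|abel \<rho>. cost u y t) + (1 - \<beta>) * long_run u y)"
      unfolding weighted_value_def by (rule INF_cong[OF refl]) (rule weighted_term[OF y _ \<rho>(1)])
    have "Vs y - e \<le> weighted_value U f g \<rho> \<beta> y"
      unfolding eq by (rule cINF_greatest[OF controls_nonempty low])
    moreover have "weighted_value U f g \<rho> \<beta> y \<le> Vs y + 2 * e"
    proof -
      have "weighted_value U f g \<rho> \<beta> y \<le> \<beta> * (LINT t|abel \<rho>. cost u0 y t) + (1 - \<beta>) * long_run u0 y"
        unfolding eq by (rule cINF_lower[OF bdd_belowI2[OF low] u0(2)])
      also have "\<dots> \<le> \<beta> * (Vs y + 2 * e) + (1 - \<beta>) * (Vs y + 2 * e)"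
      proof (rule add_mono)
        have "(LINT t|abel \<rho>. cost u0 y t) \<le> (Vs y + e) + \<rho> * K"
          by (rule abel_integral_le[OF cost_continuous[OF y u0(2)] G_bound u0_le \<rho>(1)])
        also have "\<rho> * K \<le> e"
        proof -
          have "\<rho> * K \<le> \<rho> * (K + 1)" using \<rho> by simp
          also have "\<dots> \<le> e" using \<rho>(3) u0(1) by (simp add: field_simps)
          finally show ?thesis .
        qed
        finally have "(LINT t|abel \<rho>. cost u0 y t) \<le> Vs y + 2 * e" by simp
        then show "\<beta> * (LINT t|abel \<rho>. cost u0 y t) \<le> \<beta> * (Vs y + 2 * e)" using \<beta> by simp
        show "(1 - \<beta>) * long_run u0 y \<le> (1 - \<beta>) * (Vs y + 2 * e)" using up_run \<beta> by simp
      qed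
      also have "\<dots> = Vs y + 2 * e" by (simp add: algebra_simps)
      finally show ?thesis .
    qed
    ultimately show ?case using e0 by (simp add: dist_real_def e_def abs_less_iff)
  qed
qed

end

section \<open>A random control that is good for all regular evaluations\<close>

context fine_grid
begin

text \<open>
  The feedback by which a path from another state shadows the path with digits \<open>s\<close> from \<open>z\<close>;
  \<open>follow_digits\<close> lists the digits that it plays.
\<close>

definition policy where "policy z s k x = sel k (path s z (\<tau> k), x)"

definition follow_digits where "follow_digits z s y k = policy z s k (run (policy z s) y k)"

lemma follow_close:
  assumes Y: "z \<in> Y" "y \<in> Y" and near: "norm (z - y) \<le> h" and t: "0 \<le> t"
  shows "\<bar>G (path (follow_digits z s y) y t) - G (path s z t)\<bar> \<le> \<epsilon>"
proof -
  let ?\<sigma> = "follow_digits z s y"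
  have e: "?\<sigma> = (\<lambda>k. policy z s k (run (policy z s) y k))" by (rule ext) (simp add: follow_digits_def)
  have "path ?\<sigma> y (\<tau> k) = run (policy z s) y k" for k unfolding e by (rule path_run)
  then have "?\<sigma> k = sel k (path s z (\<tau> k - \<tau> 0), path ?\<sigma> y (\<tau> k))" for k
    by (simp add: follow_digits_def policy_def)
  from shadow[OF Y ctrl_in_controls this t]
  have "norm (path s z t - path ?\<sigma> y t) \<le> norm (z - y) + err" by (simp add: trajectory_0[OF ctrl_in_controls])
  then have n: "norm (path s z t - path ?\<sigma> y t) \<le> (2 * sqrt (2 * C) + A + 2) * h" using near fine_bounds(1) by linarith
  have "\<bar>G (path s z t) - G (path ?\<sigma> y t)\<bar> \<le> \<epsilon>"
    by (rule fine[OF trajectory_in_Y[OF Y(1) ctrl_in_controls t] trajectory_in_Y[OF Y(2) ctrl_in_controls t] n])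
  then show ?thesis by (simp add: abs_minus_commute)
qed

lemma \<tau>_less_imp: "\<tau> i < \<tau> k \<Longrightarrow> i < k"
  using \<tau>_mono[of k i] by (cases "i < k") auto

lemma policy_dep: "(\<And>i. i < k \<Longrightarrow> s i = s' i) \<Longrightarrow> policy z s k x = policy z s' k x"
  unfolding policy_def using path_cong[of "\<tau> k" s s' z] \<tau>_less_imp \<tau>_nonneg[of k] by (metis (no_types, lifting))

lemma run_dep:
  assumes "\<And>i. i < k \<Longrightarrow> s i = s' i"
  shows "run (policy z s) y k = run (policy z s') y k"
  using assms
proof (induction k)
  case (Suc k)
  have r: "run (policy z s) y k = run (policy z s') y k" by (rule Suc.IH) (use Suc.prems in simp)
  have "policy z s k x = policy z s' k x" for x by (rule policy_dep) (use Suc.prems in simp)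
  then show ?case by (simp add: r)
qed simp

lemma follow_digits_dep: "(\<And>i. i < k \<Longrightarrow> s i = s' i) \<Longrightarrow> follow_digits z s y k = follow_digits z s' y k"
  unfolding follow_digits_def using run_dep[of k s s' z y] policy_dep[of k s s' z] by simp

lemma flow_continuous:
  assumes "u \<in> controls U" "0 \<le> t"
  shows "continuous_on UNIV (\<lambda>x. trajectory f u x t)"
proof (rule continuous_on_iff[THEN iffD2], intro ballI allI impI)
  fix x :: 'a and e :: real assume e: "0 < e"
  show "\<exists>d>0. \<forall>x'\<in>UNIV. dist x' x < d \<longrightarrow> dist (trajectory f u x' t) (trajectory f u x t) < e"
  proof (intro exI conjI ballI impI)
    show "0 < e / exp (L * t)" using e by simp
    fix x' assume "dist x' x < e / exp (L * t)"
    then have "norm (x' - x) * exp (L * t) < e" by (simp add: dist_norm pos_less_divide_eq)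
    then show "dist (trajectory f u x' t) (trajectory f u x t) < e"
      using trajectory_dist[OF assms(1,1) refl assms(2), of x' x] by (simp add: dist_norm)
  qed
qed

lemma policy_measurable: "policy z s k \<in> borel \<rightarrow>\<^sub>M count_space UNIV"
proof -
  have "(\<lambda>x. (path s z (\<tau> k), x)) \<in> borel \<rightarrow>\<^sub>M borel"
    by (intro borel_measurable_continuous_onI continuous_intros)
  from measurable_compose[OF this sel_measurable[of k]] show ?thesis
    by (simp add: policy_def[abs_def])
qed

lemma run_measurable: "(\<lambda>y. run (policy z s) y k) \<in> borel \<rightarrow>\<^sub>M borel"
proof (induction k)
  case (Suc k)
  have "(\<lambda>x. trajectory f (\<lambda>_. B k i) x (step k)) \<in> borel \<rightarrow>\<^sub>M borel" for i
    by (rule borel_measurable_continuous_onI[OF flow_continuous[OF const_in_controls[OF B_in]]]) (use step_pos[of k] in simp)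
  then have "(\<lambda>x. (\<lambda>i x. trajectory f (\<lambda>_. B k i) x (step k)) (policy z s k x) x) \<in> borel \<rightarrow>\<^sub>M borel"
    by (rule measurable_compose_countable[OF _ policy_measurable])
  from measurable_compose[OF Suc.IH this] show ?case by simp
qed simp

lemma follow_digits_measurable: "(\<lambda>y. follow_digits z s y k) \<in> borel \<rightarrow>\<^sub>M count_space UNIV"
  unfolding follow_digits_def by (rule measurable_compose[OF run_measurable policy_measurable])

text \<open>
  One digit sequence codes reference paths for all points \<open>j\<close> of a finite net: the digit with index
  \<open>prod_encode (j, Suc n)\<close> is the \<open>n\<close>-th digit of the path for \<open>j\<close>, and the digit with index
  \<open>prod_encode (j, 0)\<close> selects its delay.
\<close>

definition row where "row d j n = d (prod_encode (j, Suc n))" for d :: "nat \<Rightarrow> nat"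

text \<open>
  All digits that matter for row \<open>j\<close> up to position \<open>c\<close> have an index below this bound.
\<close>

definition row_bound :: "nat \<Rightarrow> nat \<Rightarrow> nat" where
  "row_bound j c = Suc (Max ((\<lambda>n. prod_encode (j, n)) ` {..Suc c}))"

lemma row_bound: "n \<le> Suc c \<Longrightarrow> prod_encode (j, n) < row_bound j c"
  unfolding row_bound_def by (intro le_imp_less_Suc Max_ge) auto

lemma row_dep:
  assumes "\<And>i. i < row_bound j c \<Longrightarrow> d i = d' i"
  shows "n \<le> c \<Longrightarrow> row d j n = row d' j n" "d (prod_encode (j, 0)) = d' (prod_encode (j, 0))"
  unfolding row_def using assms row_bound by auto

definition reference_cost :: "'a \<Rightarrow> (nat \<Rightarrow> nat) \<Rightarrow> nat \<Rightarrow> (nat \<Rightarrow> nat) \<Rightarrow> real \<Rightarrow> real" where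
  "reference_cost z ks j d t = G (path (row d j) z (t + \<tau> (ks (d (prod_encode (j, 0))))))"

lemma reference_cost_dep:
  assumes d: "\<And>i. i < row_bound j (cell (t + S)) \<Longrightarrow> d i = d' i" and S: "\<And>k. \<tau> (ks k) \<le> S" and t: "0 \<le> t"
  shows "reference_cost z ks j d t = reference_cost z ks j d' t"
proof -
  let ?k = "ks (d (prod_encode (j, 0)))"
  have le: "cell (t + \<tau> ?k) \<le> cell (t + S)" using S t \<tau>_nonneg[of ?k] by (intro cell_mono) auto
  have "path (row d j) z (t + \<tau> ?k) = path (row d' j) z (t + \<tau> ?k)"
  proof (rule path_dep)
    fix k assume "k < Suc (cell (t + \<tau> ?k))"
    then show "row d j k = row d' j k" using le by (intro row_dep(1)[OF d]) auto
  qed (use t \<tau>_nonneg[of ?k] in simp)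
  moreover have "ks (d (prod_encode (j, 0))) = ks (d' (prod_encode (j, 0)))"
    by (rule arg_cong[of _ _ ks]) (rule row_dep(2)[OF d])
  ultimately show ?thesis by (simp add: reference_cost_def)
qed

lemma integrable_on_digits:
  fixes \<Lambda> :: "real measure" and dig :: "real \<Rightarrow> nat \<Rightarrow> nat" and n :: "real \<Rightarrow> nat"
    and \<Phi> :: "(nat \<Rightarrow> nat) \<Rightarrow> real \<Rightarrow> real"
  assumes \<Lambda>: "prob_space \<Lambda>" "sets \<Lambda> = sets borel" and dig: "\<And>k. (\<lambda>w. dig w k) \<in> borel \<rightarrow>\<^sub>M count_space UNIV"
    and \<theta>: "\<theta> \<in> evaluations" and n: "n \<in> borel \<rightarrow>\<^sub>M count_space UNIV"
    and \<Phi>: "\<And>D. \<Phi> D \<in> borel_measurable half_line" "\<And>D t. \<bar>\<Phi> D t\<bar> \<le> M"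
    and dep: "\<And>t D D'. 0 \<le> t \<Longrightarrow> (\<And>i. i < n t \<Longrightarrow> D i = D' i) \<Longrightarrow> \<Phi> D t = \<Phi> D' t"
  shows "integrable (\<Lambda> \<Otimes>\<^sub>M \<theta>) (\<lambda>(w, t). \<Phi> (dig w) t)"
proof -
  interpret P: prob_space \<Lambda> by (rule \<Lambda>(1))
  interpret Q: prob_space \<theta> by (rule evaluationsD(1)[OF \<theta>])
  interpret PQ: pair_prob_space \<Lambda> \<theta> ..
  have sp: "snd z \<in> {0..}" if "z \<in> space (\<Lambda> \<Otimes>\<^sub>M \<theta>)" for z
    using measurable_space[OF measurable_snd that] unfolding evaluationsD(3)[OF \<theta>] .
  have snd1: "snd \<in> \<Lambda> \<Otimes>\<^sub>M \<theta> \<rightarrow>\<^sub>M half_line"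
    using measurable_snd[of \<Lambda> \<theta>] measurable_cong_sets[OF refl evaluationsD(2)[OF \<theta>]] by blast
  have snd2: "snd \<in> \<Lambda> \<Otimes>\<^sub>M \<theta> \<rightarrow>\<^sub>M borel"
    by (rule measurable_compose[OF snd1 measurable_restrict_space1]) simp
  have fst1: "fst \<in> \<Lambda> \<Otimes>\<^sub>M \<theta> \<rightarrow>\<^sub>M borel"
    using measurable_fst[of \<Lambda> \<theta>] measurable_cong_sets[OF refl \<Lambda>(2)] by blast
  have "(\<lambda>z. \<Phi> (dig (fst z)) (snd z)) \<in> borel_measurable (\<Lambda> \<Otimes>\<^sub>M \<theta>)"
  proof (rule digits_measurable[where w=fst and n="\<lambda>z. n (snd z)" and \<Phi>="\<lambda>D z. \<Phi> D (snd z)"])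
    show "(\<lambda>z. dig (fst z) k) \<in> \<Lambda> \<Otimes>\<^sub>M \<theta> \<rightarrow>\<^sub>M count_space UNIV" for k by (rule measurable_compose[OF fst1 dig])
    show "(\<lambda>z. n (snd z)) \<in> \<Lambda> \<Otimes>\<^sub>M \<theta> \<rightarrow>\<^sub>M count_space UNIV" by (rule measurable_compose[OF snd2 n])
    show "(\<lambda>z. \<Phi> D (snd z)) \<in> borel_measurable (\<Lambda> \<Otimes>\<^sub>M \<theta>)" for D by (rule measurable_compose[OF snd1 \<Phi>(1)])
    show "\<Phi> D (snd z) = \<Phi> D' (snd z)" if "z \<in> space (\<Lambda> \<Otimes>\<^sub>M \<theta>)" "\<And>k. k < n (snd z) \<Longrightarrow> D k = D' k" for z D D'
      by (rule dep) (use sp[OF that(1)] that(2) in auto)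
  qed
  then show ?thesis
    by (intro PQ.integrable_const_bound[where B=M]) (auto simp: split_def \<Phi>(2))
qed

text \<open>
  The cost varies by at most \<open>\<epsilon>\<close> over a time of length \<open>h\<close>, so its samples at distance \<open>h\<close> sum up
  like its integral.
\<close>

lemma sampled_average:
  assumes y: "y \<in> Y" and u: "u \<in> controls U" and t: "0 \<le> t"
  shows "h * (\<Sum>r<n. cost u y (t + real r * h)) \<le> integral {t..t + real n * h} (cost u y) + real n * h * \<epsilon>"
proof (induction n)
  case (Suc n)
  let ?a = "t + real n * h"
  have a: "0 \<le> ?a" using t h_pos by simp
  have "integral {?a..?a + h} (\<lambda>_. cost u y ?a - \<epsilon>) \<le> integral {?a..?a + h} (cost u y)"
  proof (rule integral_le[OF integrable_const_ivl cost_integrable[OF y u a]])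
    fix r assume r: "r \<in> {?a..?a + h}"
    have "norm (trajectory f u y ?a - trajectory f u y r) \<le> A * \<bar>?a - r\<bar>"
      by (rule trajectory_lipschitz[OF y u]) (use a r in auto)
    also have "\<dots> \<le> A * h" using r A_pos by (intro mult_left_mono) auto
    also have "\<dots> \<le> (2 * sqrt (2 * C) + A + 2) * h" using h_pos C_pos by (intro mult_right_mono) auto
    finally have "\<bar>cost u y ?a - cost u y r\<bar> \<le> \<epsilon>"
      by (intro fine trajectory_in_Y[OF y u]) (use a r in auto)
    then show "cost u y ?a - \<epsilon> \<le> cost u y r" by (simp add: abs_le_iff)
  qed
  then have "h * (cost u y ?a - \<epsilon>) \<le> integral {?a..?a + h} (cost u y)" using h_pos by simp
  moreover have "integral {t..?a + h} (cost u y) = integral {t..?a} (cost u y) + integral {?a..?a + h} (cost u y)"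
    using t h_pos by (intro integral_cost_combine[OF y u]) auto
  moreover have "t + real (Suc n) * h = ?a + h" by (simp add: algebra_simps)
  ultimately show ?case using Suc by (simp add: algebra_simps)
qed simp

lemma sampled_average_eventually:
  assumes y: "y \<in> Y" and u: "u \<in> controls U" and t: "0 \<le> t" and K: "0 \<le> K"
    and le: "\<And>t. 0 \<le> t \<Longrightarrow> integral {0..t} (cost u y) \<le> t * (c + \<epsilon>) + K" and c: "\<bar>c\<bar> \<le> M"
  shows "\<forall>\<^sub>F N in sequentially. (\<Sum>r<Suc N. cost u y (t + real r * h)) / real (Suc N) \<le> c + 3 * \<epsilon>"
proof -
  define Q where "Q = t * (2 * M + \<epsilon>) + K"
  have Q: "0 \<le> Q" using t M_pos eps_pos K by (simp add: Q_def)
  obtain N0 where N0: "Q / (h * \<epsilon>) \<le> real N0" using real_arch_simple by blast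
  have "(\<Sum>r<Suc N. cost u y (t + real r * h)) / real (Suc N) \<le> c + 3 * \<epsilon>" if N: "N0 \<le> N" for N
  proof -
    define n where "n = Suc N"
    have n: "0 < real n" by (simp add: n_def)
    have "Q / (h * \<epsilon>) \<le> real n" using N0 N by (simp add: n_def)
    then have Qn: "Q \<le> real n * h * \<epsilon>" using h_pos eps_pos by (simp add: field_simps)
    have "integral {0..t + real n * h} (cost u y) = integral {0..t} (cost u y) + integral {t..t + real n * h} (cost u y)"
      using t h_pos by (intro integral_cost_combine[OF y u]) auto
    moreover have "integral {0..t + real n * h} (cost u y) \<le> (t + real n * h) * (c + \<epsilon>) + K"
      by (rule le) (use t h_pos in auto)
    moreover have "\<bar>integral {0..t} (cost u y)\<bar> \<le> M * t" using integral_cost_abs[OF y u, of 0 t] t by simp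
    moreover have "t * c \<le> t * M" using t c by (intro mult_left_mono) auto
    ultimately have "integral {t..t + real n * h} (cost u y) \<le> real n * h * (c + \<epsilon>) + Q"
      unfolding Q_def by (simp add: algebra_simps abs_le_iff)
    with sampled_average[OF y u t, of n] Qn
    have "h * (\<Sum>r<n. cost u y (t + real r * h)) \<le> real n * h * (c + 3 * \<epsilon>)" by (simp add: algebra_simps)
    then have "h * (\<Sum>r<n. cost u y (t + real r * h)) \<le> h * (real n * (c + 3 * \<epsilon>))" by (simp add: mult_ac)
    then have "(\<Sum>r<n. cost u y (t + real r * h)) \<le> real n * (c + 3 * \<epsilon>)" using h_pos by simp
    then show ?thesis using n unfolding n_def by (simp add: pos_divide_le_eq mult.commute)
  qed
  then show ?thesis by (auto simp: eventually_sequentially)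
qed

text \<open>
  At level \<open>N\<close> the control of \<open>pure_uniform\<close> is restarted at the times \<open>r h\<close> with \<open>r \<le> N\<close>, each
  with the same probability. The digits \<open>X r\<close> code, for all \<open>j\<close> at once, a delayed grid path that
  follows the restarted one. The expected cost at time \<open>t\<close> is then an average of samples of one
  trajectory over a long time interval, and \<open>limit_law\<close> lets \<open>N\<close> tend to infinity.
\<close>

lemma reference_law:
  assumes ys: "\<And>j. j < J \<Longrightarrow> ys j \<in> Y"
  obtains ks :: "nat \<Rightarrow> nat \<Rightarrow> nat" and S and \<Lambda> :: "real measure" and dig
  where "0 < S" "\<And>j k. \<tau> (ks j k) \<le> S"
    "prob_space \<Lambda>" "sets \<Lambda> = sets borel" "\<And>k. (\<lambda>w. dig w k) \<in> borel \<rightarrow>\<^sub>M count_space UNIV"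
    "\<forall>j<J. \<forall>t\<ge>0. (LINT w|\<Lambda>. reference_cost (ys j) (ks j) j (dig w) t) \<le> Vs (ys j) + 4 * \<epsilon>"
proof -
  have "\<forall>j. \<exists>l :: nat list. j < J \<longrightarrow> (\<forall>s u. 0 \<le> s \<longrightarrow> u \<in> controls U \<longrightarrow>
     (\<exists>k\<in>set l. \<exists>\<sigma>. admissible \<sigma> \<and> (\<forall>t\<ge>0. \<bar>cost u (ys j) (t + s) - G (path \<sigma> (ys j) (t + \<tau> k))\<bar> \<le> \<epsilon>)))"
  proof
    fix j show "\<exists>l :: nat list. j < J \<longrightarrow> (\<forall>s u. 0 \<le> s \<longrightarrow> u \<in> controls U \<longrightarrow>
     (\<exists>k\<in>set l. \<exists>\<sigma>. admissible \<sigma> \<and> (\<forall>t\<ge>0. \<bar>cost u (ys j) (t + s) - G (path \<sigma> (ys j) (t + \<tau> k))\<bar> \<le> \<epsilon>)))"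
    proof (cases "j < J")
      case True
      obtain F where F: "finite F" "\<And>s u. 0 \<le> s \<Longrightarrow> u \<in> controls U \<Longrightarrow>
        \<exists>k\<in>F. \<exists>\<sigma>. admissible \<sigma> \<and> (\<forall>t\<ge>0. \<bar>cost u (ys j) (t + s) - G (path \<sigma> (ys j) (t + \<tau> k))\<bar> \<le> \<epsilon>)"
        using cost_finitely_many_shifts[OF ys[OF True]] by blast
      obtain l where "set l = F" using finite_list[OF F(1)] by blast
      then show ?thesis using F(2) by (intro exI[of _ l]) simp
    qed simp
  qed
  from choice[OF this] obtain kl where kl: "\<forall>j. j < J \<longrightarrow> (\<forall>s u. 0 \<le> s \<longrightarrow> u \<in> controls U \<longrightarrow>
     (\<exists>k\<in>set (kl j). \<exists>\<sigma>. admissible \<sigma> \<and> (\<forall>t\<ge>0. \<bar>cost u (ys j) (t + s) - G (path \<sigma> (ys j) (t + \<tau> k))\<bar> \<le> \<epsilon>)))" ..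
  have "\<forall>j. \<exists>z. j < J \<longrightarrow> fst z \<in> controls U \<and> 0 \<le> snd z \<and>
     (\<forall>t\<ge>0. integral {0..t} (cost (fst z) (ys j)) \<le> t * (Vs (ys j) + \<epsilon>) + snd z)"
  proof
    fix j show "\<exists>z. j < J \<longrightarrow> fst z \<in> controls U \<and> 0 \<le> snd z \<and>
     (\<forall>t\<ge>0. integral {0..t} (cost (fst z) (ys j)) \<le> t * (Vs (ys j) + \<epsilon>) + snd z)"
    proof (cases "j < J")
      case True
      obtain u K where "0 \<le> K" "u \<in> controls U" "\<forall>t\<ge>0. integral {0..t} (cost u (ys j)) \<le> t * (Vs (ys j) + \<epsilon>) + K"
        by (rule pure_uniform[OF ys[OF True] eps_pos]) (rule that, assumption+)
      then show ?thesis by (intro exI[of _ "(u, K)"]) simp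
    qed simp
  qed
  from choice[OF this] obtain z where z: "\<forall>j. j < J \<longrightarrow> fst (z j) \<in> controls U \<and> 0 \<le> snd (z j) \<and>
     (\<forall>t\<ge>0. integral {0..t} (cost (fst (z j)) (ys j)) \<le> t * (Vs (ys j) + \<epsilon>) + snd (z j))" ..
  have "\<forall>q. \<exists>p. snd q < J \<longrightarrow> fst p < length (kl (snd q)) \<and> admissible (snd p) \<and>
     (\<forall>t\<ge>0. \<bar>cost (fst (z (snd q))) (ys (snd q)) (t + real (fst q) * h) - G (path (snd p) (ys (snd q)) (t + \<tau> (kl (snd q) ! fst p)))\<bar> \<le> \<epsilon>)"
  proof
    fix q :: "nat \<times> nat"
    show "\<exists>p. snd q < J \<longrightarrow> fst p < length (kl (snd q)) \<and> admissible (snd p) \<and>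
     (\<forall>t\<ge>0. \<bar>cost (fst (z (snd q))) (ys (snd q)) (t + real (fst q) * h) - G (path (snd p) (ys (snd q)) (t + \<tau> (kl (snd q) ! fst p)))\<bar> \<le> \<epsilon>)"
    proof (cases "snd q < J")
      case True
      have "0 \<le> real (fst q) * h" "fst (z (snd q)) \<in> controls U" using h_pos z True by auto
      then obtain k \<sigma> where k: "k \<in> set (kl (snd q))" "admissible \<sigma>"
        "\<forall>t\<ge>0. \<bar>cost (fst (z (snd q))) (ys (snd q)) (t + real (fst q) * h) - G (path \<sigma> (ys (snd q)) (t + \<tau> k))\<bar> \<le> \<epsilon>"
        using kl True by blast
      obtain i where i: "i < length (kl (snd q))" "kl (snd q) ! i = k" using k(1) by (meson in_set_conv_nth)
      show ?thesis using k(2,3) i by (intro exI[of _ "(i, \<sigma>)"]) simp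
    qed simp
  qed
  from choice[OF this] obtain p where p: "\<forall>q. snd q < J \<longrightarrow> fst (p q) < length (kl (snd q)) \<and> admissible (snd (p q)) \<and>
     (\<forall>t\<ge>0. \<bar>cost (fst (z (snd q))) (ys (snd q)) (t + real (fst q) * h) - G (path (snd (p q)) (ys (snd q)) (t + \<tau> (kl (snd q) ! fst (p q))))\<bar> \<le> \<epsilon>)" ..
  define ks where "ks j k = (if j < J \<and> k < length (kl j) then kl j ! k else 0)" for j k
  define S where "S = Max (insert 1 (\<tau> ` (\<Union>j<J. set (kl j))))"
  have fin: "finite (insert 1 (\<tau> ` (\<Union>j<J. set (kl j))))" by simp
  have S0: "1 \<le> S" unfolding S_def by (rule Max_ge[OF fin]) simp
  have S: "\<tau> (ks j k) \<le> S" for j k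
  proof (cases "j < J \<and> k < length (kl j)")
    case True
    then have "kl j ! k \<in> (\<Union>j<J. set (kl j))" using nth_mem by blast
    then have "\<tau> (kl j ! k) \<in> insert 1 (\<tau> ` (\<Union>j<J. set (kl j)))" by (intro insertI2 imageI)
    then have "\<tau> (kl j ! k) \<le> S" unfolding S_def by (rule Max_ge[OF fin])
    then show ?thesis using True by (simp add: ks_def)
  next
    case False
    then have "ks j k = 0" by (auto simp: ks_def)
    then show ?thesis using S0 by simp
  qed
  \<comment> \<open>Rows beyond \<open>J\<close> carry no information and get the only digit 0.\<close>
  define m where "m i = (case prod_decode i of (j, n) \<Rightarrow> if j < J then (case n of 0 \<Rightarrow> length (kl j) | Suc n' \<Rightarrow> digits n') else 1)" for i
  define X where "X r i = (case prod_decode i of (j, n) \<Rightarrow> if j < J then (case n of 0 \<Rightarrow> fst (p (r, j)) | Suc n' \<Rightarrow> snd (p (r, j)) n') else 0)" for r i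
  have Xm: "X r i < m i" for r i
    using p[rule_format, of "(r, fst (prod_decode i))"]
    by (auto simp: X_def m_def admissible_def split: prod.split nat.split)
  have m0: "0 < m i" for i using Xm[of 0 i] by linarith
  have Xrow: "row (X r) j = snd (p (r, j))" "ks j (X r (prod_encode (j, 0))) = kl j ! fst (p (r, j))" if "j < J" for r j
    using that p[rule_format, of "(r, j)"] by (auto simp: row_def X_def ks_def fun_eq_iff)
  obtain \<Lambda> :: "real measure" and dig where \<Lambda>: "prob_space \<Lambda>" "sets \<Lambda> = sets borel"
    and dig: "\<And>k. (\<lambda>w. dig w k) \<in> borel \<rightarrow>\<^sub>M count_space UNIV" "\<And>w k. dig w k < m k"
    and lim0: "\<forall>n H c. (\<forall>\<sigma> \<sigma>'. (\<forall>k<n. \<sigma> k = \<sigma>' k) \<longrightarrow> H \<sigma> = H \<sigma>') \<longrightarrow>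
      (\<forall>\<^sub>F N in sequentially. (\<Sum>r<Suc N. H (X r)) / real (Suc N) \<le> (c :: real)) \<longrightarrow> (LINT w|\<Lambda>. H (dig w)) \<le> c"
    by (rule limit_law[of m Suc "\<lambda>N r. X r", OF m0 zero_less_Suc Xm]) (rule that, assumption+)
  have law: "(LINT w|\<Lambda>. reference_cost (ys j) (ks j) j (dig w) t) \<le> Vs (ys j) + 4 * \<epsilon>" if j: "j < J" and t: "0 \<le> t" for j t
  proof -
    define H where "H d = reference_cost (ys j) (ks j) j d t" for d
    have dep: "\<forall>d d'. (\<forall>k<row_bound j (cell (t + S)). d k = d' k) \<longrightarrow> H d = H d'"
      unfolding H_def by (intro allI impI reference_cost_dep[OF _ S t]) blast
    let ?u = "fst (z j)"
    have u: "?u \<in> controls U" "0 \<le> snd (z j)" "\<And>t. 0 \<le> t \<Longrightarrow> integral {0..t} (cost ?u (ys j)) \<le> t * (Vs (ys j) + \<epsilon>) + snd (z j)"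
      using z j by blast+
    have Vj: "\<bar>Vs (ys j)\<bar> \<le> M" using Vs_bounds[of "ys j"] by linarith
    have "\<forall>\<^sub>F N in sequentially. (\<Sum>r<Suc N. cost ?u (ys j) (t + real r * h)) / real (Suc N) \<le> Vs (ys j) + 3 * \<epsilon>"
      by (rule sampled_average_eventually[OF ys[OF j] u(1) t u(2) _ Vj]) (rule u(3))
    then have "\<forall>\<^sub>F N in sequentially. (\<Sum>r<Suc N. H (X r)) / real (Suc N) \<le> Vs (ys j) + 4 * \<epsilon>"
      unfolding H_def
    proof eventually_elim
      case (elim N)
      have "reference_cost (ys j) (ks j) j (X r) t \<le> cost ?u (ys j) (t + real r * h) + \<epsilon>" for r
      proof -
        have "\<bar>cost ?u (ys j) (t + real r * h) - G (path (snd (p (r, j))) (ys j) (t + \<tau> (kl j ! fst (p (r, j)))))\<bar> \<le> \<epsilon>"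
          using p[rule_format, of "(r, j)"] j t by simp
        then show ?thesis unfolding reference_cost_def Xrow[OF j] by linarith
      qed
      then have "(\<Sum>r<Suc N. reference_cost (ys j) (ks j) j (X r) t) \<le> (\<Sum>r<Suc N. cost ?u (ys j) (t + real r * h) + \<epsilon>)"
        by (intro sum_mono)
      also have "\<dots> = (\<Sum>r<Suc N. cost ?u (ys j) (t + real r * h)) + real (Suc N) * \<epsilon>"
        by (simp only: sum.distrib sum_constant card_lessThan)
      finally have "(\<Sum>r<Suc N. reference_cost (ys j) (ks j) j (X r) t) / real (Suc N)
          \<le> ((\<Sum>r<Suc N. cost ?u (ys j) (t + real r * h)) + real (Suc N) * \<epsilon>) / real (Suc N)"
        by (rule divide_right_mono) simp
      also have "\<dots> = (\<Sum>r<Suc N. cost ?u (ys j) (t + real r * h)) / real (Suc N) + \<epsilon>"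
        by (simp only: add_divide_distrib) simp
      finally show ?case using elim by linarith
    qed
    from mp[OF mp[OF spec[OF spec[OF spec[OF lim0]]] dep] this] show ?thesis unfolding H_def .
  qed
  show ?thesis
  proof (rule that[of S ks \<Lambda> dig])
    show "0 < S" using S0 by simp
    show "\<forall>j<J. \<forall>t\<ge>0. (LINT w|\<Lambda>. reference_cost (ys j) (ks j) j (dig w) t) \<le> Vs (ys j) + 4 * \<epsilon>"
      using law by blast
  qed (rule S \<Lambda> dig)+
qed

text \<open>
  From \<open>y\<close> one follows the random reference path of the net point close to \<open>y\<close>. The cost of that path at
  time \<open>t\<close> plus its delay has expectation at most \<open>V\<^sup>* + 4 \<epsilon>\<close>; the delay, the distance to the net point
  and the difference of the values of \<open>V\<^sup>*\<close> account for the other \<open>3 \<epsilon>\<close>.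
\<close>

theorem random_control_exists:
  shows "\<exists>S>0. \<exists>(\<Lambda> :: real measure) u. random_control U Y \<Lambda> u \<and>
    (\<forall>\<theta>\<in>evaluations. (\<forall>s. 0 \<le> s \<longrightarrow> s \<le> S \<longrightarrow> TV s \<theta> \<le> \<epsilon> / (4 * M)) \<longrightarrow>
      (\<forall>y\<in>Y. random_payoff f g \<theta> y \<Lambda> u \<le> Vs y + 7 * \<epsilon>))"
proof -
  obtain xs idx where xs: "set xs \<subseteq> Y" "idx \<in> borel \<rightarrow>\<^sub>M count_space UNIV"
    and idx: "\<And>z. z \<in> Y \<Longrightarrow> idx z < length xs \<and> dist (xs ! idx z) z < h"
    by (rule net_index[OF compact_Y h_pos]) (rule that, assumption+)
  have xsY: "j < length xs \<Longrightarrow> xs ! j \<in> Y" for j using xs(1) nth_mem by blast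
  obtain ks S and \<Lambda> :: "real measure" and dig where S: "0 < S" "\<And>j k. \<tau> (ks j k) \<le> S"
    and \<Lambda>: "prob_space \<Lambda>" "sets \<Lambda> = sets borel" and dig: "\<And>k. (\<lambda>w. dig w k) \<in> borel \<rightarrow>\<^sub>M count_space UNIV"
    and law0: "\<forall>j<length xs. \<forall>t\<ge>0. (LINT w|\<Lambda>. reference_cost (xs ! j) (ks j) j (dig w) t) \<le> Vs (xs ! j) + 4 * \<epsilon>"
    by (rule reference_law[of "length xs" "\<lambda>j. xs ! j", OF xsY]) (assumption, rule that, assumption+)
  have law: "(LINT w|\<Lambda>. reference_cost (xs ! j) (ks j) j (dig w) t) \<le> Vs (xs ! j) + 4 * \<epsilon>" if "j < length xs" "0 \<le> t" for j t
    using law0 that by blast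
  interpret P: prob_space \<Lambda> by (rule \<Lambda>(1))
  have sp\<Lambda>: "space \<Lambda> = UNIV" using sets_eq_imp_space_eq[OF \<Lambda>(2)] by simp
  define v where "v d y = follow_digits (xs ! idx y) (row d (idx y)) y" for d y
  define u where "u y w = ctrl (v (dig w) y)" for y w
  have v_dep: "v d y k = v d' y k" if "k \<le> c" "\<And>i. i < row_bound (idx y) c \<Longrightarrow> d i = d' i" for d d' y k c
    unfolding v_def by (intro follow_digits_dep row_dep(1)[OF that(2)]) (use that(1) in auto)
  have meas: "(\<lambda>(y, w, t). u y w t) \<in> restrict_space borel Y \<Otimes>\<^sub>M (\<Lambda> \<Otimes>\<^sub>M half_line) \<rightarrow>\<^sub>M restrict_space borel U"
  proof -
    let ?Z = "restrict_space borel Y \<Otimes>\<^sub>M (\<Lambda> \<Otimes>\<^sub>M half_line)"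
    have my: "fst \<in> ?Z \<rightarrow>\<^sub>M borel" by (rule measurable_compose[OF measurable_fst measurable_restrict_space1]) simp
    have mw: "(\<lambda>z. fst (snd z)) \<in> ?Z \<rightarrow>\<^sub>M borel"
      using measurable_compose[OF measurable_snd measurable_fst, of "restrict_space borel Y" \<Lambda> half_line]
        measurable_cong_sets[OF refl \<Lambda>(2)] by blast
    have mt: "(\<lambda>z. snd (snd z)) \<in> ?Z \<rightarrow>\<^sub>M borel"
      by (rule measurable_compose[OF measurable_compose[OF measurable_snd measurable_snd] measurable_restrict_space1]) simp
    have mi: "(\<lambda>z. idx (fst z)) \<in> ?Z \<rightarrow>\<^sub>M count_space UNIV" by (rule measurable_compose[OF my xs(2)])
    have mc: "(\<lambda>z. cell (snd (snd z))) \<in> ?Z \<rightarrow>\<^sub>M count_space UNIV" by (rule measurable_compose[OF mt cell_measurable])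
    have "(\<lambda>z. ctrl (v (dig (fst (snd z))) (fst z)) (snd (snd z))) \<in> ?Z \<rightarrow>\<^sub>M restrict_space borel U"
    proof (rule digits_measurable[where w="\<lambda>z. fst (snd z)" and n="\<lambda>z. row_bound (idx (fst z)) (cell (snd (snd z)))"
          and \<Phi>="\<lambda>d z. ctrl (v d (fst z)) (snd (snd z))"])
      show "(\<lambda>z. dig (fst (snd z)) k) \<in> ?Z \<rightarrow>\<^sub>M count_space UNIV" for k by (rule measurable_compose[OF mw dig])
      show "(\<lambda>z. row_bound (idx (fst z)) (cell (snd (snd z)))) \<in> ?Z \<rightarrow>\<^sub>M count_space UNIV"
        by (rule measurable_compose_countable[OF measurable_compose_countable[OF _ mi] mc]) simp
      show "(\<lambda>z. ctrl (v d (fst z)) (snd (snd z))) \<in> ?Z \<rightarrow>\<^sub>M restrict_space borel U" for d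
      proof -
        have "(\<lambda>z. B c (follow_digits (xs ! j) (row d j) (fst z) c)) \<in> ?Z \<rightarrow>\<^sub>M restrict_space borel U" for j c
        proof -
          have 1: "B c \<in> count_space UNIV \<rightarrow>\<^sub>M restrict_space borel U" using B_in by (simp add: space_restrict_space)
          show ?thesis by (rule measurable_compose[OF measurable_compose[OF my follow_digits_measurable] 1])
        qed
        then have "(\<lambda>z. B c (follow_digits (xs ! idx (fst z)) (row d (idx (fst z))) (fst z) c)) \<in> ?Z \<rightarrow>\<^sub>M restrict_space borel U" for c
          by (rule measurable_compose_countable[OF _ mi])
        then have "(\<lambda>z. B (cell (snd (snd z))) (follow_digits (xs ! idx (fst z)) (row d (idx (fst z))) (fst z) (cell (snd (snd z))))) \<in> ?Z \<rightarrow>\<^sub>M restrict_space borel U"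
          by (rule measurable_compose_countable[OF _ mc])
        then show ?thesis by (simp add: ctrl_def v_def)
      qed
      show "ctrl (v d (fst z)) (snd (snd z)) = ctrl (v d' (fst z)) (snd (snd z))"
        if "\<And>k. k < row_bound (idx (fst z)) (cell (snd (snd z))) \<Longrightarrow> d k = d' k" for z d d'
        unfolding ctrl_def using v_dep[OF order_refl that] by simp
    qed
    then show ?thesis by (simp add: u_def split_def)
  qed
  have "completely_metrizable_space (euclidean :: real topology)"
    by (rule completely_metrizable_space_euclidean)
  moreover have "second_countable (euclidean :: real topology)"
  proof -
    obtain B :: "real set set" where B: "countable B" "topological_basis B" using ex_countable_basis by blast
    have "\<exists>V\<in>B. x \<in> V \<and> V \<subseteq> W" if "open W" "x \<in> W" for W x
      by (rule topological_basisE[OF B(2) that]) blast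
    then show ?thesis unfolding second_countable_def
      using B topological_basis_open by (intro exI[of _ B]) auto
  qed
  moreover have "sets \<Lambda> = sigma_sets (space \<Lambda>) {V. openin (euclidean :: real topology) V}"
    unfolding \<Lambda>(2) sp\<Lambda> sets_borel by simp
  ultimately have "standard_borel \<Lambda>" unfolding standard_borel_def using sp\<Lambda> by (intro exI[of _ euclidean]) simp
  then have rc: "random_control U Y \<Lambda> u" unfolding random_control_def using \<Lambda>(1) meas by simp
  have "random_payoff f g \<theta> y \<Lambda> u \<le> Vs y + 7 * \<epsilon>"
    if \<theta>: "\<theta> \<in> evaluations" and TV: "\<And>s. 0 \<le> s \<Longrightarrow> s \<le> S \<Longrightarrow> TV s \<theta> \<le> \<epsilon> / (4 * M)" and y: "y \<in> Y" for \<theta> y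
  proof -
    interpret Q: prob_space \<theta> by (rule evaluationsD(1)[OF \<theta>])
    interpret PQ: pair_prob_space \<Lambda> \<theta> ..
    define j z where "j = idx y" and "z = xs ! j"
    have j: "j < length xs" "z \<in> Y" "norm (z - y) \<le> h" "norm (y - z) \<le> h"
      using idx[OF y] xsY by (auto simp: j_def z_def dist_norm norm_minus_commute)
    define R where "R d t = reference_cost z (ks j) j d t" for d t
    have Rm: "R d \<in> borel_measurable half_line" for d
    proof -
      have "(\<lambda>t. cost (ctrl (row d j)) z (t + \<tau> (ks j (d (prod_encode (j, 0)))))) \<in> borel_measurable half_line"
        by (rule cost_shift_measurable[OF j(2) ctrl_in_controls \<tau>_nonneg])
      then show ?thesis by (simp add: R_def[abs_def] reference_cost_def)
    qed
    have Rint: "integrable (\<Lambda> \<Otimes>\<^sub>M \<theta>) (\<lambda>(w, t). R (dig w) t)"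
    proof (rule integrable_on_digits[OF \<Lambda> dig \<theta>, where n="\<lambda>t. row_bound j (cell (t + S))"])
      have "(\<lambda>t. cell (t + S)) \<in> borel \<rightarrow>\<^sub>M count_space UNIV"
        by (rule measurable_compose[OF _ cell_measurable]) simp
      then show "(\<lambda>t. row_bound j (cell (t + S))) \<in> borel \<rightarrow>\<^sub>M count_space UNIV" by (rule measurable_compose) simp
      show "R d \<in> borel_measurable half_line" for d by (rule Rm)
      show "\<bar>R d t\<bar> \<le> M" for d t unfolding R_def reference_cost_def by (rule G_bound)
      show "R d t = R d' t" if "0 \<le> t" "\<And>i. i < row_bound j (cell (t + S)) \<Longrightarrow> d i = d' i" for t d d'
        unfolding R_def by (rule reference_cost_dep[OF that(2) S(2) that(1)])
    qed
    have Cint: "integrable (\<Lambda> \<Otimes>\<^sub>M \<theta>) (\<lambda>(w, t). cost (ctrl (v (dig w) y)) y t)"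
    proof (rule integrable_on_digits[OF \<Lambda> dig \<theta>, where n="\<lambda>t. row_bound j (cell t)" and \<Phi>="\<lambda>d t. cost (ctrl (v d y)) y t"])
      show "(\<lambda>t. row_bound j (cell t)) \<in> borel \<rightarrow>\<^sub>M count_space UNIV" by (rule measurable_compose[OF cell_measurable]) simp
      show "cost (ctrl (v d y)) y \<in> borel_measurable half_line" for d by (rule cost_measurable[OF y ctrl_in_controls])
      show "\<bar>cost (ctrl (v d y)) y t\<bar> \<le> M" for d t by (rule G_bound)
      show "cost (ctrl (v d y)) y t = cost (ctrl (v d' y)) y t" if t: "0 \<le> t" and dd: "\<And>i. i < row_bound j (cell t) \<Longrightarrow> d i = d' i" for t d d'
      proof -
        have "path (v d y) y t = path (v d' y) y t"
          by (rule path_dep[OF _ t], rule v_dep[of _ "cell t"]) (use dd in \<open>auto simp: j_def\<close>)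
        then show ?thesis by simp
      qed
    qed
    have pt: "payoff f g \<theta> y (u y w) \<le> (LINT t|\<theta>. R (dig w) t) + 2 * \<epsilon>" for w
    proof -
      let ?d = "dig w"
      have "payoff f g \<theta> y (u y w) = (LINT t|\<theta>. cost (ctrl (v ?d y)) y t)"
        unfolding u_def by (rule payoff_eq[OF \<theta> ctrl_in_controls])
      also have "\<dots> \<le> (LINT t|\<theta>. cost (ctrl (row ?d j)) z t) + \<epsilon>"
      proof (rule integral_evaluation_mono[OF \<theta> cost_measurable[OF y ctrl_in_controls] cost_measurable[OF j(2) ctrl_in_controls] G_bound G_bound])
        fix t :: real assume "0 \<le> t"
        from follow_close[OF j(2) y j(3) this, of "row ?d j"]
        show "cost (ctrl (v ?d y)) y t \<le> cost (ctrl (row ?d j)) z t + \<epsilon>"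
          unfolding v_def j_def[symmetric] z_def[symmetric] by (simp add: abs_le_iff)
      qed
      finally have 1: "payoff f g \<theta> y (u y w) \<le> (LINT t|\<theta>. cost (ctrl (row ?d j)) z t) + \<epsilon>" .
      let ?s = "\<tau> (ks j (?d (prod_encode (j, 0))))"
      have "\<bar>(LINT t|\<theta>. cost (ctrl (row ?d j)) z (t + ?s)) - (LINT t|\<theta>. cost (ctrl (row ?d j)) z t)\<bar> \<le> 4 * M * TV ?s \<theta>"
        by (rule integral_shift_TV[OF \<theta> cost_measurable[OF j(2) ctrl_in_controls] M_pos G_bound \<tau>_nonneg])
      also have "\<dots> \<le> 4 * M * (\<epsilon> / (4 * M))"
        using TV[OF \<tau>_nonneg S(2)] M_pos by (intro mult_left_mono) auto
      also have "\<dots> = \<epsilon>" using M_pos by simp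
      finally show ?thesis using 1 unfolding R_def reference_cost_def by linarith
    qed
    have pint: "integrable \<Lambda> (\<lambda>w. payoff f g \<theta> y (u y w))"
      unfolding u_def payoff_eq[OF \<theta> ctrl_in_controls] using PQ.integrable_fst[OF Cint] .
    have Rint1: "integrable \<Lambda> (\<lambda>w. LINT t|\<theta>. R (dig w) t)" using PQ.integrable_fst[OF Rint] .
    have "random_payoff f g \<theta> y \<Lambda> u \<le> (LINT w|\<Lambda>. (LINT t|\<theta>. R (dig w) t) + 2 * \<epsilon>)"
      unfolding random_payoff_def by (rule integral_mono[OF pint]) (use Rint1 pt in auto)
    also have "\<dots> = (LINT w|\<Lambda>. (LINT t|\<theta>. R (dig w) t)) + 2 * \<epsilon>" using Rint1 by (simp add: P.prob_space)
    also have "(LINT w|\<Lambda>. (LINT t|\<theta>. R (dig w) t)) = (LINT t|\<theta>. (LINT w|\<Lambda>. R (dig w) t))"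
      by (rule PQ.Fubini_integral[OF Rint, symmetric])
    also have "\<dots> \<le> (LINT t|\<theta>. Vs z + 4 * \<epsilon>)"
    proof (rule integral_mono)
      show "integrable \<theta> (\<lambda>t. LINT w|\<Lambda>. R (dig w) t)" using PQ.integrable_snd[OF Rint] .
      show "(LINT w|\<Lambda>. R (dig w) t) \<le> Vs z + 4 * \<epsilon>" if "t \<in> space \<theta>" for t
        unfolding R_def z_def by (rule law[OF j(1)]) (use that evaluationsD(3)[OF \<theta>] in auto)
    qed simp
    also have "\<dots> = Vs z + 4 * \<epsilon>" by (simp add: Q.prob_space)
    also have "Vs z \<le> Vs y + \<epsilon>" by (rule Vs_near[OF y j(2) j(4)])
    finally show ?thesis by simp
  qed
  then show ?thesis using S(1) rc by blast
qed

end

theorem proposition3p6: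
  fixes U :: "'u::{metric_space, second_countable_topology} set"
    and f :: "'a::euclidean_space \<Rightarrow> 'u \<Rightarrow> 'a"
    and g :: "'a \<Rightarrow> 'u \<Rightarrow> real"
    and Y :: "'a set"
  assumes "compact_nonexpansive U f g Y"
  shows "general_uniform_value U f g Y (V_star U f g) \<and>
         (\<forall>\<beta>\<in>{0<..<1}. \<forall>y0\<in>Y.
           ((\<lambda>\<rho>. weighted_value U f g \<rho> \<beta> y0) \<longlongrightarrow> V_star U f g y0) (at_right 0))"
proof -
  interpret compact_nonexpansive_problem U f g Y
    by (rule compact_nonexpansive_problem.intro[OF assms])
  have "\<exists>\<eta>>0. \<exists>S>0. \<forall>\<theta>\<in>evaluations. (SUP s\<in>{0..S}. TV s \<theta>) \<le> \<eta> \<longrightarrow>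
        (\<forall>y0\<in>Y. \<bar>eval_value U f g \<theta> y0 - V_star U f g y0\<bar> \<le> e)" if e: "0 < e" for e
  proof -
    obtain \<eta> S where S: "0 < \<eta>" "0 < S"
      "\<And>\<theta> y. \<theta> \<in> evaluations \<Longrightarrow> (\<And>s. 0 \<le> s \<Longrightarrow> s \<le> S \<Longrightarrow> TV s \<theta> \<le> \<eta>) \<Longrightarrow> y \<in> Y \<Longrightarrow> \<bar>V \<theta> y - Vs y\<bar> \<le> e"
      using limit_value_uniform[OF e] by blast
    have "\<bar>V \<theta> y - Vs y\<bar> \<le> e" if "\<theta> \<in> evaluations" "(SUP s\<in>{0..S}. TV s \<theta>) \<le> \<eta>" "y \<in> Y" for \<theta> y
      by (rule S(3)[OF that(1) TV_le_SUP[OF that(1,2)] that(3)])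
    then show ?thesis using S(1,2) by blast
  qed
  moreover have "\<exists>\<eta>>0. \<exists>S>0. \<exists>(\<Lambda> :: real measure) u. random_control U Y \<Lambda> u \<and>
        (\<forall>\<theta>\<in>evaluations. (SUP s\<in>{0..S}. TV s \<theta>) \<le> \<eta> \<longrightarrow>
          (\<forall>y0\<in>Y. random_payoff f g \<theta> y0 \<Lambda> u \<le> V_star U f g y0 + e))" if e: "0 < e" for e
  proof -
    obtain h where "fine_grid U f g Y h (e / 7)" using fine_grid_exists[of "e / 7"] e by auto
    then interpret fine_grid U f g Y h "e / 7" .
    obtain S and \<Lambda> :: "real measure" and u where S: "0 < S" "random_control U Y \<Lambda> u"
      and R: "\<forall>\<theta>\<in>evaluations. (\<forall>s. 0 \<le> s \<longrightarrow> s \<le> S \<longrightarrow> TV s \<theta> \<le> e / 7 / (4 * M)) \<longrightarrow>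
        (\<forall>y\<in>Y. random_payoff f g \<theta> y \<Lambda> u \<le> Vs y + 7 * (e / 7))"
      using random_control_exists by blast
    have "random_payoff f g \<theta> y \<Lambda> u \<le> Vs y + e"
      if \<theta>: "\<theta> \<in> evaluations" and TV: "(SUP s\<in>{0..S}. TV s \<theta>) \<le> e / 7 / (4 * M)" and y: "y \<in> Y" for \<theta> y
    proof -
      have "\<forall>s. 0 \<le> s \<longrightarrow> s \<le> S \<longrightarrow> TV s \<theta> \<le> e / 7 / (4 * M)" using TV_le_SUP[OF \<theta> TV] by blast
      then have "random_payoff f g \<theta> y \<Lambda> u \<le> Vs y + 7 * (e / 7)" using R \<theta> y by blast
      then show ?thesis by simp
    qed
    moreover have "0 < e / 7 / (4 * M)" using e M_pos by simp
    ultimately show ?thesis using S by blast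
  qed
  ultimately have "general_uniform_value U f g Y (V_star U f g)"
    unfolding general_uniform_value_def by blast
  then show ?thesis using weighted_limit by blast
qed

end
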